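(* Let $n=p$ be a prime number or let $n=4$. Let $G$ be a solvable subgroup of $\mathcal{A}_n=\mathrm{Aut}(T_n)$ which contains the $n$-ary adding machine $\tau$. Then there is an integer $i\ge 0$ such that $G$ is conjugate in $\mathcal{A}_n$ to a subgroup of $\Gamma_i$.
   Context: Let $n\ge 2$, $Y=\{0,1,\dots,n-1\}$, and let $T_n$ be the regular rooted $n$-ary tree whose vertices are the finite words over $Y$ (root = empty word). $\mathcal{A}_n=\mathrm{Aut}(T_n)$. Automorphisms act on the right, $\alpha\beta$ means first $\alpha$ then $\beta$, and $e$ is the identity. $\Sigma_n$ is the symmetric group on $Y$. Each $\alpha\in\mathcal{A}_n$ is written $\alpha=(\alpha|_0,\dots,\alpha|_{n-1})\sigma_\alpha$, where $\sigma_\alpha\in\Sigma_n$ and $\alpha|_i\in\mathcal{A}_n$ are determined by $(iu)\alpha=(i)\sigma_\alpha\cdot (u)\alpha|_i$ for $i\in Y$ and every word $u$. A permutation $\pi\in\Sigma_n$ is identified with the rigid automorphism $(e,\dots,e)\pi$. The $n$-ary adding machine is $\tau=(e,\dots,e,\tau)\sigma$, where $\sigma=(0,1,\dots,n-1)$ is the cycle $i\mapsto i+1 \pmod n$. $\overline{\langle\tau\rangle}$ is the closure of $\langle\tau\rangle$ in $\mathcal{A}_n$ for the profinite topology (defined by the level stabilizers of the tree). The groups $\Gamma_i$ are defined by $\Gamma_0=N_{\mathcal{A}_n}(\overline{\langle\tau\rangle})$ (normalizer in $\mathcal{A}_n$) and $\Gamma_{i+1}=(\times_n\Gamma_i)\rtimes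 G_{i+1}=\{(g_0,\dots,g_{n-1})\pi : g_0,\dots,g_{n-1}\in\Gamma_i,\ \pi\in G_{i+1}\}$ for $i\ge 0$. Here, if $n=p$ is prime, every $G_{i}$ is $F=N_{\Sigma_p}(\langle\sigma\rangle)$ (of order $p(p-1)$), and if $n=4$, every $G_i$ is $\Sigma_4$. *)

theory Defs
  imports
    "HOL-Computational_Algebra.Primes"
    "HOL-Analysis.Abstract_Topology"
    "HOL-Combinatorics.Permutations"
    "HOL-Algebra.Solvable_Groups"
    "HOL-Algebra.Group_Action"
begin

text \<open>
  Permutations of \<open>S\<close> are total functions that are the identity outside \<open>S\<close>. The product acts
  from the right: \<open>f \<otimes> g\<close> is first \<open>f\<close>, then \<open>g\<close>.
\<close>

definition perm_group :: "'a set \<Rightarrow> ('a \<Rightarrow> 'a) monoid"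
  where "perm_group S = \<lparr>carrier = {f. f permutes S}, mult = (\<lambda>f g. g \<circ> f), one = id\<rparr>"

definition words :: "nat \<Rightarrow> nat list set"
  where "words n = lists {..<n}"

definition tree_adj :: "nat list \<Rightarrow> nat list \<Rightarrow> bool"
  where "tree_adj u v \<longleftrightarrow> (\<exists>x. v = u @ [x]) \<or> (\<exists>x. u = v @ [x])"

definition tree_automorphism :: "nat \<Rightarrow> (nat list \<Rightarrow> nat list) \<Rightarrow> bool"
  where "tree_automorphism n f \<longleftrightarrow> f permutes words n \<and> f [] = [] \<and>
    (\<forall>u\<in>words n. \<forall>v\<in>words n. tree_adj (f u) (f v) \<longleftrightarrow> tree_adj u v)"

definition tree_aut :: "nat \<Rightarrow> (nat list \<Rightarrow> nat list) monoid"
  where "tree_aut n = (perm_group (words n)) \<lparr>carrier := {f. tree_automorphism n f}\<rparr>"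

text \<open>\<open>wreath n g \<pi>\<close> is the map \<open>(g\<^sub>0, \<dots>, g\<^sub>n\<^sub>-\<^sub>1)\<pi>\<close>, sending \<open>iu\<close> to \<open>(i)\<pi> \<cdot> (u)g\<^sub>i\<close>.\<close>

definition wreath ::
  "nat \<Rightarrow> (nat \<Rightarrow> nat list \<Rightarrow> nat list) \<Rightarrow> (nat \<Rightarrow> nat) \<Rightarrow> nat list \<Rightarrow> nat list"
  where "wreath n g \<pi> w =
    (if w \<in> words n then (case w of [] \<Rightarrow> [] | i # u \<Rightarrow> \<pi> i # g i u) else w)"

definition cyc :: "nat \<Rightarrow> nat \<Rightarrow> nat"
  where "cyc n i = (if i < n then Suc i mod n else i)"

text \<open>
  The recursion solves \<open>\<tau> = (e, \<dots>, e, \<tau>)\<sigma>\<close> on words; outside the tree, \<open>\<tau>\<close> has to be the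
  identity in order to belong to \<^term>\<open>carrier (tree_aut n)\<close>.
\<close>

fun odometer :: "nat \<Rightarrow> nat list \<Rightarrow> nat list"
  where
    "odometer n [] = []"
  | "odometer n (i # u) = cyc n i # (if i = n - 1 then odometer n u else u)"

definition adding_machine :: "nat \<Rightarrow> nat list \<Rightarrow> nat list"
  where "adding_machine n w = (if w \<in> words n then odometer n w else w)"

definition level_stabilizer :: "nat \<Rightarrow> nat \<Rightarrow> (nat list \<Rightarrow> nat list) set"
  where "level_stabilizer n k =
    {f \<in> carrier (tree_aut n). \<forall>w\<in>words n. length w = k \<longrightarrow> f w = w}"

definition profinite_topology :: "nat \<Rightarrow> (nat list \<Rightarrow> nat list) topology"
  where "profinite_topology n = topology_generated_by
    {f <#\<^bsub>tree_aut n\<^esub> level_stabilizer n k | f k. f \<in> carrier (tree_aut n)}"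

text \<open>
  The group \<open>G\<^sub>i\<close> of root permutations, independent of \<open>i\<close>: \<open>\<Sigma>\<^sub>4\<close> for \<open>n = 4\<close> and
  \<open>N(\<langle>\<sigma>\<rangle>)\<close> for \<open>n\<close> prime. The value for other \<open>n\<close> carries no meaning.
\<close>

definition top_group :: "nat \<Rightarrow> (nat \<Rightarrow> nat) set"
  where "top_group n =
    (if n = 4 then carrier (perm_group {..<n})
     else normalizer (perm_group {..<n}) (generate (perm_group {..<n}) {cyc n}))"

fun Gamma :: "nat \<Rightarrow> nat \<Rightarrow> (nat list \<Rightarrow> nat list) set"
  where
    "Gamma n 0 = normalizer (tree_aut n)
      (profinite_topology n closure_of generate (tree_aut n) {adding_machine n})"
  | "Gamma n (Suc i) = {wreath n g \<pi> | g \<pi>. (\<forall>j<n. g j \<in> Gamma n i) \<and> \<pi> \<in> top_group n}"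

end

theory Submission
  imports Defs "HOL-Number_Theory.Number_Theory"
begin

text \<open>
  Write \<open>\<tau>\<close> for the adding machine. For \<open>0 < i < n\<close> the power \<open>\<tau>\<^sup>i\<close>
  moves the letter \<open>0\<close> to \<open>i\<close> with trivial state at \<open>0\<close>, so every state of every element of \<open>G\<close>
  already occurs as a state at \<open>0\<close> of an element of \<open>G\<close> that fixes the letter \<open>0\<close>. These states
  form a group, the branch of \<open>G\<close>, which again contains \<open>\<tau>\<close>, and \<open>G\<close> lies in the wreath product
  of its branch with its group of root permutations. For prime \<open>n\<close> the latter normalizes
  \<open>\<langle>\<sigma>\<rangle>\<close> (Galois: the last term of a derived series with nontrivial root action acts as an abelian
  group normalized by an \<open>n\<close>-cycle, hence as \<open>\<langle>\<sigma>\<rangle>\<close>; \<open>root_in_top_group\<close>). So if the branch of \<open>G\<close> is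
  conjugate into \<open>\<Gamma>\<^sub>i\<close>, then \<open>G\<close> is conjugate into \<open>\<Gamma>\<^sub>i\<^sub>+\<^sub>1\<close> (\<open>conj_into_Gamma_branch\<close>).

  Let \<open>B\<close> be the last nontrivial term of the derived series, an abelian normal subgroup. Pass to
  branches, replacing \<open>B\<close> by the group \<open>B'\<close> of states at \<open>0\<close> of those elements of \<open>B\<close> that fix the
  first level; \<open>B'\<close> is abelian and normal in the branch of \<open>G\<close>. As \<open>B\<close> is not trivial, some
  iterate acts nontrivially on the first level. From then on the action of \<open>B\<close> on the first level
  contains \<open>\<sigma>\<close>, after one more step if \<open>n = 4\<close> (\<open>good_pair_branch1\<close>):

  \<^item> For prime \<open>n\<close>, a nontrivial abelian permutation group of degree \<open>n\<close> normalized by \<open>\<sigma>\<close> is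
    \<open>\<langle>\<sigma>\<rangle>\<close>. If \<open>b \<in> B\<close> acts as \<open>\<sigma>\<close> and \<open>B'\<close> acted trivially on its first level, then \<open>b\<close> would
    commute with \<open>\<tau>\<close> on the second level, so it would be a power \<open>\<tau>\<^sup>j\<close> there; but \<open>b\<^sup>n\<close> is trivial on
    that level, so \<open>n\<close> divides \<open>j\<close>, a contradiction.

  \<^item> For \<open>n = 4\<close>, a nontrivial abelian permutation group of degree 4 normalized by \<open>\<sigma>\<close> contains
    \<open>\<sigma>\<^sup>2\<close>. If \<open>b \<in> B\<close> acts as \<open>\<sigma>\<^sup>2\<close>, then modulo \<open>B'\<close> the states of \<open>b\<close> are \<open>c, c, \<tau>c, \<tau>c\<close>, and
    \<open>b\<^sup>2\<close> shows that \<open>\<tau>c\<^sup>2\<close> is in \<open>B'\<close>. A check of the 24 permutations \<open>c\<close> gives \<open>\<sigma>\<close> in the root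
    action of \<open>B'\<close>.

  Once \<open>\<sigma>\<close> occurs in the root action of every iterate (\<open>good_pair\<close>), \<open>B\<close> is transitive on every
  level, and, being abelian, acts regularly there. Choose \<open>a \<in> B\<close> that agrees with \<open>\<tau>\<close> at
  \<open>00\<close>. Then \<open>\<tau> = as\<close> with \<open>s\<close> fixing \<open>00\<close>, so \<open>\<tau>\<^sup>n\<close> agrees at \<open>00\<close> with the
  product of the conjugates of \<open>a\<close> by \<open>\<tau>\<^sup>0, \<dots>, \<tau>\<^sup>n\<^sup>-\<^sup>1\<close>. Comparing this product with \<open>a\<^sup>n\<close> shows that
  \<open>a\<^sup>n\<close> is transitive one level further down: the correction is a multiple of \<open>n(n-1)/2\<close>, which
  vanishes modulo \<open>p\<close> for odd \<open>n = p\<close> and modulo 2 for \<open>n = 4\<close>. For \<open>n = 2\<close> it need not vanish,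
  and a computation on the third level takes its place (\<open>exists_generating_element_two\<close>).
  Consequently \<open>B\<close> contains an element \<open>b\<close> that is transitive on every level
  (\<open>cyclic_on_level_of_generating\<close>). It is conjugate to \<open>\<tau>\<close> (\<open>conj_to_tau\<close>), the closure of
  \<open>\<langle>\<tau>\<rangle>\<close> is the centralizer of \<open>\<tau>\<close>, which is abelian (\<open>closure_tau\<close>, \<open>centralizer_abelian\<close>), and
  for \<open>g \<in> G\<close> the conjugate of \<open>b\<close> by \<open>g\<close> lies in \<open>B\<close>, so it centralizes \<open>b\<close>. Hence \<open>G\<close> is
  conjugate into the normalizer \<open>\<Gamma>\<^sub>0\<close> (\<open>good_pair_conj_into_Gamma\<close>).

  In the proofs, automorphisms are composed as functions, so \<open>f \<circ> g\<close> is first \<open>g\<close>, then \<open>f\<close>.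
\<close>

section \<open>Conjugation and orbits of a single permutation\<close>

text \<open>
Inverse functions; the plain name is taken by the inverse in a group.
\<close>

abbreviation iv :: "('a \<Rightarrow> 'a) \<Rightarrow> 'a \<Rightarrow> 'a" where "iv f \<equiv> inv_into UNIV f"

text \<open>
  The conjugate \<open>g \<circ> f \<circ> g\<^sup>-\<^sup>1\<close>.
\<close>

definition conj_by :: "('a \<Rightarrow> 'a) \<Rightarrow> ('a \<Rightarrow> 'a) \<Rightarrow> 'a \<Rightarrow> 'a"
  where "conj_by g f = g \<circ> f \<circ> iv g"

lemma funpow_fixpoint_mult: "(f ^^ d) x = x \<Longrightarrow> (f ^^ (d * k)) x = x"
  by (induction k) (simp_all add: funpow_add)

lemma single_orbit_period:
  assumes fin: "finite S" and inj: "inj f" and x: "x \<in> S" and clos: "\<And>y. y \<in> S \<Longrightarrow> f y \<in> S"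
    and tr: "\<And>y. y \<in> S \<Longrightarrow> \<exists>i. (f ^^ i) x = y"
  shows "(f ^^ i) x = x \<longleftrightarrow> card S dvd i"
proof -
  have inS: "(f ^^ i) x \<in> S" for i by (induction i) (auto simp: x clos)
  have injp: "inj (f ^^ i)" for i using inj by (induction i) (auto intro: inj_compose)
  have cancel: "(f ^^ (b - a)) x = x" if "(f ^^ a) x = (f ^^ b) x" "a \<le> b" for a b
  proof -
    have "(f ^^ a) ((f ^^ (b - a)) x) = (f ^^ a) x"
      using that by (simp add: funpow_add[symmetric, THEN fun_cong, unfolded o_apply])
    then show ?thesis using injp[of a] by (simp add: inj_eq)
  qed
  have "\<not> inj (\<lambda>i. (f ^^ i) x)"
  proof
    assume "inj (\<lambda>i. (f ^^ i) x)"
    then have "infinite (range (\<lambda>i. (f ^^ i) x))" by (simp add: finite_image_iff)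
    then show False using fin inS by (metis finite_subset image_subsetI)
  qed
  then obtain a b where ab: "(f ^^ a) x = (f ^^ b) x" "a < b"
    unfolding inj_def by (metis linorder_neqE_nat)
  define P where "P d \<longleftrightarrow> 0 < d \<and> (f ^^ d) x = x" for d
  have "P (b - a)" using ab cancel[of a b] by (simp add: P_def)
  \<comment> \<open>\<open>d\<close> is the length of the orbit\<close>
  define d where "d = (LEAST d. P d)"
  have d: "P d" unfolding d_def by (rule LeastI) fact
  have dle: "d \<le> e" if "P e" for e unfolding d_def by (rule Least_le) fact
  have md: "(f ^^ i) x = (f ^^ (i mod d)) x" for i
  proof -
    have "(f ^^ i) x = (f ^^ (i mod d + d * (i div d))) x" by simp
    also have "\<dots> = (f ^^ (i mod d)) ((f ^^ (d * (i div d))) x)" unfolding funpow_add by simp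
    finally show ?thesis using d funpow_fixpoint_mult[of d f x] by (simp add: P_def)
  qed
  have "inj_on (\<lambda>i. (f ^^ i) x) {..<d}"
  proof (rule linorder_inj_onI')
    fix i j assume ij: "i \<in> {..<d}" "j \<in> {..<d}" "i < j"
    show "(f ^^ i) x \<noteq> (f ^^ j) x"
    proof
      assume "(f ^^ i) x = (f ^^ j) x"
      then have "P (j - i)" using cancel[of i j] ij by (simp add: P_def)
      then show False using dle[of "j - i"] ij by simp
    qed
  qed
  moreover have "(\<lambda>i. (f ^^ i) x) ` {..<d} = S"
  proof
    show "S \<subseteq> (\<lambda>i. (f ^^ i) x) ` {..<d}"
    proof
      fix y assume "y \<in> S"
      then obtain i where "(f ^^ i) x = y" using tr by auto
      then show "y \<in> (\<lambda>i. (f ^^ i) x) ` {..<d}" using md[of i] d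
        by (intro image_eqI[of _ _ "i mod d"]) (auto simp: P_def)
    qed
  qed (use inS in auto)
  ultimately have "card S = d" by (metis card_image card_lessThan)
  moreover have "(f ^^ i) x = x \<longleftrightarrow> i mod d = 0"
  proof
    assume "(f ^^ i) x = x"
    then have "(f ^^ (i mod d)) x = x" using md by simp
    then show "i mod d = 0" using dle[of "i mod d"] d unfolding P_def
      by (metis mod_less_divisor not_le zero_less_iff_neq_zero)
  qed (use md[of i] in simp)
  ultimately show ?thesis by (simp add: mod_eq_0_iff_dvd)
qed

section \<open>Automorphisms of the tree, root permutations and states\<close>

lemma words_simps [simp]:
  "[] \<in> words n" "i # u \<in> words n \<longleftrightarrow> i < n \<and> u \<in> words n"
  "u @ v \<in> words n \<longleftrightarrow> u \<in> words n \<and> v \<in> words n"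
  by (auto simp: words_def)

lemma words_replicate [simp]: "i < n \<Longrightarrow> replicate k i \<in> words n"
  by (induction k) auto

lemma words_butlast: "w \<in> words n \<Longrightarrow> butlast w \<in> words n"
  by (auto simp: words_def dest: in_set_butlastD)

lemma tree_adj_butlast:
  "tree_adj u v \<longleftrightarrow> (v \<noteq> [] \<and> butlast v = u) \<or> (u \<noteq> [] \<and> butlast u = v)"
  unfolding tree_adj_def by (metis append_butlast_last_id butlast_snoc snoc_eq_iff_butlast)

text \<open>
  Preserving adjacency and the root amounts to preserving length and parents.
\<close>

lemma tree_automorphism_iff:
  "tree_automorphism n f \<longleftrightarrow> f permutes words n \<and>
    (\<forall>w\<in>words n. length (f w) = length w \<and> f (butlast w) = butlast (f w))"
proof
  assume A: "tree_automorphism n f"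
  then have p: "f permutes words n" and e: "f [] = []"
    and adj: "\<And>u v. u \<in> words n \<Longrightarrow> v \<in> words n \<Longrightarrow> tree_adj (f u) (f v) \<longleftrightarrow> tree_adj u v"
    unfolding tree_automorphism_def by auto
  have "w \<in> words n \<Longrightarrow> length (f w) = length w \<and> f (butlast w) = butlast (f w)" for w
  proof (induction w rule: rev_induct)
    case Nil
    then show ?case using e by simp
  next
    case (snoc x w)
    then have w: "w \<in> words n" and wx: "w @ [x] \<in> words n" by auto
    have IH: "length (f w) = length w" "f (butlast w) = butlast (f w)" using snoc.IH[OF w] by auto
    have "tree_adj w (w @ [x])" by (simp add: tree_adj_butlast)
    then have "tree_adj (f w) (f (w @ [x]))" using adj w wx by blast
    moreover have "\<not> (f w \<noteq> [] \<and> butlast (f w) = f (w @ [x]))"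
    proof
      assume "f w \<noteq> [] \<and> butlast (f w) = f (w @ [x])"
      then have "f (butlast w) = f (w @ [x])" using IH by simp
      then have "butlast w = w @ [x]" using permutes_inj[OF p] by (simp add: inj_eq)
      then have "length (butlast w) = length (w @ [x])" by simp
      then show False by simp
    qed
    ultimately have "f (w @ [x]) \<noteq> []" "butlast (f (w @ [x])) = f w"
      by (auto simp: tree_adj_butlast)
    then have "Suc (length (f w)) = length (f (w @ [x]))"
      by (metis append_butlast_last_id length_append_singleton)
    then show ?case using IH \<open>butlast (f (w @ [x])) = f w\<close> by simp
  qed
  then show "f permutes words n \<and>
    (\<forall>w\<in>words n. length (f w) = length w \<and> f (butlast w) = butlast (f w))" using p by blast
next
  assume A: "f permutes words n \<and>
    (\<forall>w\<in>words n. length (f w) = length w \<and> f (butlast w) = butlast (f w))"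
  then have p: "f permutes words n"
    and l: "\<And>w. w \<in> words n \<Longrightarrow> length (f w) = length w"
    and b: "\<And>w. w \<in> words n \<Longrightarrow> f (butlast w) = butlast (f w)" by auto
  have nil: "f w = [] \<longleftrightarrow> w = []" if "w \<in> words n" for w using l[OF that] by auto
  have "tree_adj (f u) (f v) \<longleftrightarrow> tree_adj u v" if "u \<in> words n" "v \<in> words n" for u v
    using that by (simp add: tree_adj_butlast nil b[symmetric] inj_eq[OF permutes_inj[OF p]])
  then show "tree_automorphism n f"
    unfolding tree_automorphism_def using p nil[of "[]"] by auto
qed

text \<open>
  The permutation that \<open>f\<close> induces on the first level, extended by the identity.
\<close>

definition root_perm :: "nat \<Rightarrow> (nat list \<Rightarrow> nat list) \<Rightarrow> nat \<Rightarrow> nat"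
  where "root_perm n f i = (if i < n then hd (f [i]) else i)"

text \<open>
  The state \<open>f|\<^sub>i\<close>, that is, the action of \<open>f\<close> on the subtree below the letter \<open>i\<close>, transported to
  the whole tree. It is the identity outside the tree, as the automorphisms are.
\<close>

definition state_at :: "nat \<Rightarrow> (nat list \<Rightarrow> nat list) \<Rightarrow> nat \<Rightarrow> nat list \<Rightarrow> nat list"
  where "state_at n f i u = (if u \<in> words n then tl (f (i # u)) else u)"

text \<open>
  In this locale \<open>rp f\<close> is the root permutation of \<open>f\<close>, \<open>st f i\<close> its state at \<open>i\<close>, and \<open>zs k\<close> is
  the leftmost word of length \<open>k\<close>.
\<close>

locale regular_tree =
  fixes n :: nat
  assumes n2: "2 \<le> n"
begin

abbreviation "rp \<equiv> root_perm n"
abbreviation "st \<equiv> state_at n"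
abbreviation "\<sigma> \<equiv> cyc n"
abbreviation "\<tau> \<equiv> adding_machine n"
abbreviation "zs k \<equiv> replicate k (0::nat)"

definition Aut :: "(nat list \<Rightarrow> nat list) set"
  where "Aut = {f. tree_automorphism n f}"

lemma n_pos [simp]: "0 < n" "Suc 0 < n" "n \<noteq> 0"
  using n2 by auto

lemma AutI:
  assumes "f permutes words n" "\<And>w. w \<in> words n \<Longrightarrow> length (f w) = length w"
    "\<And>w. w \<in> words n \<Longrightarrow> f (butlast w) = butlast (f w)"
  shows "f \<in> Aut"
  using assms by (simp add: Aut_def tree_automorphism_iff)

lemma AutD:
  assumes "f \<in> Aut"
  shows Aut_permutes: "f permutes words n"
    and Aut_length: "w \<in> words n \<Longrightarrow> length (f w) = length w"
    and Aut_butlast: "w \<in> words n \<Longrightarrow> f (butlast w) = butlast (f w)"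
    and Aut_bij: "bij f" and Aut_inj: "inj f"
    and Aut_words: "f w \<in> words n \<longleftrightarrow> w \<in> words n"
    and Aut_outside: "w \<notin> words n \<Longrightarrow> f w = w"
  using assms by (auto simp: Aut_def tree_automorphism_iff permutes_bij permutes_inj permutes_in_image
    permutes_not_in)

lemma iv_left [simp]: "f \<in> Aut \<Longrightarrow> iv f (f x) = x"
  by (simp add: Aut_inj)

lemma iv_right [simp]: "f \<in> Aut \<Longrightarrow> f (iv f x) = x"
  by (simp add: Aut_bij bij_is_surj surj_f_inv_f)

lemma iv_comp [simp]: "f \<in> Aut \<Longrightarrow> iv f \<circ> f = id" "f \<in> Aut \<Longrightarrow> f \<circ> iv f = id"
  by (auto simp: fun_eq_iff)

lemma id_Aut [simp]: "id \<in> Aut"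
  by (rule AutI) auto

lemma comp_Aut [simp]: "f \<in> Aut \<Longrightarrow> g \<in> Aut \<Longrightarrow> f \<circ> g \<in> Aut"
  by (rule AutI) (auto simp: permutes_compose AutD)

lemma iv_Aut [simp]:
  assumes f: "f \<in> Aut" shows "iv f \<in> Aut"
proof (rule AutI)
  show p: "iv f permutes words n" using f by (simp add: permutes_inv AutD)
  fix w assume "w \<in> words n"
  then have v: "iv f w \<in> words n" using p by (simp add: permutes_in_image)
  show "length (iv f w) = length w" using Aut_length[OF f v] f by simp
  have "f (butlast (iv f w)) = butlast w" using Aut_butlast[OF f v] f by simp
  then show "iv f (butlast w) = butlast (iv f w)" using f by (metis iv_left)
qed

lemma funpow_Aut [simp]: "f \<in> Aut \<Longrightarrow> f ^^ k \<in> Aut"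
  by (induction k) (auto simp del: funpow.simps(2) simp: funpow.simps(2)[unfolded o_def[symmetric]])

lemma iv_iv [simp]: "f \<in> Aut \<Longrightarrow> iv (iv f) = f"
  by (simp add: Aut_bij inv_inv_eq)

lemma iv_distrib: "f \<in> Aut \<Longrightarrow> g \<in> Aut \<Longrightarrow> iv (f \<circ> g) = iv g \<circ> iv f"
  by (simp add: Aut_bij o_inv_distrib)

lemma Aut_take:
  assumes "f \<in> Aut" "u @ v \<in> words n"
  shows "take (length u) (f (u @ v)) = f u"
  using assms(2)
proof (induction v rule: rev_induct)
  case Nil
  then show ?case using assms by (simp add: Aut_length)
next
  case (snoc x v)
  have "butlast (f ((u @ v) @ [x])) = f (u @ v)" using Aut_butlast[OF assms(1) snoc.prems] by (simp add: butlast_append)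
  moreover have "length (f (u @ v @ [x])) = length u + length v + 1"
    using Aut_length[OF assms(1) snoc.prems] by simp
  ultimately have "f (u @ v @ [x]) = f (u @ v) @ [last (f (u @ v @ [x]))]"
    by (metis Suc_eq_plus1 append.assoc append_butlast_last_id length_0_conv nat.distinct(1))
  moreover have "length (f (u @ v)) = length u + length v" using snoc.prems by (simp add: Aut_length[OF assms(1)])
  ultimately have "take (length u) (f (u @ v @ [x])) = take (length u) (f (u @ v))"
    by (metis append_take_drop_id le_add1 append_assoc length_append_singleton take_append
        cancel_comm_monoid_add_class.diff_cancel diff_is_0_eq take0 append_Nil2)
  then show ?case using snoc by simp
qed

lemma Aut_Nil [simp]: "f \<in> Aut \<Longrightarrow> f [] = []"
  using Aut_length[of f "[]"] by simp

lemma Aut_Cons: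
  assumes "f \<in> Aut" "i < n" "u \<in> words n"
  shows "f (i # u) = rp f i # st f i u"
proof -
  have "take 1 (f (i # u)) = f [i]" using Aut_take[OF assms(1), of "[i]" u] assms by simp
  moreover have "length (f (i # u)) = Suc (length u)" using Aut_length[OF assms(1), of "i # u"] assms by simp
  ultimately obtain a v where av: "f (i # u) = a # v" "f [i] = [a]" by (cases "f (i # u)") auto
  then show ?thesis using assms by (simp add: root_perm_def state_at_def)
qed

lemma root_less [simp]: "f \<in> Aut \<Longrightarrow> rp f i < n \<longleftrightarrow> i < n"
proof (cases "i < n")
  case True
  assume f: "f \<in> Aut"
  have "f [i] \<in> words n" using Aut_words[OF f, of "[i]"] True by simp
  then show ?thesis unfolding Aut_Cons[OF f True words_simps(1)] using True by simp
qed (simp add: root_perm_def)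

lemma state_words [simp]: "f \<in> Aut \<Longrightarrow> i < n \<Longrightarrow> st f i u \<in> words n \<longleftrightarrow> u \<in> words n"
proof (cases "u \<in> words n")
  case True
  assume f: "f \<in> Aut" and i: "i < n"
  have "f (i # u) \<in> words n" using Aut_words[OF f, of "i # u"] True i by simp
  then show ?thesis unfolding Aut_Cons[OF f i True] using True by simp
qed (simp add: state_at_def)

lemma Aut_eqI:
  assumes "f \<in> Aut" "g \<in> Aut" "\<And>w. w \<in> words n \<Longrightarrow> f w = g w" shows "f = g"
  using assms by (auto simp: fun_eq_iff) (metis Aut_outside)

lemma root_outside [simp]: "\<not> i < n \<Longrightarrow> rp f i = i"
  by (simp add: root_perm_def)

lemma root_id [simp]: "rp id = id"
  by (auto simp: root_perm_def)

lemma state_id [simp]: "st id i = id"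
  by (auto simp: state_at_def fun_eq_iff)

lemma root_comp: "f \<in> Aut \<Longrightarrow> g \<in> Aut \<Longrightarrow> rp (f \<circ> g) = rp f \<circ> rp g"
proof
  fix i assume a: "f \<in> Aut" "g \<in> Aut"
  show "rp (f \<circ> g) i = (rp f \<circ> rp g) i"
  proof (cases "i < n")
    case True
    then have "(f \<circ> g) [i] = rp f (rp g i) # st f (rp g i) (st g i [])"
      using a by (simp add: Aut_Cons)
    then show ?thesis using True Aut_Cons[of "f \<circ> g" i "[]"] a by simp
  qed simp
qed

lemma state_comp:
  assumes a: "f \<in> Aut" "g \<in> Aut" "i < n"
  shows "st (f \<circ> g) i = st f (rp g i) \<circ> st g i"
proof
  fix u show "st (f \<circ> g) i u = (st f (rp g i) \<circ> st g i) u"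
  proof (cases "u \<in> words n")
    case True
    then have "(f \<circ> g) (i # u) = rp f (rp g i) # st f (rp g i) (st g i u)"
      using a by (simp add: Aut_Cons)
    then show ?thesis using True Aut_Cons[of "f \<circ> g" i u] a by simp
  qed (simp add: state_at_def)
qed

lemma root_iv_left: "f \<in> Aut \<Longrightarrow> rp (iv f) \<circ> rp f = id"
  using root_comp[of "iv f" f] by simp

lemma root_iv_right: "f \<in> Aut \<Longrightarrow> rp f \<circ> rp (iv f) = id"
  using root_comp[of f "iv f"] by simp

lemma root_bij: "f \<in> Aut \<Longrightarrow> bij (rp f)"
  using root_iv_left root_iv_right o_bij by blast

lemma root_iv: "f \<in> Aut \<Longrightarrow> rp (iv f) = iv (rp f)"
  using root_iv_left root_iv_right inv_unique_comp by metis

lemma root_permutes: "f \<in> Aut \<Longrightarrow> rp f permutes {..<n}"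
  using root_bij[of f] unfolding permutes_def by (auto simp: bij_iff)

lemma root_iv_app [simp]: "f \<in> Aut \<Longrightarrow> rp (iv f) (rp f i) = i" "f \<in> Aut \<Longrightarrow> rp f (rp (iv f) i) = i"
  using root_iv_left[of f] root_iv_right[of f] by (auto simp: fun_eq_iff)

lemma state_iv_left: "f \<in> Aut \<Longrightarrow> i < n \<Longrightarrow> st (iv f) (rp f i) \<circ> st f i = id"
  using state_comp[of "iv f" f i] by simp

lemma state_iv_right: "f \<in> Aut \<Longrightarrow> i < n \<Longrightarrow> st f i \<circ> st (iv f) (rp f i) = id"
  using state_comp[of f "iv f" "rp f i"] by simp

lemma state_bij: "f \<in> Aut \<Longrightarrow> i < n \<Longrightarrow> bij (st f i)"
  using state_iv_left state_iv_right o_bij by blast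

lemma state_iv: "f \<in> Aut \<Longrightarrow> i < n \<Longrightarrow> st (iv f) (rp f i) = iv (st f i)"
  using state_iv_left state_iv_right inv_unique_comp by metis

lemma state_Aut [simp]:
  assumes f: "f \<in> Aut" and i: "i < n" shows "st f i \<in> Aut"
proof (rule AutI)
  have "bij_betw (st f i) (words n) (words n)"
    unfolding bij_betw_def
  proof
    show "inj_on (st f i) (words n)" using state_bij[OF f i] by (meson bij_is_inj inj_on_subset subset_UNIV)
    show "st f i ` words n = words n"
    proof
      show "words n \<subseteq> st f i ` words n"
      proof
        fix w assume w: "w \<in> words n"
        obtain v where v: "w = st f i v" using state_bij[OF f i] by (metis bij_pointE)
        then have "v \<in> words n" using w f i by simp
        then show "w \<in> st f i ` words n" using v by blast
      qed
    qed (use f i in auto)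
  qed
  then show "st f i permutes words n" by (rule bij_imp_permutes) (simp add: state_at_def)
  fix w assume w: "w \<in> words n"
  show "length (st f i w) = length w"
    using Aut_length[OF f, of "i # w"] Aut_Cons[OF f i w] i w by simp
  show "st f i (butlast w) = butlast (st f i w)"
  proof (cases "w = []")
    case True
    have "length (f [i]) = 1" using Aut_length[OF f, of "[i]"] i by simp
    then show ?thesis using True by (cases "f [i]") (auto simp: state_at_def)
  next
    case False
    then have "butlast (i # w) = i # butlast w" by simp
    then have "f (i # butlast w) = butlast (f (i # w))" using Aut_butlast[OF f, of "i # w"] i w by simp
    moreover have "st f i w \<noteq> []"
      using Aut_length[OF f, of "i # w"] Aut_Cons[OF f i w] i w False by auto
    ultimately show ?thesis using Aut_Cons[OF f i w] Aut_Cons[OF f i words_butlast[OF w]] by simp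
  qed
qed

lemma Aut_root_state_eqI:
  assumes "f \<in> Aut" "g \<in> Aut" "rp f = rp g" "\<And>i. i < n \<Longrightarrow> st f i = st g i"
  shows "f = g"
proof (rule Aut_eqI)
  fix w assume "w \<in> words n"
  then show "f w = g w" using assms by (cases w) (auto simp: Aut_Cons)
qed fact+

lemma wreath_Aut [simp]:
  assumes g: "\<And>i. i < n \<Longrightarrow> g i \<in> Aut" and p: "\<pi> permutes {..<n}"
  shows "wreath n g \<pi> \<in> Aut"
proof (rule AutI)
  have pl: "\<pi> i < n \<longleftrightarrow> i < n" for i using permutes_in_image[OF p, of i] by simp
  have "bij_betw (wreath n g \<pi>) (words n) (words n)"
  proof (rule bij_betw_byWitness[where f' = "wreath n (\<lambda>i. iv (g (iv \<pi> i))) (iv \<pi>)"])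
    have ip: "iv \<pi> i < n \<longleftrightarrow> i < n" for i
      using permutes_in_image[OF permutes_inv[OF p], of i] by simp
    have pp: "\<pi> (iv \<pi> i) = i" "iv \<pi> (\<pi> i) = i" for i using permutes_inverses[OF p] by auto
    show "\<forall>a\<in>words n. wreath n (\<lambda>i. iv (g (iv \<pi> i))) (iv \<pi>) (wreath n g \<pi> a) = a"
    proof
      fix a assume "a \<in> words n"
      then show "wreath n (\<lambda>i. iv (g (iv \<pi> i))) (iv \<pi>) (wreath n g \<pi> a) = a"
        using g by (cases a) (auto simp: wreath_def pl pp Aut_words)
    qed
    show "\<forall>a\<in>words n. wreath n g \<pi> (wreath n (\<lambda>i. iv (g (iv \<pi> i))) (iv \<pi>) a) = a"
    proof
      fix a assume "a \<in> words n"
      then show "wreath n g \<pi> (wreath n (\<lambda>i. iv (g (iv \<pi> i))) (iv \<pi>) a) = a"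
        using g by (cases a) (auto simp: wreath_def ip pp Aut_words)
    qed
    show "wreath n g \<pi> ` words n \<subseteq> words n"
      by (auto simp: wreath_def pl Aut_words[OF g] split: list.splits)
    show "wreath n (\<lambda>i. iv (g (iv \<pi> i))) (iv \<pi>) ` words n \<subseteq> words n"
      by (auto simp: wreath_def ip Aut_words[OF iv_Aut[OF g]] split: list.splits)
  qed
  then show "wreath n g \<pi> permutes words n" by (rule bij_imp_permutes) (simp add: wreath_def)
  fix w assume w: "w \<in> words n"
  show "length (wreath n g \<pi> w) = length w"
    using w by (cases w) (auto simp: wreath_def Aut_length[OF g])
  have gn: "g i [] = []" if "i < n" for i using Aut_Nil[OF g[OF that]] .
  show "wreath n g \<pi> (butlast w) = butlast (wreath n g \<pi> w)"
  proof (cases w)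
    case (Cons i u)
    then have "u \<noteq> [] \<Longrightarrow> g i u \<noteq> []" using Aut_length[OF g, of i u] w by auto
    then show ?thesis using Cons w Aut_butlast[OF g, of i u] words_butlast[of u n]
      by (auto simp: wreath_def gn)
  qed (simp add: wreath_def)
qed

lemma root_wreath [simp]: "\<pi> permutes {..<n} \<Longrightarrow> rp (wreath n g \<pi>) = \<pi>"
  by (auto simp: root_perm_def wreath_def fun_eq_iff permutes_def)

lemma state_wreath [simp]: "g i \<in> Aut \<Longrightarrow> i < n \<Longrightarrow> st (wreath n g \<pi>) i = g i"
  by (auto simp: state_at_def wreath_def fun_eq_iff Aut_outside)

lemma wreath_root_state: "f \<in> Aut \<Longrightarrow> wreath n (st f) (rp f) = f"
  by (rule Aut_root_state_eqI) (simp_all add: root_permutes)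

section \<open>The adding machine\<close>

lemma cyc_less [simp]: "\<sigma> i < n \<longleftrightarrow> i < n"
  by (simp add: cyc_def)

lemma cyc_pow: "i < n \<Longrightarrow> (\<sigma> ^^ j) i = (i + j) mod n"
  by (induction j) (auto simp: cyc_def mod_Suc_eq)

lemma cyc_pow_outside: "\<not> i < n \<Longrightarrow> (\<sigma> ^^ j) i = i"
  by (induction j) (auto simp: cyc_def)

lemma cyc_pow_n [simp]: "\<sigma> ^^ n = id"
proof
  fix i show "(\<sigma> ^^ n) i = id i" by (cases "i < n") (auto simp: cyc_pow cyc_pow_outside)
qed

lemma cyc_bij: "bij \<sigma>"
proof (rule o_bij)
  have "\<sigma> ^^ Suc (n - 1) = id" using cyc_pow_n n_pos(1) Suc_diff_1 by metis
  then show "\<sigma> \<circ> (\<sigma> ^^ (n - 1)) = id" unfolding funpow.simps(2) .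
  then show "(\<sigma> ^^ (n - 1)) \<circ> \<sigma> = id" by (metis funpow_Suc_right funpow.simps(2))
qed

lemma cyc_permutes: "\<sigma> permutes {..<n}"
  using cyc_bij unfolding permutes_def bij_iff by (auto simp: cyc_def)

lemma adding_machine_wreath: "\<tau> = wreath n (\<lambda>i. if i = n - 1 then \<tau> else id) \<sigma>"
proof
  fix w show "\<tau> w = wreath n (\<lambda>i. if i = n - 1 then \<tau> else id) \<sigma> w"
    by (cases w) (auto simp: adding_machine_def wreath_def)
qed

lemma tau_words: "u \<in> words n \<Longrightarrow> odometer n u \<in> words n \<and> length (odometer n u) = length u"
  by (induction u) auto

lemma tau_surj: "u \<in> words n \<Longrightarrow> \<exists>v\<in>words n. odometer n v = u"
proof (induction u)
  case (Cons i u)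
  then obtain v where v: "v \<in> words n" "odometer n v = u" by auto
  obtain j where j: "\<sigma> j = i" using cyc_bij by (metis bij_pointE)
  then have "j < n" using Cons.prems by (metis cyc_less words_simps(2))
  then show ?case using j v Cons.prems
    by (intro bexI[of _ "j # (if j = n - 1 then v else u)"]) auto
qed (auto intro!: bexI[of _ "[]"])

lemma tau_inj: "u \<in> words n \<Longrightarrow> v \<in> words n \<Longrightarrow> odometer n u = odometer n v \<Longrightarrow> u = v"
proof (induction u arbitrary: v)
  case Nil
  then show ?case by (cases v) auto
next
  case (Cons i u)
  then obtain j w where v: "v = j # w" by (cases v) auto
  have "\<sigma> i = \<sigma> j" using Cons v by simp
  then have "i = j" using cyc_bij by (metis bij_pointE)
  then show ?case using Cons v by (auto split: if_splits)
qed

lemma odometer_butlast: "odometer n (butlast u) = butlast (odometer n u)"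
proof (induction u)
  case (Cons i u)
  have "odometer n v = [] \<longleftrightarrow> v = []" for v by (cases v) auto
  then show ?case using Cons by auto
qed simp

lemma tau_Aut [simp]: "\<tau> \<in> Aut"
proof (rule AutI)
  have "bij_betw \<tau> (words n) (words n)"
    unfolding bij_betw_def inj_on_def using tau_inj tau_words tau_surj
    by (auto simp: adding_machine_def image_iff) (metis)
  then show "\<tau> permutes words n" by (rule bij_imp_permutes) (simp add: adding_machine_def)
qed (auto simp: adding_machine_def tau_words odometer_butlast words_butlast)

lemma root_tau [simp]: "rp \<tau> = \<sigma>"
  by (subst adding_machine_wreath) (simp add: cyc_permutes)

lemma state_tau: "i < n \<Longrightarrow> st \<tau> i = (if i = n - 1 then \<tau> else id)"
  by (subst adding_machine_wreath) (simp add: cyc_permutes)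

lemma root_funpow: "f \<in> Aut \<Longrightarrow> rp (f ^^ k) = rp f ^^ k"
  by (induction k) (simp_all add: root_comp)

lemma state_tau_pow0: "k < n \<Longrightarrow> st (\<tau> ^^ k) 0 = id"
proof (induction k)
  case (Suc k)
  have "st (\<tau> \<circ> \<tau> ^^ k) 0 = st \<tau> (rp (\<tau> ^^ k) 0) \<circ> st (\<tau> ^^ k) 0"
    by (rule state_comp) simp_all
  also have "rp (\<tau> ^^ k) 0 = k" using Suc.prems by (simp add: root_funpow cyc_pow)
  also have "st \<tau> k = id"
  proof -
    have "k < n" "k \<noteq> n - 1" using Suc.prems by linarith+
    then show ?thesis using state_tau[of k] by presburger
  qed
  also have "st (\<tau> ^^ k) 0 = id" using Suc.IH Suc.prems Suc_lessD by blast
  finally show ?case unfolding funpow.simps(2) by simp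
qed (simp add: id_def[symmetric])

lemma root_tau_pow: "i < n \<Longrightarrow> rp (\<tau> ^^ k) i = (i + k) mod n"
  by (simp add: root_funpow cyc_pow)

lemma state_tau_pow_n: "st (\<tau> ^^ n) 0 = \<tau>"
proof -
  have "\<tau> ^^ n = \<tau> \<circ> \<tau> ^^ (n - 1)" using n2 by (metis Suc_diff_1 funpow.simps(2) n_pos(1))
  then show ?thesis by (simp add: state_comp root_tau_pow state_tau_pow0 state_tau)
qed

lemma state_funpow_fix:
  assumes "f \<in> Aut" "i < n" "rp f i = i"
  shows "st (f ^^ k) i = st f i ^^ k" and "rp (f ^^ k) i = i"
proof -
  show r: "rp (f ^^ k) i = i" for k using assms by (induction k) (simp_all add: root_comp)
  show "st (f ^^ k) i = st f i ^^ k"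
    using assms by (induction k) (simp_all add: state_comp r)
qed

section \<open>Automorphisms acting as a full cycle on a level\<close>

text \<open>
  The powers of \<open>f\<close> move the leftmost word of length \<open>k\<close> to every word of length \<open>k\<close>; for an
  automorphism this says that \<open>f\<close> acts on level \<open>k\<close> as a single cycle of length \<open>n\<^sup>k\<close>.
\<close>

definition cyclic_on_level :: "(nat list \<Rightarrow> nat list) \<Rightarrow> nat \<Rightarrow> bool"
  where "cyclic_on_level f k \<longleftrightarrow> (\<forall>w\<in>words n. length w = k \<longrightarrow> (\<exists>j. (f ^^ j) (zs k) = w))"

text \<open>
  Transitivity descends: a full cycle on the first level whose \<open>n\<close>-th power has a state that is a
  full cycle on level \<open>k\<close> is a full cycle on level \<open>k + 1\<close>.
\<close>

lemma cyclic_on_level_Suc: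
  assumes f: "f \<in> Aut" and tr: "\<And>i. i < n \<Longrightarrow> \<exists>j. rp (f ^^ j) 0 = i"
    and r: "rp (f ^^ n) 0 = 0" and s: "cyclic_on_level (st (f ^^ n) 0) k"
  shows "cyclic_on_level f (Suc k)"
  unfolding cyclic_on_level_def
proof (intro ballI impI)
  fix w assume w: "w \<in> words n" "length w = Suc k"
  then obtain i u where iu: "w = i # u" "i < n" "u \<in> words n" "length u = k" by (cases w) auto
  obtain j where j: "rp (f ^^ j) 0 = i" using tr iu by blast
  define v where "v = iv (st (f ^^ j) 0) u"
  have v: "v \<in> words n" "length v = k" "st (f ^^ j) 0 v = u"
    using iu f by (auto simp: v_def Aut_words Aut_length)
  then obtain l where l: "(st (f ^^ n) 0 ^^ l) (zs k) = v"
    using s unfolding cyclic_on_level_def by blast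
  have "((f ^^ n) ^^ l) (0 # zs k) = 0 # v"
    using f r l by (simp add: Aut_Cons state_funpow_fix)
  then have "(f ^^ (j + n * l)) (0 # zs k) = (f ^^ j) (0 # v)"
    by (simp add: funpow_add funpow_mult)
  also have "\<dots> = w" using f j v iu by (simp add: Aut_Cons)
  finally show "\<exists>j. (f ^^ j) (zs (Suc k)) = w" by (intro exI[of _ "j + n * l"]) simp
qed

lemma cyclic_on_level_0 [simp]: "cyclic_on_level f 0"
  unfolding cyclic_on_level_def by (auto intro: exI[of _ 0])

lemma tau_cyclic: "cyclic_on_level \<tau> k"
proof (induction k)
  case (Suc k)
  show ?case
  proof (rule cyclic_on_level_Suc)
    show "\<exists>j. rp (\<tau> ^^ j) 0 = i" if "i < n" for i
      using that by (intro exI[of _ i]) (simp add: root_tau_pow)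
  qed (simp_all add: root_tau_pow state_tau_pow_n Suc)
qed simp

lemma level_card: "card {w \<in> words n. length w = k} = n ^ k" "finite {w \<in> words n. length w = k}"
proof -
  have e: "{w \<in> words n. length w = k} = {xs. set xs \<subseteq> {..<n} \<and> length xs = k}"
    by (auto simp: words_def)
  show "card {w \<in> words n. length w = k} = n ^ k" unfolding e by (simp add: card_lists_length_eq)
  show "finite {w \<in> words n. length w = k}" unfolding e by (simp add: finite_lists_length_eq)
qed

lemma cyclic_on_level_period:
  assumes f: "f \<in> Aut" and c: "cyclic_on_level f k"
  shows "(f ^^ j) (zs k) = zs k \<longleftrightarrow> n ^ k dvd j"
proof -
  have "(f ^^ j) (zs k) = zs k \<longleftrightarrow> card {w \<in> words n. length w = k} dvd j"
    using c f unfolding cyclic_on_level_def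
    by (intro single_orbit_period) (auto simp: level_card Aut_inj Aut_words Aut_length)
  then show ?thesis by (simp add: level_card)
qed

end

section \<open>Abelian permutation groups of degree four normalized by a 4-cycle\<close>

lemma perm4_list:
  fixes p q r s :: nat
  assumes "p \<in> {0,1,2,3}" "q \<in> {0,1,2,3}" "r \<in> {0,1,2,3}" "s \<in> {0,1,2,3}" "distinct [p, q, r, s]"
  shows "(p, q, r, s) \<in> {(0,1,2,3),(0,1,3,2),(0,2,1,3),(0,2,3,1),(0,3,1,2),(0,3,2,1),
    (1,0,2,3),(1,0,3,2),(1,2,0,3),(1,2,3,0),(1,3,0,2),(1,3,2,0),
    (2,0,1,3),(2,0,3,1),(2,1,0,3),(2,1,3,0),(2,3,0,1),(2,3,1,0),
    (3,0,1,2),(3,0,2,1),(3,1,0,2),(3,1,2,0),(3,2,0,1),(3,2,1,0)}"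
  using assms(1-4)
  apply (elim insertE emptyE)
  using assms(5)
  by simp_all

lemma less_4_cases: "i < (4::nat) \<Longrightarrow> i = 0 \<or> i = 1 \<or> i = 2 \<or> i = 3"
  by auto

lemma permutes_4:
  assumes "a permutes {..<4::nat}"
  shows "(a 0, a 1, a 2, a 3) \<in> {(0,1,2,3),(0,1,3,2),(0,2,1,3),(0,2,3,1),(0,3,1,2),(0,3,2,1),
    (1,0,2,3),(1,0,3,2),(1,2,0,3),(1,2,3,0),(1,3,0,2),(1,3,2,0),
    (2,0,1,3),(2,0,3,1),(2,1,0,3),(2,1,3,0),(2,3,0,1),(2,3,1,0),
    (3,0,1,2),(3,0,2,1),(3,1,0,2),(3,1,2,0),(3,2,0,1),(3,2,1,0)}"
proof (rule perm4_list)
  have "a i < 4" if "i < 4" for i using permutes_in_image[OF assms, of i] that by simp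
  then have "a i \<in> {0,1,2,3}" if "i < 4" for i using less_4_cases that by blast
  then show "a 0 \<in> {0,1,2,3}" "a 1 \<in> {0,1,2,3}" "a 2 \<in> {0,1,2,3}" "a 3 \<in> {0,1,2,3}" by simp_all
  show "distinct [a 0, a 1, a 2, a 3]" by (simp add: inj_eq[OF permutes_inj[OF assms]])
qed

lemma cyc_4 [simp]: "cyc 4 0 = 1" "cyc 4 (Suc 0) = 2" "cyc 4 2 = 3" "cyc 4 3 = 0"
  by (simp_all add: cyc_def)

lemma eq_on_4: "f 0 = g 0 \<Longrightarrow> f 1 = g 1 \<Longrightarrow> f 2 = g 2 \<Longrightarrow> f 3 = g 3 \<Longrightarrow> i < (4::nat) \<Longrightarrow> f i = g i"
  by (drule less_4_cases) (elim disjE; simp)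

text \<open>
  Here \<open>a'\<close> is the conjugate of \<open>a\<close> by the 4-cycle \<open>\<sigma>\<close>. If a nontrivial \<open>a\<close> commutes with it, then
  \<open>\<sigma>\<^sup>2\<close> is one of \<open>a\<close>, \<open>a\<^sup>2\<close>, \<open>aa'\<close>. All 24 permutations are checked.
\<close>

lemma double_step_of_commuting:
  fixes a a' :: "nat \<Rightarrow> nat"
  assumes a: "a permutes {..<4}" and a': "\<And>i. i < 4 \<Longrightarrow> a' (cyc 4 i) = cyc 4 (a i)"
    and comm: "\<And>i. i < 4 \<Longrightarrow> a (a' i) = a' (a i)" and ne: "a \<noteq> id"
  shows "\<exists>b\<in>{a, a \<circ> a, a \<circ> a'}. \<forall>i<4. b i = (i + 2) mod 4"
proof -
  have ne': "\<not> (a 0 = 0 \<and> a 1 = 1 \<and> a 2 = 2 \<and> a 3 = 3)"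
  proof
    assume "a 0 = 0 \<and> a 1 = 1 \<and> a 2 = 2 \<and> a 3 = 3"
    then have "a i = id i" for i
      using eq_on_4[of a id i] permutes_not_in[OF a, of i] by (cases "i < 4") simp_all
    then show False using ne by blast
  qed
  have a'': "a' (Suc 0) = cyc 4 (a 0)" "a' 2 = cyc 4 (a 1)" "a' 3 = cyc 4 (a 2)" "a' 0 = cyc 4 (a 3)"
    using a'[of 0] a'[of 1] a'[of 2] a'[of 3] by simp_all
  have comm': "a (a' 0) = a' (a 0)" "a (a' 1) = a' (a 1)" "a (a' 2) = a' (a 2)"
    using comm by simp_all
  have D: "(a 0 = 2 \<and> a 1 = 3 \<and> a 2 = 0 \<and> a 3 = 1)
    \<or> (a (a 0) = 2 \<and> a (a 1) = 3 \<and> a (a 2) = 0 \<and> a (a 3) = 1)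
    \<or> (a (a' 0) = 2 \<and> a (a' 1) = 3 \<and> a (a' 2) = 0 \<and> a (a' 3) = 1)"
    using permutes_4[OF a] ne' comm'
    by (elim insertE emptyE) (simp_all add: a'')
  have "\<forall>i<4. b i = (i + 2) mod 4" if "b 0 = 2 \<and> b 1 = 3 \<and> b 2 = 0 \<and> b 3 = 1" for b :: "nat \<Rightarrow> nat"
    using eq_on_4[of b "\<lambda>i. (i + 2) mod 4"] that by simp
  then have "b 0 = 2 \<and> b 1 = 3 \<and> b 2 = 0 \<and> b 3 = 1 \<Longrightarrow> b \<in> {a, a \<circ> a, a \<circ> a'} \<Longrightarrow> ?thesis" for b
    by blast
  from this[of a] this[of "a \<circ> a"] this[of "a \<circ> a'"] show ?thesis
    using D unfolding comp_apply by blast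
qed

text \<open>
  Here \<open>a = \<sigma>c\<^sup>2\<close>, and \<open>a'\<close> and \<open>b\<close> are the conjugates of \<open>a\<close> by \<open>\<sigma>\<close> and by \<open>c\<close>. If \<open>a\<close> commutes with
  both, then \<open>a\<close> is \<open>\<sigma>\<close> or its inverse.
\<close>

lemma full_cycle_of_commuting:
  fixes a a' b c :: "nat \<Rightarrow> nat"
  assumes c: "c permutes {..<4}" and a: "\<And>i. i < 4 \<Longrightarrow> a i = cyc 4 (c (c i))"
    and a': "\<And>i. i < 4 \<Longrightarrow> a' (cyc 4 i) = cyc 4 (a i)" and comm: "\<And>i. i < 4 \<Longrightarrow> a (a' i) = a' (a i)"
    and b: "\<And>i. i < 4 \<Longrightarrow> b (c i) = c (a i)" and comm': "\<And>i. i < 4 \<Longrightarrow> a (b i) = b (a i)"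
  shows "\<exists>x\<in>{a, a \<circ> a \<circ> a}. \<forall>i<4. x i = cyc 4 i"
proof -
  have a1: "a 0 = cyc 4 (c (c 0))" "a (Suc 0) = cyc 4 (c (c 1))" "a 2 = cyc 4 (c (c 2))" "a 3 = cyc 4 (c (c 3))"
    using a by simp_all
  have a'': "a' (Suc 0) = cyc 4 (a 0)" "a' 2 = cyc 4 (a 1)" "a' 3 = cyc 4 (a 2)" "a' 0 = cyc 4 (a 3)"
    using a'[of 0] a'[of 1] a'[of 2] a'[of 3] by simp_all
  have cl: "c 0 < 4" "c 1 < 4" "c 2 < 4" "c 3 < 4" using permutes_in_image[OF c] by simp_all
  have comm1: "a (a' 0) = a' (a 0)" "a (a' 1) = a' (a 1)" "a (a' 2) = a' (a 2)"
    "b (a (c 0)) = a (c (a 0))" "b (a (c 1)) = a (c (a 1))" "b (a (c 2)) = a (c (a 2))"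
    "b (a (c 3)) = a (c (a 3))"
    using comm comm'[OF cl(1)] comm'[OF cl(2)] comm'[OF cl(3)] comm'[OF cl(4)] b by simp_all
  have b1: "b (c 0) = c (a 0)" "b (c (Suc 0)) = c (a 1)" "b (c 2) = c (a 2)" "b (c 3) = c (a 3)"
    using b by simp_all
  have D: "(a 0 = 1 \<and> a 1 = 2 \<and> a 2 = 3 \<and> a 3 = 0)
    \<or> (a (a (a 0)) = 1 \<and> a (a (a 1)) = 2 \<and> a (a (a 2)) = 3 \<and> a (a (a 3)) = 0)"
    using permutes_4[OF c] comm1 b1
    by (elim insertE emptyE) (simp_all add: a'' a1)
  have "\<forall>i<4. b i = cyc 4 i" if "b 0 = 1 \<and> b 1 = 2 \<and> b 2 = 3 \<and> b 3 = 0" for b :: "nat \<Rightarrow> nat"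
    using eq_on_4[of b "cyc 4"] that by simp
  then have "b 0 = 1 \<and> b 1 = 2 \<and> b 2 = 3 \<and> b 3 = 0 \<Longrightarrow> b \<in> {a, a \<circ> a \<circ> a} \<Longrightarrow> ?thesis" for b
    by blast
  from this[of a] this[of "a \<circ> a \<circ> a"] show ?thesis
    using D unfolding comp_apply by blast
qed

section \<open>Abelian permutation groups of prime degree normalized by a full cycle\<close>

lemma conj_by_comp: "bij g \<Longrightarrow> conj_by g (f \<circ> f') = conj_by g f \<circ> conj_by g f'"
  by (auto simp: conj_by_def fun_eq_iff bij_is_inj)

lemma conj_by_eq_iff: "bij g \<Longrightarrow> conj_by g f = h \<longleftrightarrow> g \<circ> f = h \<circ> g"
  unfolding conj_by_def fun_eq_iff comp_apply
  by (metis bij_inv_eq_iff)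

lemma conj_by_inj: "bij g \<Longrightarrow> conj_by g f = conj_by g f' \<longleftrightarrow> f = f'"
  unfolding conj_by_def fun_eq_iff comp_apply
  by (metis bij_inv_eq_iff)

context regular_tree
begin

text \<open>
A subgroup of the symmetric group on the letters, given by its set of elements.
\<close>

definition perm_subgp :: "(nat \<Rightarrow> nat) set \<Rightarrow> bool"
  where "perm_subgp A \<longleftrightarrow> (\<forall>a\<in>A. a permutes {..<n}) \<and> id \<in> A \<and> (\<forall>a\<in>A. \<forall>b\<in>A. a \<circ> b \<in> A)
    \<and> (\<forall>a\<in>A. iv a \<in> A)"

definition abelian :: "('a \<Rightarrow> 'a) set \<Rightarrow> bool"
  where "abelian A \<longleftrightarrow> (\<forall>a\<in>A. \<forall>b\<in>A. a \<circ> b = b \<circ> a)"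

lemma abelianD: "abelian A \<Longrightarrow> a \<in> A \<Longrightarrow> b \<in> A \<Longrightarrow> a (b x) = b (a x)"
  unfolding abelian_def by (metis comp_apply)

lemma commutes_cyc:
  assumes a: "a permutes {..<n}" and c: "a \<circ> \<sigma> = \<sigma> \<circ> a"
  shows "a = \<sigma> ^^ (a 0)"
proof
  fix i
  have a0: "a 0 < n" using permutes_in_image[OF a, of 0] by simp
  have p: "a ((\<sigma> ^^ j) x) = (\<sigma> ^^ j) (a x)" for j x
    using c by (induction j) (simp_all add: fun_eq_iff)
  show "a i = (\<sigma> ^^ a 0) i"
  proof (cases "i < n")
    case True
    then have "a i = a ((\<sigma> ^^ i) 0)" by (simp add: cyc_pow)
    also have "\<dots> = (\<sigma> ^^ i) (a 0)" by (rule p)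
    also have "\<dots> = (\<sigma> ^^ a 0) i" using True a0 by (simp add: cyc_pow add.commute)
    finally show ?thesis .
  qed (use permutes_not_in[OF a, of i] cyc_pow_outside[of i] in auto)
qed

lemma abelian_containing_cyc:
  assumes A: "perm_subgp A" "abelian A" "\<sigma> \<in> A" and a: "a \<in> A"
  shows "a = \<sigma> ^^ (a 0)"
  using A a by (intro commutes_cyc) (auto simp: perm_subgp_def abelian_def)

lemma cyc_mem_of_pow1:
  assumes "a permutes {..<n}" "\<And>i. i < n \<Longrightarrow> a i = \<sigma> i" shows "a = \<sigma>"
proof
  fix i show "a i = \<sigma> i"
    using assms(2)[of i] permutes_not_in[OF assms(1), of i] permutes_not_in[OF cyc_permutes, of i]
    by (cases "i < n") auto
qed

text \<open>
  Since \<open>\<sigma>\<close> permutes the orbits of \<open>A\<close> transitively, they all have the same size, which divides the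
  prime \<open>n\<close>. As \<open>A\<close> is not trivial, there is one orbit only.
\<close>

lemma orbits_prime:
  assumes p: "prime n" and A: "perm_subgp A" and nt: "a0 \<in> A" "a0 \<noteq> id"
    and nrm: "\<And>a. a \<in> A \<Longrightarrow> conj_by \<sigma> a \<in> A" and j: "j < n"
  shows "\<exists>a\<in>A. a 0 = j"
proof -
  define orb where "orb i = (\<lambda>a. a i) ` A" for i
  have perm: "a permutes {..<n}" if "a \<in> A" for a using A that by (simp add: perm_subgp_def)
  have orb_sub: "orb i \<subseteq> {..<n}" if "i < n" for i
    using permutes_in_image[OF perm, of _ i] that by (auto simp: orb_def)
  have fin: "finite (orb i)" if "i < n" for i using orb_sub[OF that] finite_subset by blast
  have self: "i \<in> orb i" for i unfolding orb_def using A by (auto simp: perm_subgp_def intro!: image_eqI[of _ _ id])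
  have step: "card (orb i) \<le> card (orb (\<sigma> i))" if "i < n" for i
  proof -
    have "\<sigma> ` orb i \<subseteq> orb (\<sigma> i)"
    proof
      fix y assume "y \<in> \<sigma> ` orb i"
      then obtain a where a: "a \<in> A" "y = \<sigma> (a i)" by (auto simp: orb_def)
      have "conj_by \<sigma> a (\<sigma> i) = y" using a by (simp add: conj_by_def bij_is_inj[OF cyc_bij])
      then show "y \<in> orb (\<sigma> i)" using nrm[OF a(1)] by (auto simp: orb_def)
    qed
    then have "card (\<sigma> ` orb i) \<le> card (orb (\<sigma> i))" using fin[of "\<sigma> i"] that by (intro card_mono) auto
    then show ?thesis by (simp add: card_image inj_on_subset[OF bij_is_inj[OF cyc_bij]])
  qed
  have steps: "card (orb i) \<le> card (orb ((\<sigma> ^^ k) i))" if "i < n" for i k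
  proof (induction k)
    case (Suc k)
    then show ?case using step[of "(\<sigma> ^^ k) i"] that by (simp add: cyc_pow)
  qed simp
  have eq: "card (orb i) = card (orb 0)" if "i < n" for i
  proof (rule antisym)
    show "card (orb i) \<le> card (orb 0)" using steps[OF that, of "n - i"] that by (simp add: cyc_pow)
    show "card (orb 0) \<le> card (orb i)" using steps[of 0 i] that by (simp add: cyc_pow)
  qed
  have orb_eq: "orb i = orb k" if "x \<in> orb i" "x \<in> orb k" for i k x
  proof -
    have *: "orb i \<subseteq> orb k" if ik: "x \<in> orb i" "x \<in> orb k" for i k
    proof
      fix y assume "y \<in> orb i"
      then obtain a where a: "a \<in> A" "y = a i" by (auto simp: orb_def)
      obtain b c where bc: "b \<in> A" "x = b i" "c \<in> A" "x = c k" using ik by (auto simp: orb_def)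
      have "iv b x = i" using bc permutes_inverses(2)[OF perm[OF bc(1)]] by simp
      then have "y = (a \<circ> iv b \<circ> c) k" using a bc by simp
      moreover have "a \<circ> iv b \<circ> c \<in> A" using A a bc by (simp add: perm_subgp_def)
      ultimately show "y \<in> orb k" unfolding orb_def by blast
    qed
    show ?thesis using *[of i k] *[of k i] that by blast
  qed
  have "card (orb 0) * card (orb ` {..<n}) = card (\<Union> (orb ` {..<n}))"
  proof (rule card_partition)
    show "finite (\<Union> (orb ` {..<n}))" using fin by auto
    show "c \<inter> d = {}" if "c \<in> orb ` {..<n}" "d \<in> orb ` {..<n}" "c \<noteq> d" for c d
      using that orb_eq by fast
    show "finite (orb ` {..<n})" by simp
    show "card c = card (orb 0)" if "c \<in> orb ` {..<n}" for c using that eq by blast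
  qed
  moreover have "\<Union> (orb ` {..<n}) = {..<n}" using orb_sub self by blast
  ultimately have "card (orb 0) dvd n" by (metis card_lessThan dvd_triv_left)
  then consider "card (orb 0) = 1" | "card (orb 0) = n" using p by (auto simp: prime_nat_iff)
  then have "orb 0 = {..<n}"
  proof cases
    case 1
    have "a0 i = i" for i
    proof (cases "i < n")
      case True
      then have "card (orb i) = 1" using eq 1 by simp
      moreover have "a0 i \<in> orb i" using nt by (simp add: orb_def)
      ultimately show ?thesis using self[of i] by (metis card_1_singletonE singletonD)
    qed (use permutes_not_in[OF perm[OF nt(1)], of i] in auto)
    then show ?thesis using nt(2) by (auto simp: fun_eq_iff)
  next
    case 2
    then show ?thesis using orb_sub[of 0] by (intro card_subset_eq) auto
  qed
  then have "j \<in> orb 0" using j by simp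
  then show ?thesis by (auto simp: orb_def)
qed

lemma funpow_conj_by: "bij g \<Longrightarrow> (conj_by g ^^ j) a \<circ> g ^^ j = g ^^ j \<circ> a"
proof (induction j)
  case (Suc j)
  have "(conj_by g ^^ Suc j) a \<circ> g ^^ Suc j = (conj_by g ((conj_by g ^^ j) a) \<circ> g) \<circ> g ^^ j"
    by (simp add: fun_eq_iff)
  also have "conj_by g ((conj_by g ^^ j) a) \<circ> g = g \<circ> (conj_by g ^^ j) a"
    using conj_by_eq_iff[OF Suc.prems] by metis
  also have "g \<circ> (conj_by g ^^ j) a \<circ> g ^^ j = g \<circ> ((conj_by g ^^ j) a \<circ> g ^^ j)"
    by (rule o_assoc[symmetric])
  also have "\<dots> = g ^^ Suc j \<circ> a" unfolding Suc.IH[OF Suc.prems] by (simp add: fun_eq_iff)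
  finally show ?case .
qed simp

text \<open>
  \<open>A\<close> is regular, so it has at most \<open>n\<close> elements. Conjugation by \<open>\<sigma>\<close> acts on \<open>A\<close> with orbits of size 1
  or \<open>n\<close> and fixes the identity, so it is trivial on \<open>A\<close>.
\<close>

lemma abelian_prime_degree:
  assumes p: "prime n" and A: "perm_subgp A" and ab: "abelian A" and nt: "a0 \<in> A" "a0 \<noteq> id"
    and nrm: "\<And>a. a \<in> A \<Longrightarrow> conj_by \<sigma> a \<in> A"
  shows "\<sigma> \<in> A"
proof -
  have perm: "a permutes {..<n}" if "a \<in> A" for a using A that by (simp add: perm_subgp_def)
  have reg: "a = b" if "a \<in> A" "b \<in> A" "a 0 = b 0" for a b
  proof
    fix i show "a i = b i"
    proof (cases "i < n")
      case True
      then obtain c where c: "c \<in> A" "c 0 = i" using orbits_prime[OF p A nt nrm] by blast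
      then show ?thesis using abelianD[OF ab that(1) c(1), of 0] abelianD[OF ab that(2) c(1), of 0] that by simp
    qed (use permutes_not_in[OF perm[OF that(1)], of i] permutes_not_in[OF perm[OF that(2)], of i] in auto)
  qed
  have injA: "inj_on (\<lambda>a. a 0) A" using reg by (auto intro: inj_onI)
  have imA: "(\<lambda>a. a 0) ` A \<subseteq> {..<n}" using permutes_in_image[OF perm, of _ 0] by auto
  have finA: "finite A" using inj_on_finite[OF injA imA] by simp
  have cardA: "card A \<le> n" using card_inj_on_le[OF injA imA] by simp
  define T where "T = conj_by \<sigma>"
  have injT: "inj T" unfolding T_def using conj_by_inj[OF cyc_bij] by (auto intro: injI)
  have Tid: "T id = id" unfolding T_def conj_by_eq_iff[OF cyc_bij] by simp
  have TA: "(T ^^ j) a \<in> A" if "a \<in> A" for j a using that nrm by (induction j) (auto simp: T_def)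
  have Tn: "(T ^^ n) a = a" for a using funpow_conj_by[OF cyc_bij, of n a] by (simp add: T_def)
  have fix_: "T a = a" if a: "a \<in> A" for a
  proof (rule ccontr)
    assume ne: "T a \<noteq> a"
    have injp: "inj (T ^^ j)" for j using injT by (induction j) (auto intro: inj_compose)
    have inj: "inj_on (\<lambda>j. (T ^^ j) a) {..<n}"
    proof (rule linorder_inj_onI')
      fix i j assume ij: "i \<in> {..<n}" "j \<in> {..<n}" "i < j"
      show "(T ^^ i) a \<noteq> (T ^^ j) a"
      proof
        assume e: "(T ^^ i) a = (T ^^ j) a"
        have "(T ^^ j) a = (T ^^ i) ((T ^^ (j - i)) a)"
          using ij by (simp add: funpow_add[symmetric, THEN fun_cong, unfolded o_apply])
        then have m: "(T ^^ (j - i)) a = a" using e injp[of i] by (simp add: inj_eq)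
        have "\<not> n dvd (j - i)" using ij by (auto dest: dvd_imp_le)
        then have "coprime n (j - i)" using p prime_imp_coprime by blast
        then have "gcd (j - i) n = 1" by (simp add: gcd.commute)
        moreover have "j - i \<noteq> 0" using ij by simp
        ultimately obtain x y where xy: "(j - i) * x = n * y + 1"
          using bezout_nat[of "j - i" n] by auto
        \<comment> \<open>\<open>T\<close> is a power of \<open>T\<^sup>j\<^sup>-\<^sup>i\<close> up to a multiple of the period \<open>n\<close>\<close>
        have "(T ^^ (1 + n * y)) a = T ((T ^^ (n * y)) a)" by simp
        also have "\<dots> = T a" using funpow_fixpoint_mult[OF Tn[of a], of y] by simp
        finally have "T a = (T ^^ ((j - i) * x)) a" using xy by simp
        then show False using funpow_fixpoint_mult[OF m, of x] ne by simp
      qed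
    qed
    have nid: "(T ^^ j) a \<noteq> id" for j
    proof
      assume "(T ^^ j) a = id"
      moreover have "(T ^^ j) id = id" using Tid by (induction j) auto
      ultimately have "a = id" using injp[of j] by (metis injD)
      then show False using ne Tid by simp
    qed
    have "id \<notin> (\<lambda>j. (T ^^ j) a) ` {..<n}" 
    proof
      assume "id \<in> (\<lambda>j. (T ^^ j) a) ` {..<n}"
      then obtain j where "id = (T ^^ j) a" by (rule imageE)
      then show False using nid[of j] by (rule notE[OF not_sym, rotated])
    qed
    then have "card (insert id ((\<lambda>j. (T ^^ j) a) ` {..<n})) = Suc n"
      by (simp add: card_image[OF inj])
    moreover have "insert id ((\<lambda>j. (T ^^ j) a) ` {..<n}) \<subseteq> A"
      using TA[OF a] A by (auto simp: perm_subgp_def)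
    ultimately show False using card_mono[OF finA] cardA by (metis Suc_n_not_le_n le_trans)
  qed
  obtain a where a: "a \<in> A" "a 0 = 1" using orbits_prime[OF p A nt nrm, of 1] n2 by auto
  have "a \<circ> \<sigma> = \<sigma> \<circ> a" using fix_[OF a(1)] conj_by_eq_iff[OF cyc_bij, of a a] by (simp add: T_def)
  then have "a = \<sigma> ^^ 1" using commutes_cyc[OF perm[OF a(1)]] a(2) by simp
  then show ?thesis using a by simp
qed

section \<open>Branches of groups that contain the adding machine\<close>

lemma root_conj: "g \<in> Aut \<Longrightarrow> f \<in> Aut \<Longrightarrow> rp (conj_by g f) = conj_by (rp g) (rp f)"
  by (simp add: conj_by_def root_comp root_iv)

lemma root_conj_id: "g \<in> Aut \<Longrightarrow> f \<in> Aut \<Longrightarrow> rp f = id \<Longrightarrow> rp (conj_by g f) = id"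
  using bij_is_surj[OF root_bij, of g] by (simp add: root_conj) (simp add: conj_by_def surj_iff)

lemma conj_by_Aut [simp]: "g \<in> Aut \<Longrightarrow> f \<in> Aut \<Longrightarrow> conj_by g f \<in> Aut"
  by (simp add: conj_by_def)

lemma state_conj:
  assumes "g \<in> Aut" "f \<in> Aut" "i < n"
  shows "st (conj_by g f) (rp g i) = st g (rp f i) \<circ> st f i \<circ> iv (st g i)"
  using assms by (simp add: conj_by_def state_comp state_iv root_comp o_assoc[symmetric] del: o_assoc)

text \<open>
  A subgroup of the automorphism group of the tree, given by its set of elements. It is the same
  as \<open>subgroup G (tree_aut n)\<close>, see \<open>subgroup_tree_aut_iff\<close>, in terms of functions.
\<close>

definition subgp :: "(nat list \<Rightarrow> nat list) set \<Rightarrow> bool"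
  where "subgp G \<longleftrightarrow> G \<subseteq> Aut \<and> id \<in> G \<and> (\<forall>f\<in>G. \<forall>g\<in>G. f \<circ> g \<in> G) \<and> (\<forall>f\<in>G. iv f \<in> G)"

lemma subgpD:
  assumes "subgp G"
  shows subgp_Aut: "f \<in> G \<Longrightarrow> f \<in> Aut" and subgp_id: "id \<in> G"
    and subgp_comp: "f \<in> G \<Longrightarrow> g \<in> G \<Longrightarrow> f \<circ> g \<in> G" and subgp_iv: "f \<in> G \<Longrightarrow> iv f \<in> G"
  using assms by (auto simp: subgp_def)

lemma subgp_pow: "subgp G \<Longrightarrow> f \<in> G \<Longrightarrow> f ^^ k \<in> G"
  by (induction k) (simp_all add: subgp_id subgp_comp)

text \<open>
Every element of \<open>G\<close> conjugates \<open>B\<close> into itself.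
\<close>

definition normalizes :: "('a \<Rightarrow> 'a) set \<Rightarrow> ('a \<Rightarrow> 'a) set \<Rightarrow> bool"
  where "normalizes G B \<longleftrightarrow> (\<forall>g\<in>G. \<forall>b\<in>B. conj_by g b \<in> B)"

text \<open>
The states at the letter \<open>0\<close> of the elements that fix this letter.
\<close>

definition branch :: "(nat list \<Rightarrow> nat list) set \<Rightarrow> (nat list \<Rightarrow> nat list) set"
  where "branch G = {st g 0 |g. g \<in> G \<and> rp g 0 = 0}"

text \<open>
The states at the letter \<open>0\<close> of the elements that fix the whole first level.
\<close>

definition branch1 :: "(nat list \<Rightarrow> nat list) set \<Rightarrow> (nat list \<Rightarrow> nat list) set"
  where "branch1 B = {st b 0 |b. b \<in> B \<and> rp b = id}"

lemma subgp_branch: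
  assumes G: "subgp G" shows "subgp (branch G)"
  unfolding subgp_def
proof (intro conjI ballI)
  show "branch G \<subseteq> Aut" using subgp_Aut[OF G] by (auto simp: branch_def)
  show "id \<in> branch G" using subgp_id[OF G] unfolding branch_def by (intro CollectI exI[of _ id]) simp
  fix f assume "f \<in> branch G"
  then obtain f' where f: "f = st f' 0" "f' \<in> G" "rp f' 0 = 0" by (auto simp: branch_def)
  note fa = subgp_Aut[OF G f(2)]
  have "iv f = st (iv f') 0" using state_iv[OF fa, of 0] f by simp
  moreover have "rp (iv f') 0 = 0" using root_iv_app(1)[OF fa, of 0] f by simp
  ultimately show "iv f \<in> branch G" using subgp_iv[OF G f(2)] by (auto simp: branch_def)
  fix g assume "g \<in> branch G"
  then obtain g' where g: "g = st g' 0" "g' \<in> G" "rp g' 0 = 0" by (auto simp: branch_def)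
  have "f \<circ> g = st (f' \<circ> g') 0" "rp (f' \<circ> g') 0 = 0"
    using f g fa subgp_Aut[OF G g(2)] by (simp_all add: state_comp root_comp)
  then show "f \<circ> g \<in> branch G" using subgp_comp[OF G f(2) g(2)] by (auto simp: branch_def)
qed

lemma subgp_branch1:
  assumes G: "subgp G" shows "subgp (branch1 G)"
proof -
  have "subgp {g \<in> G. rp g = id}"
    using G unfolding subgp_def by (auto simp: root_comp root_iv subset_iff inv_id[unfolded id_def[symmetric]])
  moreover have "branch {g \<in> G. rp g = id} = branch1 G" by (auto simp: branch_def branch1_def)
  ultimately show ?thesis using subgp_branch by metis
qed

lemma tau_branch:
  assumes G: "subgp G" "\<tau> \<in> G" shows "\<tau> \<in> branch G"
  unfolding branch_def using subgp_pow[OF G, of n]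
  by (intro CollectI exI[of _ "\<tau> ^^ n"]) (simp add: root_tau_pow state_tau_pow_n)

text \<open>
  The state at \<open>i\<close> of \<open>g\<close> is the state at \<open>0\<close> of \<open>\<tau>\<^sup>-\<^sup>j g \<tau>\<^sup>i\<close>, where \<open>g\<close> moves \<open>i\<close> to \<open>j\<close>, because
  \<open>\<tau>\<^sup>i\<close> and \<open>\<tau>\<^sup>j\<close> have trivial states at \<open>0\<close>.
\<close>

lemma state_branch:
  assumes G: "subgp G" "\<tau> \<in> G" and g: "g \<in> G" "i < n"
  shows "st g i \<in> branch G"
proof -
  define j where "j = rp g i"
  have ga: "g \<in> Aut" using subgp_Aut[OF G(1) g(1)] .
  have j: "j < n" using g ga by (simp add: j_def)
  define h where "h = iv (\<tau> ^^ j) \<circ> (g \<circ> \<tau> ^^ i)"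
  have hG: "h \<in> G" unfolding h_def using G g by (intro subgp_comp subgp_iv subgp_pow)
  have t: "rp (\<tau> ^^ i) 0 = i" "rp (\<tau> ^^ j) 0 = j" using g j by (simp_all add: root_tau_pow)
  have r: "rp (g \<circ> \<tau> ^^ i) 0 = j" using ga t by (simp add: root_comp j_def)
  have ij: "rp (iv (\<tau> ^^ j)) j = 0" using root_iv_app(1)[of "\<tau> ^^ j" 0] t by simp
  have "rp h 0 = 0" using ga r ij by (simp add: h_def root_comp[of "iv (\<tau> ^^ j)" "g \<circ> \<tau> ^^ i"])
  moreover have "st (iv (\<tau> ^^ j)) j = id"
    using state_iv[of "\<tau> ^^ j" 0] t j by (simp add: state_tau_pow0 inv_id[unfolded id_def[symmetric]])
  then have "st h 0 = st g i"
    using ga r t g by (simp add: h_def state_comp[of "iv (\<tau> ^^ j)" "g \<circ> \<tau> ^^ i"] state_comp[of g "\<tau> ^^ i"] state_tau_pow0)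
  ultimately show ?thesis using hG unfolding branch_def by (intro CollectI exI[of _ h]) simp
qed

text \<open>
  A group \<open>G\<close> containing \<open>\<tau>\<close> together with an abelian normal subgroup \<open>B\<close>.
\<close>

definition tau_pair :: "(nat list \<Rightarrow> nat list) set \<Rightarrow> (nat list \<Rightarrow> nat list) set \<Rightarrow> bool"
  where "tau_pair G B \<longleftrightarrow> subgp G \<and> \<tau> \<in> G \<and> subgp B \<and> B \<subseteq> G \<and> abelian B \<and> normalizes G B"

lemma tau_pairD:
  assumes "tau_pair G B"
  shows "subgp G" "\<tau> \<in> G" "subgp B" "abelian B"
    "g \<in> G \<Longrightarrow> b \<in> B \<Longrightarrow> conj_by g b \<in> B" "B \<subseteq> G"
  using assms by (auto simp: tau_pair_def normalizes_def)

lemma state_branch1: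
  assumes P: "tau_pair G B" and b: "b \<in> B" "rp b = id" "i < n"
  shows "st b i \<in> branch1 B"
proof -
  note G = tau_pairD[OF P]
  define t where "t = iv (\<tau> ^^ i)"
  have tG: "t \<in> G" unfolding t_def using G by (intro subgp_iv subgp_pow)
  have ta: "t \<in> Aut" using subgp_Aut[OF G(1) tG] .
  have ba: "b \<in> Aut" using subgp_Aut[OF G(3) b(1)] .
  have r: "rp t i = 0" using root_iv_app(1)[of "\<tau> ^^ i" 0] b by (simp add: t_def root_tau_pow)
  have s: "st t i = id" using state_iv[of "\<tau> ^^ i" 0] b
    by (simp add: t_def state_tau_pow0 inv_id[unfolded id_def[symmetric]] root_tau_pow)
  have "st (conj_by t b) 0 = st b i"
    using state_conj[OF ta ba b(3)] r s b by (simp add: inv_id[unfolded id_def[symmetric]])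
  moreover have "rp (conj_by t b) = id"
    using ta ba b by (simp add: root_conj_id)
  ultimately show ?thesis using G(5)[OF tG b(1)] unfolding branch1_def by force
qed

lemma tau_pair_branch:
  assumes P: "tau_pair G B" shows "tau_pair (branch G) (branch1 B)"
  unfolding tau_pair_def
proof (intro conjI)
  note G = tau_pairD[OF P]
  show "subgp (branch G)" "\<tau> \<in> branch G" "subgp (branch1 B)"
    using G subgp_branch tau_branch subgp_branch1 by auto
  show "branch1 B \<subseteq> branch G" using G(6) by (auto simp: branch_def branch1_def)
  have ba: "b \<in> B \<Longrightarrow> b \<in> Aut" for b using subgp_Aut[OF G(3)] .
  show "abelian (branch1 B)"
    unfolding abelian_def
  proof (intro ballI)
    fix a b assume "a \<in> branch1 B" "b \<in> branch1 B"
    then obtain a' b' where ab: "a = st a' 0" "b = st b' 0" "a' \<in> B" "b' \<in> B" "rp a' = id" "rp b' = id"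
      by (auto simp: branch1_def)
    have "a' \<circ> b' = b' \<circ> a'" using G(4) ab unfolding abelian_def by blast
    then have "st (a' \<circ> b') 0 = st (b' \<circ> a') 0" by simp
    then show "a \<circ> b = b \<circ> a" using ab ba by (simp add: state_comp)
  qed
  show "normalizes (branch G) (branch1 B)"
    unfolding normalizes_def
  proof (intro ballI)
    fix g b assume "g \<in> branch G" "b \<in> branch1 B"
    then obtain g' b' where gb: "g = st g' 0" "b = st b' 0" "g' \<in> G" "b' \<in> B" "rp g' 0 = 0" "rp b' = id"
      by (auto simp: branch_def branch1_def)
    have ga: "g' \<in> Aut" using subgp_Aut[OF G(1) gb(3)] .
    have "st (conj_by g' b') 0 = conj_by g b"
      using state_conj[OF ga ba[OF gb(4)], of 0] gb by (simp add: conj_by_def)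
    moreover have "rp (conj_by g' b') = id"
      using ga ba gb by (simp add: root_conj_id)
    ultimately show "conj_by g b \<in> branch1 B" using G(5)[OF gb(3,4)] unfolding branch1_def by force
  qed
qed

lemma root_perm_subgp: "subgp G \<Longrightarrow> perm_subgp (rp ` G)"
  unfolding perm_subgp_def
  by (auto simp: subgp_def root_permutes subset_iff root_comp[symmetric] root_iv[symmetric] image_iff
      intro: bexI[of _ id])

end

section \<open>Passing from the branch back to the group\<close>

lemma (in group) normalizer_iff:
  assumes H: "H \<subseteq> carrier G" and x: "x \<in> carrier G"
  shows "x \<in> normalizer G H \<longleftrightarrow> (\<forall>h\<in>H. x \<otimes> h \<otimes> inv x \<in> H \<and> inv x \<otimes> h \<otimes> x \<in> H)"
proof -
  have c: "x <# H #> inv x = (\<lambda>h. x \<otimes> h \<otimes> inv x) ` H"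
    by (auto simp: l_coset_def r_coset_def)
  have "x \<in> normalizer G H \<longleftrightarrow> (\<lambda>h. x \<otimes> h \<otimes> inv x) ` H = H"
    using assms unfolding normalizer_def stabilizer_def c[symmetric] by simp
  also have "\<dots> \<longleftrightarrow> (\<forall>h\<in>H. x \<otimes> h \<otimes> inv x \<in> H \<and> inv x \<otimes> h \<otimes> x \<in> H)"
  proof
    assume e: "(\<lambda>h. x \<otimes> h \<otimes> inv x) ` H = H"
    show "\<forall>h\<in>H. x \<otimes> h \<otimes> inv x \<in> H \<and> inv x \<otimes> h \<otimes> x \<in> H"
    proof
      fix h assume h: "h \<in> H"
      then obtain k where k: "k \<in> H" "h = x \<otimes> k \<otimes> inv x" using e by blast
      have "k \<in> carrier G" using k H by blast
      then have "inv x \<otimes> h \<otimes> x = k" unfolding k using x by (simp add: m_assoc inv_solve_left')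
      then show "x \<otimes> h \<otimes> inv x \<in> H \<and> inv x \<otimes> h \<otimes> x \<in> H" using k h e by blast
    qed
  next
    assume a: "\<forall>h\<in>H. x \<otimes> h \<otimes> inv x \<in> H \<and> inv x \<otimes> h \<otimes> x \<in> H"
    show "(\<lambda>h. x \<otimes> h \<otimes> inv x) ` H = H"
    proof
      show "H \<subseteq> (\<lambda>h. x \<otimes> h \<otimes> inv x) ` H"
      proof
        fix h assume h: "h \<in> H"
        then have hc: "h \<in> carrier G" using H by blast
        have "x \<otimes> (inv x \<otimes> h \<otimes> x) \<otimes> inv x = h" 
        proof -
          have "x \<otimes> (inv x \<otimes> h) = h" using m_assoc[of x "inv x" h] x hc by simp
          then show ?thesis using x hc by (simp add: m_assoc)
        qed
        then show "h \<in> (\<lambda>h. x \<otimes> h \<otimes> inv x) ` H" using a h by (metis imageI)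
      qed
    qed (use a in auto)
  qed
  finally show ?thesis .
qed

lemma group_perm_group: "group (perm_group S)"
proof (rule groupI)
  fix f assume "f \<in> carrier (perm_group S)"
  then have f: "f permutes S" by (simp add: perm_group_def)
  show "\<exists>g\<in>carrier (perm_group S). g \<otimes>\<^bsub>perm_group S\<^esub> f = \<one>\<^bsub>perm_group S\<^esub>"
    using permutes_inv[OF f] permutes_inv_o(1)[OF f] by (intro bexI[of _ "iv f"]) (auto simp: perm_group_def)
qed (auto simp: perm_group_def permutes_compose permutes_id fun_eq_iff)

lemma inv_perm_group:
  assumes "f permutes S" shows "inv\<^bsub>perm_group S\<^esub> f = iv f"
proof -
  interpret group "perm_group S" by (rule group_perm_group)
  show ?thesis
    using assms permutes_inv[OF assms] permutes_inv_o(1)[OF assms]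
    by (intro inv_equality) (auto simp: perm_group_def)
qed

context regular_tree
begin

lemma group_tree_aut: "group (tree_aut n)"
proof (rule groupI)
  fix f assume "f \<in> carrier (tree_aut n)"
  then have f: "f \<in> Aut" by (simp add: tree_aut_def Aut_def)
  show "\<exists>g\<in>carrier (tree_aut n). g \<otimes>\<^bsub>tree_aut n\<^esub> f = \<one>\<^bsub>tree_aut n\<^esub>"
    using iv_Aut[OF f] iv_comp(2)[OF f]
    by (intro bexI[of _ "iv f"]) (auto simp: tree_aut_def perm_group_def Aut_def)
qed (use comp_Aut id_Aut in \<open>auto simp: tree_aut_def perm_group_def Aut_def fun_eq_iff\<close>)

lemma tree_aut_simps [simp]: "carrier (tree_aut n) = Aut" "f \<otimes>\<^bsub>tree_aut n\<^esub> g = g \<circ> f"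
  "\<one>\<^bsub>tree_aut n\<^esub> = id"
  by (simp_all add: tree_aut_def perm_group_def Aut_def)

lemma inv_tree_aut [simp]: "f \<in> Aut \<Longrightarrow> inv\<^bsub>tree_aut n\<^esub> f = iv f"
  using group.inv_equality[OF group_tree_aut, of "iv f" f] by simp

lemma subgroup_tree_aut_iff: "subgroup G (tree_aut n) \<longleftrightarrow> subgp G"
proof
  assume "subgroup G (tree_aut n)"
  then interpret subgroup G "tree_aut n" .
  have "G \<subseteq> Aut" using subset by simp
  then show "subgp G" unfolding subgp_def using one_closed m_closed m_inv_closed
    by (auto simp: subset_iff)
next
  assume "subgp G"
  then show "subgroup G (tree_aut n)"
    by (intro subgroup.intro) (auto simp: subgp_def subset_iff)
qed

text \<open>
  A series from \<open>G\<close> down to the trivial group such that each term is normal in \<open>G\<close> and the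
  commutators \<open>x y x\<^sup>-\<^sup>1 y\<^sup>-\<^sup>1\<close> of a term lie in the next one. Unlike the derived series itself,
  such series pass to branches term by term.
\<close>

definition solv_chain :: "(nat list \<Rightarrow> nat list) set \<Rightarrow> (nat \<Rightarrow> (nat list \<Rightarrow> nat list) set) \<Rightarrow> nat \<Rightarrow> bool"
  where "solv_chain G H d \<longleftrightarrow> H 0 = G \<and> H d = {id} \<and> (\<forall>i. subgp (H i) \<and> H i \<subseteq> G \<and> normalizes G (H i) \<and>
    (\<forall>x\<in>H i. \<forall>y\<in>H i. conj_by x y \<circ> iv y \<in> H (Suc i)))"

lemma solvable_imp_solv_chain:
  assumes G: "subgp G" and s: "solvable (tree_aut n \<lparr>carrier := G\<rparr>)"
  shows "\<exists>H d. solv_chain G H d"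
proof -
  interpret T: group "tree_aut n" by (rule group_tree_aut)
  have sG: "subgroup G (tree_aut n)" using G by (simp add: subgroup_tree_aut_iff)
  interpret K: group "tree_aut n \<lparr>carrier := G\<rparr>" using T.subgroup_imp_group[OF sG] .
  let ?K = "tree_aut n \<lparr>carrier := G\<rparr>"
  define H where "H i = (derived ?K ^^ i) G" for i
  obtain d where d: "H d = {id}" using s K.solvable_iff_trivial_derived_seq by (auto simp: H_def)
  have nrm: "H i \<lhd> ?K" for i
  proof (induction i)
    case 0
    show ?case using K.normal_self by (simp add: H_def)
  next
    case (Suc i)
    then show ?case using K.derived_is_normal by (simp add: H_def)
  qed
  have sub: "subgp (H i)" for i
  proof -
    have "subgroup (H i) ?K" using nrm[of i] by (simp add: normal_def)
    then show ?thesis using T.incl_subgroup[OF sG] by (simp add: subgroup_tree_aut_iff)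
  qed
  have inv: "inv\<^bsub>?K\<^esub> g = iv g" if "g \<in> G" for g
    using T.m_inv_consistent[OF sG that] subgp_Aut[OF G that] by simp
  have HG: "H i \<subseteq> G" for i using subgroup.subset[OF normal_imp_subgroup[OF nrm[of i]]] by simp
  have "normalizes G (H i)" for i
    unfolding normalizes_def
  proof (intro ballI)
    fix g h assume g: "g \<in> G" and h: "h \<in> H i"
    have "iv g \<otimes>\<^bsub>?K\<^esub> h \<otimes>\<^bsub>?K\<^esub> inv\<^bsub>?K\<^esub> (iv g) \<in> H i"
      using normal.inv_op_closed2[OF nrm[of i], of "iv g" h] g h subgp_iv[OF G] by simp
    then show "conj_by g h \<in> H i"
      using inv[OF subgp_iv[OF G g]] subgp_Aut[OF G g] by (simp add: conj_by_def o_assoc)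
  qed
  moreover have "conj_by x y \<circ> iv y \<in> H (Suc i)" if xy: "x \<in> H i" "y \<in> H i" for x y i
  proof -
    have xy': "x \<in> G" "y \<in> G" using xy HG by auto
    have a: "x \<in> Aut" "y \<in> Aut" using xy' subgp_Aut[OF G] by auto
    have m: "iv x \<in> H i" "iv y \<in> H i" using xy subgp_iv[OF sub] by auto
    have "iv y \<otimes>\<^bsub>?K\<^esub> iv x \<otimes>\<^bsub>?K\<^esub> inv\<^bsub>?K\<^esub> (iv y) \<otimes>\<^bsub>?K\<^esub> inv\<^bsub>?K\<^esub> (iv x) \<in> derived_set ?K (H i)"
      using m by blast
    then have "iv y \<otimes>\<^bsub>?K\<^esub> iv x \<otimes>\<^bsub>?K\<^esub> inv\<^bsub>?K\<^esub> (iv y) \<otimes>\<^bsub>?K\<^esub> inv\<^bsub>?K\<^esub> (iv x) \<in> H (Suc i)"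
      unfolding H_def funpow.simps comp_apply derived_def by (rule generate.incl)
    then show ?thesis
      using inv[OF subgp_iv[OF G xy'(1)]] inv[OF subgp_iv[OF G xy'(2)]] a by (simp add: conj_by_def o_assoc)
  qed
  moreover have "H 0 = G" by (simp add: H_def)
  ultimately have "solv_chain G H d" using d sub HG unfolding solv_chain_def by simp
  then show ?thesis by blast
qed

lemma conj_state_fix:
  assumes "g \<in> Aut" "h \<in> Aut" "rp g 0 = 0" "rp h 0 = 0"
  shows "st (conj_by g h) 0 = conj_by (st g 0) (st h 0)" "rp (conj_by g h) 0 = 0"
proof -
  show "st (conj_by g h) 0 = conj_by (st g 0) (st h 0)"
    using state_conj[of g h 0] assms by (simp add: conj_by_def)
  show "rp (conj_by g h) 0 = 0"
    using assms root_iv_app(1)[of g 0] by (simp add: conj_by_def root_comp)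
qed

lemma solv_chain_branch:
  assumes c: "solv_chain G H d" shows "solv_chain (branch G) (\<lambda>i. branch (H i)) d"
  unfolding solv_chain_def
proof (intro conjI allI)
  have H: "H 0 = G" "H d = {id}" "\<And>i. subgp (H i)" "\<And>i. normalizes G (H i)"
    "\<And>i x y. x \<in> H i \<Longrightarrow> y \<in> H i \<Longrightarrow> conj_by x y \<circ> iv y \<in> H (Suc i)" "\<And>i. H i \<subseteq> G"
    using c by (auto simp: solv_chain_def)
  show "branch (H 0) = branch G" using H by simp
  show "branch (H d) = {id}" unfolding H(2) by (auto simp: branch_def)
  fix i
  show "subgp (branch (H i))" using subgp_branch H by blast
  show "branch (H i) \<subseteq> branch G" using H(6)[of i] by (auto simp: branch_def)
  show "normalizes (branch G) (branch (H i))"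
    unfolding normalizes_def
  proof (intro ballI)
    fix g h assume "g \<in> branch G" "h \<in> branch (H i)"
    then obtain g' h' where e: "g = st g' 0" "h = st h' 0" "g' \<in> G" "h' \<in> H i" "rp g' 0 = 0" "rp h' 0 = 0"
      by (auto simp: branch_def)
    have a: "g' \<in> Aut" "h' \<in> Aut" using e H(1) subgp_Aut[OF H(3)] by auto
    have "conj_by g' h' \<in> H i" using H(4)[of i] e by (simp add: normalizes_def)
    then show "conj_by g h \<in> branch (H i)"
      using conj_state_fix[OF a e(5,6)] e unfolding branch_def by force
  qed
  show "\<forall>x\<in>branch (H i). \<forall>y\<in>branch (H i). conj_by x y \<circ> iv y \<in> branch (H (Suc i))"
  proof (intro ballI)
    fix g h assume "g \<in> branch (H i)" "h \<in> branch (H i)"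
    then obtain g' h' where e: "g = st g' 0" "h = st h' 0" "g' \<in> H i" "h' \<in> H i" "rp g' 0 = 0" "rp h' 0 = 0"
      by (auto simp: branch_def)
    have a: "g' \<in> Aut" "h' \<in> Aut" using e subgp_Aut[OF H(3)] by auto
    have r: "rp (iv h') 0 = 0" using root_iv_app(1)[of h' 0] a e by simp
    have "st (iv h') 0 = iv h" using state_iv[of h' 0] a e by simp
    then have "conj_by g h \<circ> iv h = st (conj_by g' h' \<circ> iv h') 0"
      using conj_state_fix[OF a e(5,6)] a r e by (simp add: state_comp)
    moreover have "rp (conj_by g' h' \<circ> iv h') 0 = 0"
      using conj_state_fix[OF a e(5,6)] a r by (simp add: root_comp)
    ultimately show "conj_by g h \<circ> iv h \<in> branch (H (Suc i))"
      using H(5)[OF e(3,4)] unfolding branch_def by blast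
  qed
qed

lemma generate_cyc: "generate (perm_group {..<n}) {\<sigma>} = range (\<lambda>k. \<sigma> ^^ k)"
proof
  show "generate (perm_group {..<n}) {\<sigma>} \<subseteq> range (\<lambda>k. \<sigma> ^^ k)"
  proof
    fix x assume "x \<in> generate (perm_group {..<n}) {\<sigma>}"
    then show "x \<in> range (\<lambda>k. \<sigma> ^^ k)"
    proof (induction rule: generate.induct)
      case one
      show ?case by (intro range_eqI[of _ _ 0]) (simp add: perm_group_def id_def)
    next
      case (incl h)
      then show ?case by (intro range_eqI[of _ _ 1]) simp
    next
      case (inv h)
      have "\<sigma> ^^ (n - 1) \<circ> \<sigma> = id" using cyc_pow_n Suc_diff_1[OF n_pos(1)] funpow_Suc_right by metis
      moreover have "\<sigma> \<circ> \<sigma> ^^ (n - 1) = id" using cyc_pow_n Suc_diff_1[OF n_pos(1)] funpow.simps(2) by metis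
      ultimately have "iv \<sigma> = \<sigma> ^^ (n - 1)" using inv_unique_comp by blast
      then show ?case using inv inv_perm_group[OF cyc_permutes] by auto
    next
      case (eng x y)
      then obtain k l where "x = \<sigma> ^^ k" "y = \<sigma> ^^ l" by auto
      then show ?case by (intro range_eqI[of _ _ "l + k"]) (simp add: perm_group_def funpow_add)
    qed
  qed
  show "range (\<lambda>k. \<sigma> ^^ k) \<subseteq> generate (perm_group {..<n}) {\<sigma>}"
  proof
    fix x assume "x \<in> range (\<lambda>k. \<sigma> ^^ k)"
    then obtain k where "x = \<sigma> ^^ k" by auto
    moreover have "\<sigma> ^^ k \<in> generate (perm_group {..<n}) {\<sigma>}"
    proof (induction k)
      case 0
      show ?case using generate.one[of "perm_group {..<n}"] by (simp add: perm_group_def id_def)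
    next
      case (Suc k)
      have "\<sigma> ^^ k \<otimes>\<^bsub>perm_group {..<n}\<^esub> \<sigma> \<in> generate (perm_group {..<n}) {\<sigma>}"
        using generate.eng[OF Suc generate.incl] by blast
      moreover have "\<sigma> ^^ k \<otimes>\<^bsub>perm_group {..<n}\<^esub> \<sigma> = \<sigma> ^^ Suc k"
        unfolding funpow.simps(2) by (simp add: perm_group_def)
      ultimately show ?case by metis
    qed
    ultimately show "x \<in> generate (perm_group {..<n}) {\<sigma>}" by simp
  qed
qed

lemma last_nontrivial:
  assumes "P 0" "\<not> P d" shows "\<exists>j. P j \<and> \<not> P (Suc j)"
  using assms by (induction d) auto

text \<open>
  For prime \<open>n\<close>, the last term of the series that acts nontrivially on the first level acts there as
  an abelian group, hence as \<open>\<langle>\<sigma>\<rangle>\<close>, and \<open>G\<close> normalizes it.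
\<close>

lemma root_in_top_group:
  assumes n: "prime n \<or> n = 4" and \<tau>: "\<tau> \<in> G" and c: "solv_chain G H d" and g: "g \<in> G"
  shows "rp g \<in> top_group n"
proof (cases "n = 4")
  case True
  have "g \<in> Aut" using c g subgp_Aut[of G g] by (auto simp: solv_chain_def)
  then show ?thesis using True root_permutes[of g] by (simp add: top_group_def perm_group_def)
next
  case False
  then have p: "prime n" using n by simp
  have H: "H 0 = G" "H d = {id}" "\<And>i. subgp (H i)" "\<And>i. normalizes G (H i)"
    "\<And>i x y. x \<in> H i \<Longrightarrow> y \<in> H i \<Longrightarrow> conj_by x y \<circ> iv y \<in> H (Suc i)"
    using c by (auto simp: solv_chain_def)
  have a: "h \<in> Aut" if "h \<in> H i" for h i using subgp_Aut[OF H(3)] that by blast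
  have G: "subgp G" using H(1) H(3)[of 0] by simp
  have "\<sigma> \<noteq> id" using cyc_pow[of 0 1] n2 by (auto simp: cyc_def dest!: fun_cong[of _ _ 0])
  then have "\<exists>h\<in>H 0. rp h \<noteq> id" using \<tau> H(1) root_tau by metis
  moreover have "\<not> (\<exists>h\<in>H d. rp h \<noteq> id)" using H(2) by simp
  ultimately obtain j where j: "\<exists>h\<in>H j. rp h \<noteq> id" "\<not> (\<exists>h\<in>H (Suc j). rp h \<noteq> id)"
    using last_nontrivial[of "\<lambda>i. \<exists>h\<in>H i. rp h \<noteq> id" d] by blast
  define A where "A = rp ` H j"
  have A: "perm_subgp A" unfolding A_def using root_perm_subgp H(3) by blast
  have Ac: "conj_by (rp g) x \<in> A" if gx: "g \<in> G" "x \<in> A" for g x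
  proof -
    obtain h where h: "h \<in> H j" "x = rp h" using gx by (auto simp: A_def)
    then have "conj_by g h \<in> H j" using H(4)[of j] gx by (simp add: normalizes_def)
    moreover have "rp (conj_by g h) = conj_by (rp g) x"
      using h subgp_Aut[OF G gx(1)] a by (simp add: root_conj)
    ultimately show ?thesis unfolding A_def by (metis imageI)
  qed
  have ab: "abelian A"
    unfolding abelian_def A_def
  proof (intro ballI)
    fix x y assume "x \<in> rp ` H j" "y \<in> rp ` H j"
    then obtain x' y' where xy: "x = rp x'" "y = rp y'" "x' \<in> H j" "y' \<in> H j" by auto
    have "rp (conj_by x' y' \<circ> iv y') = id" using j(2) H(5)[OF xy(3,4)] by blast
    then have e: "conj_by x y \<circ> iv y = id" using xy a by (simp add: root_comp root_conj root_iv)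
    have "bij y" using xy a root_bij[of y'] by simp
    then have "conj_by x y = conj_by x y \<circ> iv y \<circ> y" by (simp add: fun_eq_iff bij_is_inj)
    then have "conj_by x y = y" using e by simp
    then show "x \<circ> y = y \<circ> x" using conj_by_eq_iff[of x y y] root_bij[of x'] xy a by simp
  qed
  obtain a0 where a0: "a0 \<in> A" "a0 \<noteq> id" using j(1) by (auto simp: A_def)
  have sA: "\<sigma> \<in> A" using abelian_prime_degree[OF p A ab a0] Ac[OF \<tau>] by simp
  have pA: "\<sigma> ^^ k \<in> A" for k using sA A by (induction k) (auto simp: perm_subgp_def)
  have AR: "A = range (\<lambda>k. \<sigma> ^^ k)"
    using abelian_containing_cyc[OF A ab sA] pA by blast
  have ga: "g \<in> Aut" using subgp_Aut[OF G g] .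
  interpret P: group "perm_group {..<n}" by (rule group_perm_group)
  have car: "rp g \<in> carrier (perm_group {..<n})" using root_permutes[OF ga] by (simp add: perm_group_def)
  have "A \<subseteq> carrier (perm_group {..<n})" using A by (auto simp: perm_subgp_def perm_group_def)
  moreover have "\<forall>h\<in>A. rp g \<otimes>\<^bsub>perm_group {..<n}\<^esub> h \<otimes>\<^bsub>perm_group {..<n}\<^esub> inv\<^bsub>perm_group {..<n}\<^esub> (rp g) \<in> A \<and>
      inv\<^bsub>perm_group {..<n}\<^esub> (rp g) \<otimes>\<^bsub>perm_group {..<n}\<^esub> h \<otimes>\<^bsub>perm_group {..<n}\<^esub> rp g \<in> A"
  proof
    fix h assume h: "h \<in> A"
    have "iv (iv (rp g)) = rp g" using root_bij[OF ga] by (simp add: inv_inv_eq)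
    then show "rp g \<otimes>\<^bsub>perm_group {..<n}\<^esub> h \<otimes>\<^bsub>perm_group {..<n}\<^esub> inv\<^bsub>perm_group {..<n}\<^esub> (rp g) \<in> A \<and>
      inv\<^bsub>perm_group {..<n}\<^esub> (rp g) \<otimes>\<^bsub>perm_group {..<n}\<^esub> h \<otimes>\<^bsub>perm_group {..<n}\<^esub> rp g \<in> A"
      using Ac[OF g h] Ac[OF subgp_iv[OF G g] h]
      unfolding inv_perm_group[OF root_permutes[OF ga]] root_iv[OF ga] conj_by_def
      by (simp add: perm_group_def o_assoc)
  qed
  ultimately have "rp g \<in> normalizer (perm_group {..<n}) A" using P.normalizer_iff[OF _ car] by blast
  then show ?thesis using False by (simp add: top_group_def generate_cyc AR)
qed

text \<open>
  \<open>G\<close> has a conjugate inside some \<open>\<Gamma>\<^sub>i\<close>. In terms of the product of \<open>tree_aut n\<close>, which acts from the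
  right, \<open>conj_by \<gamma> g\<close> is \<open>\<gamma>\<^sup>-\<^sup>1 g \<gamma>\<close>.
\<close>

definition conj_into_Gamma :: "(nat list \<Rightarrow> nat list) set \<Rightarrow> bool"
  where "conj_into_Gamma G \<longleftrightarrow> (\<exists>i. \<exists>\<gamma>\<in>Aut. \<forall>g\<in>G. conj_by \<gamma> g \<in> Gamma n i)"

text \<open>
  If \<open>\<gamma>\<close> conjugates the branch into \<open>\<Gamma>\<^sub>i\<close>, then \<open>(\<gamma>, \<dots>, \<gamma>)\<close> conjugates \<open>G\<close> into \<open>\<Gamma>\<^sub>i\<^sub>+\<^sub>1\<close>.
\<close>

lemma conj_into_Gamma_branch:
  assumes G: "subgp G" "\<tau> \<in> G" and top: "\<And>g. g \<in> G \<Longrightarrow> rp g \<in> top_group n"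
    and b: "conj_into_Gamma (branch G)"
  shows "conj_into_Gamma G"
proof -
  obtain i \<gamma> where \<gamma>: "\<gamma> \<in> Aut" "\<And>g. g \<in> branch G \<Longrightarrow> conj_by \<gamma> g \<in> Gamma n i"
    using b by (auto simp: conj_into_Gamma_def)
  define \<delta> where "\<delta> = wreath n (\<lambda>_. \<gamma>) id"
  have d: "\<delta> \<in> Aut" "rp \<delta> = id" "\<And>j. j < n \<Longrightarrow> st \<delta> j = \<gamma>"
    using \<gamma> permutes_id by (simp_all add: \<delta>_def)
  have "conj_by \<delta> g \<in> Gamma n (Suc i)" if g: "g \<in> G" for g
  proof -
    have ga: "g \<in> Aut" using subgp_Aut[OF G(1) g] .
    have s: "st (conj_by \<delta> g) j = conj_by \<gamma> (st g j)" if "j < n" for j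
      using state_conj[OF d(1) ga that] d(2,3) that ga by (simp add: conj_by_def)
    have r: "rp (conj_by \<delta> g) = rp g" using d ga by (simp add: root_conj) (simp add: conj_by_def)
    have "conj_by \<delta> g = wreath n (st (conj_by \<delta> g)) (rp g)"
      using wreath_root_state[of "conj_by \<delta> g"] d ga r by simp
    moreover have "st (conj_by \<delta> g) j \<in> Gamma n i" if "j < n" for j
      using s[OF that] \<gamma>(2)[OF state_branch[OF G g that]] by simp
    ultimately show ?thesis using top[OF g] by auto
  qed
  then show ?thesis unfolding conj_into_Gamma_def using d(1) by blast
qed

section \<open>The action of an abelian normal subgroup on the first level\<close>

lemma tau_pair_Aut: "tau_pair G B \<Longrightarrow> b \<in> B \<Longrightarrow> b \<in> Aut" "tau_pair G B \<Longrightarrow> g \<in> G \<Longrightarrow> g \<in> Aut"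
  by (auto simp: tau_pair_def subgp_def)

lemma tau_pair_root:
  assumes P: "tau_pair G B"
  shows "perm_subgp (rp ` B)" "abelian (rp ` B)"
    "\<And>g x. g \<in> G \<Longrightarrow> x \<in> rp ` B \<Longrightarrow> conj_by (rp g) x \<in> rp ` B"
proof -
  note a = tau_pair_Aut[OF P]
  show "perm_subgp (rp ` B)" using root_perm_subgp tau_pairD(3)[OF P] by blast
  show "abelian (rp ` B)"
    unfolding abelian_def
  proof (intro ballI)
    fix x y assume "x \<in> rp ` B" "y \<in> rp ` B"
    then obtain x' y' where xy: "x = rp x'" "y = rp y'" "x' \<in> B" "y' \<in> B" by auto
    then have "rp (x' \<circ> y') = rp (y' \<circ> x')" using tau_pairD(4)[OF P] by (simp add: abelian_def)
    then show "x \<circ> y = y \<circ> x" using xy a by (simp add: root_comp)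
  qed
  fix g x assume "g \<in> G" "x \<in> rp ` B"
  then obtain x' where x: "x = rp x'" "x' \<in> B" "g \<in> G" by auto
  then have "rp (conj_by g x') = conj_by (rp g) x" using a by (simp add: root_conj)
  then show "conj_by (rp g) x \<in> rp ` B" using tau_pairD(5)[OF P x(3,2)] by (metis imageI)
qed

lemma perm_subgp_comp: "perm_subgp A \<Longrightarrow> a \<in> A \<Longrightarrow> b \<in> A \<Longrightarrow> a \<circ> b \<in> A"
  by (simp add: perm_subgp_def)

lemma bex_subset: "A \<subseteq> B \<Longrightarrow> \<exists>x\<in>A. Q x \<Longrightarrow> \<exists>x\<in>B. Q x"
  by blast

lemma cyc_in_root_prime:
  assumes P: "tau_pair G B" and p: "prime n" and b: "b \<in> B" "rp b \<noteq> id"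
  shows "\<sigma> \<in> rp ` B"
  using abelian_prime_degree[OF p tau_pair_root(1,2)[OF P], of "rp b"] b
    tau_pair_root(3)[OF P tau_pairD(2)[OF P]] by simp

lemma root_pow_id: "f \<in> Aut \<Longrightarrow> rp f = \<sigma> \<Longrightarrow> rp (f ^^ n) = id"
  by (simp add: root_funpow)

text \<open>
  If the branch acted trivially on its first level, an element \<open>b\<close> with root permutation \<open>\<sigma>\<close> would
  commute with \<open>\<tau>\<close> on the second level and be a power of \<open>\<tau>\<close> there.
\<close>

lemma branch1_root_nontrivial:
  assumes P: "tau_pair G B" and s: "\<sigma> \<in> rp ` B"
  shows "\<exists>b\<in>branch1 B. rp b \<noteq> id"
proof (rule ccontr)
  assume "\<not> (\<exists>b\<in>branch1 B. rp b \<noteq> id)"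
  then have triv: "rp b = id" if "b \<in> branch1 B" for b using that by blast
  note G = tau_pairD[OF P]
  note a = tau_pair_Aut[OF P]
  obtain b where b: "b \<in> B" "rp b = \<sigma>" using s by auto
  have fix2: "x [i, j] = [i, j]" if x: "x \<in> B" "rp x = id" "i < n" "j < n" for x i j
  proof -
    have "rp (st x i) = id" using triv state_branch1[OF P x(1-3)] by blast
    then have "st x i [j] = [j]" using Aut_Cons[of "st x i" j "[]"] x a by simp
    then show ?thesis using Aut_Cons[of x i "[j]"] x a by simp
  qed
  define k where "k = conj_by \<tau> b \<circ> iv b"
  have kB: "k \<in> B" unfolding k_def using G b by (intro subgp_comp subgp_iv) auto
  have "conj_by \<sigma> \<sigma> = \<sigma>" using conj_by_eq_iff[OF cyc_bij, of \<sigma> \<sigma>] by simp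
  moreover have "\<sigma> \<circ> iv \<sigma> = id" using cyc_bij surj_iff bij_is_surj by blast
  ultimately have "rp k = id" using a b by (simp add: k_def root_comp root_conj root_iv)
  have comm: "b (\<tau> v) = \<tau> (b v)" if v: "v \<in> words n" "length v = 2" for v
  proof -
    have "b (\<tau> v) \<in> words n" "length (b (\<tau> v)) = 2"
      using v a b by (simp_all add: Aut_words Aut_length)
    then obtain i j where ij: "b (\<tau> v) = [i, j]" "i < n" "j < n" by (auto simp: length_Suc_conv numeral_2_eq_2)
    have "k (b (\<tau> v)) = \<tau> (b v)" using a b by (simp add: k_def conj_by_def)
    then show ?thesis using fix2[OF kB \<open>rp k = id\<close>] ij by simp
  qed
  have comm': "b ((\<tau> ^^ i) (zs 2)) = (\<tau> ^^ i) (b (zs 2))" for i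
  proof (induction i)
    case (Suc i)
    have "(\<tau> ^^ i) (zs 2) \<in> words n \<and> length ((\<tau> ^^ i) (zs 2)) = 2"
      by (simp add: Aut_words Aut_length)
    then show ?case using comm Suc by simp
  qed simp
  have "b (zs 2) \<in> words n" "length (b (zs 2)) = 2" using a b by (simp_all add: Aut_words Aut_length)
  then obtain j where j: "(\<tau> ^^ j) (zs 2) = b (zs 2)"
    using tau_cyclic[of 2] unfolding cyclic_on_level_def by blast
  have pow: "(b ^^ m) (zs 2) = (\<tau> ^^ (m * j)) (zs 2)" for m
  proof (induction m)
    case (Suc m)
    have "(b ^^ Suc m) (zs 2) = (\<tau> ^^ (m * j)) ((\<tau> ^^ j) (zs 2))"
      using Suc comm' j by simp
    also have "\<dots> = (\<tau> ^^ (Suc m * j)) (zs 2)"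
      by (simp add: funpow_add[symmetric, THEN fun_cong, unfolded o_apply] add.commute)
    finally show ?case .
  qed simp
  have z2: "zs 2 = [0, 0]" by (simp add: numeral_2_eq_2 numeral_3_eq_3)
  have "(b ^^ n) (zs 2) = zs 2"
    unfolding z2 using fix2[of "b ^^ n" 0 0] subgp_pow[OF G(3) b(1)] root_pow_id[of b] b a by simp
  then have "n ^ 2 dvd n * j"
    using pow[of n] cyclic_on_level_period[OF tau_Aut tau_cyclic, of "n * j" 2] by simp
  then have "n dvd j" by (simp add: power2_eq_square)
  moreover have "rp b 0 = j mod n"
    using j Aut_Cons[of "\<tau> ^^ j" 0 "[0]"] Aut_Cons[of b 0 "[0]"] a b z2 by (simp add: root_tau_pow)
  ultimately show False using b n2 by (auto simp: cyc_def)
qed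

lemma double_step_in_root:
  assumes P: "tau_pair G B" and n: "n = 4" and b: "b \<in> B" "rp b \<noteq> id"
  shows "\<exists>b\<in>B. \<forall>i<4. rp b i = (i + 2) mod 4"
proof -
  let ?a = "rp b" and ?a' = "conj_by \<sigma> (rp b)"
  have aB: "?a \<in> rp ` B" "?a' \<in> rp ` B"
    using b tau_pair_root(3)[OF P tau_pairD(2)[OF P], of "rp b"] by auto
  have perm: "?a permutes {..<4}" using root_permutes[of b] tau_pair_Aut(1)[OF P b(1)] n by simp
  have ex: "\<exists>c\<in>{?a, ?a \<circ> ?a, ?a \<circ> ?a'}. \<forall>i<4. c i = (i + 2) mod 4"
  proof (rule double_step_of_commuting[OF perm])
    show "?a' (cyc 4 i) = cyc 4 (?a i)" for i
      using n by (simp add: conj_by_def bij_is_inj[OF cyc_bij[unfolded n]])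
    show "?a (?a' i) = ?a' (?a i)" for i using abelianD[OF tau_pair_root(2)[OF P] aB] .
  qed (use b in auto)
  have "{?a, ?a \<circ> ?a, ?a \<circ> ?a'} \<subseteq> rp ` B"
    using perm_subgp_comp[OF tau_pair_root(1)[OF P]] aB by blast
  then have "\<exists>c\<in>rp ` B. \<forall>i<4. c i = (i + 2) mod 4" by (rule bex_subset[OF _ ex])
  then show ?thesis by simp
qed

text \<open>
  Conjugation by \<open>\<tau>\<close> changes \<open>b\<close> only by an element \<open>k\<close> that fixes the first level. Comparing states
  at the letters 0 and 1 determines those of \<open>b\<close> modulo the branch, and the state of \<open>b\<^sup>2\<close> at 0
  shows that \<open>\<tau>v\<^sup>2\<close> lies in the branch, where \<open>v\<close> is the state of \<open>b\<close> at 0.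
\<close>

lemma cyc_in_branch1_root_4:
  assumes P: "tau_pair G B" and n: "n = 4" and b: "b \<in> B" "\<And>i. i < 4 \<Longrightarrow> rp b i = (i + 2) mod 4"
  shows "\<sigma> \<in> rp ` branch1 B"
proof -
  note G = tau_pairD[OF P]
  note au = tau_pair_Aut[OF P]
  note P' = tau_pair_branch[OF P]
  note G' = tau_pairD[OF P']
  note au' = tau_pair_Aut[OF P']
  have ba: "b \<in> Aut" using au b by simp
  have rb: "rp b \<circ> rp b = id"
  proof
    fix i show "(rp b \<circ> rp b) i = id i"
      using b(2)[of i] b(2)[of "(i + 2) mod 4"] root_outside[of i b] n by (cases "i < 4") (auto simp: mod_simps)
  qed
  define k where "k = conj_by \<tau> b \<circ> iv b"
  have kB: "k \<in> B" unfolding k_def using G b by (intro subgp_comp subgp_iv) auto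
  have ka: "k \<in> Aut" using au kB by simp
  have kb: "k \<circ> (b \<circ> \<tau>) = \<tau> \<circ> b" using ba by (simp add: k_def conj_by_def fun_eq_iff)
  have "\<sigma> \<circ> rp b = rp b \<circ> \<sigma>"
  proof
    fix i show "(\<sigma> \<circ> rp b) i = (rp b \<circ> \<sigma>) i"
      using b(2)[of i] b(2)[of "cyc 4 i"] root_outside[of i b] n by (cases "i < 4") (auto simp: cyc_def mod_simps)
  qed
  then have "conj_by \<sigma> (rp b) = rp b" using conj_by_eq_iff[OF cyc_bij] by blast
  moreover have "rp b \<circ> iv (rp b) = id" using root_bij[OF ba] surj_iff bij_is_surj by blast
  ultimately have rk: "rp k = id" using ba by (simp add: k_def root_comp root_conj root_iv)
  have kst: "st k i \<in> branch1 B" if "i < n" for i using state_branch1[OF P kB rk that] .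
  have stb: "st b i \<in> Aut" if "i < n" for i using ba that by simp
  have eq: "st \<tau> (rp b i) \<circ> st b i = st k (rp b (\<sigma> i)) \<circ> (st b (\<sigma> i) \<circ> st \<tau> i)" if "i < n" for i
    using arg_cong[OF kb, of "\<lambda>f. st f i"] that ba ka by (simp add: state_comp root_comp)
  let ?v = "st b 0"
  have t: "st \<tau> 0 = id" "st \<tau> 1 = id" "st \<tau> 2 = id" "st \<tau> 3 = \<tau>"
    using state_tau[of 0] state_tau[of 1] state_tau[of 2] state_tau[of 3] n by simp_all
  have rs: "rp b 0 = 2" "rp b 1 = 3" "rp b 2 = 0" "\<sigma> 0 = 1" "\<sigma> 1 = 2"
    using b(2)[of 0] b(2)[of 1] b(2)[of 2] n by simp_all
  have e0: "?v = st k 3 \<circ> st b 1"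
    using eq[of 0] unfolding rs t id_comp comp_id using n_pos by blast
  have e1: "\<tau> \<circ> st b 1 = st k 0 \<circ> st b 2"
    using eq[of 1] unfolding rs t id_comp comp_id using n2 by simp
  have e2: "st (b \<circ> b) 0 = st b 2 \<circ> ?v" using state_comp[OF ba ba, of 0] rs by simp
  have bb: "st (b \<circ> b) 0 \<in> branch1 B"
    using subgp_comp[OF G(3) b(1) b(1)] rb ba by (auto simp: branch1_def root_comp)
  define x where "x = \<tau> \<circ> ?v \<circ> ?v"
  have "3 < n" using n by simp
  then have k3: "st k 3 \<in> branch1 B" "st k 3 \<in> Aut" using kst[of 3] ka by simp_all
  \<comment> \<open>move the factor \<open>st k 3\<close> of the branch to the left of \<open>\<tau>\<close>\<close>
  have "x = conj_by \<tau> (st k 3) \<circ> (\<tau> \<circ> st b 1 \<circ> ?v)"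
    unfolding x_def by (subst (1) e0) (simp add: conj_by_def fun_eq_iff)
  also have "\<tau> \<circ> st b 1 \<circ> ?v = st k 0 \<circ> st (b \<circ> b) 0" unfolding e1 e2 by (simp add: o_assoc)
  finally have x: "x = conj_by \<tau> (st k 3) \<circ> (st k 0 \<circ> st (b \<circ> b) 0)" .
  have xB: "x \<in> branch1 B"
    unfolding x by (intro subgp_comp[OF G'(3)] G'(5)[OF G'(2) k3(1)] kst bb) simp
  have vG: "?v \<in> branch G" using state_branch[OF G(1,2), of b 0] b G by auto
  have va: "?v \<in> Aut" and xa: "x \<in> Aut" using ba by (simp_all add: x_def)
  let ?a = "rp x" and ?c = "rp ?v" and ?a' = "conj_by \<sigma> (rp x)" and ?b = "conj_by (rp ?v) (rp x)"
  have aB: "?a \<in> rp ` branch1 B" "?a' \<in> rp ` branch1 B" "?b \<in> rp ` branch1 B"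
    using xB tau_pair_root(3)[OF P' G'(2), of ?a] tau_pair_root(3)[OF P' vG, of ?a] by auto
  have "\<exists>y\<in>{?a, ?a \<circ> ?a \<circ> ?a}. \<forall>i<4. y i = cyc 4 i"
  proof (rule full_cycle_of_commuting)
    show "?c permutes {..<4}" using root_permutes[OF va] n by simp
    have "rp x = \<sigma> \<circ> ?c \<circ> ?c" using va by (simp add: x_def root_comp)
    then show "?a i = cyc 4 (?c (?c i))" for i using n by simp
    show "?a' (cyc 4 i) = cyc 4 (?a i)" for i
      using n by (simp add: conj_by_def bij_is_inj[OF cyc_bij[unfolded n]])
    show "?a (?a' i) = ?a' (?a i)" "?a (?b i) = ?b (?a i)" for i
      using abelianD[OF tau_pair_root(2)[OF P']] aB by blast+
    show "?b (?c i) = ?c (?a i)" for i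
      by (simp add: conj_by_def bij_is_inj[OF root_bij[OF va]])
  qed
  then obtain y where y: "y \<in> {?a, ?a \<circ> ?a \<circ> ?a}" "\<forall>i<4. y i = cyc 4 i" by blast
  have "?a \<circ> ?a \<circ> ?a \<in> rp ` branch1 B" using perm_subgp_comp[OF tau_pair_root(1)[OF P']] aB by blast
  then have yB: "y \<in> rp ` branch1 B" using y aB(1) by blast
  then have "y permutes {..<n}" using tau_pair_root(1)[OF P'] unfolding perm_subgp_def by blast
  then have "y = \<sigma>" using y n by (intro cyc_mem_of_pow1) auto
  then show ?thesis using yB by simp
qed

text \<open>
  \<open>B\<close> acts on the first level as \<open>\<langle>\<sigma>\<rangle>\<close>. For the admissible \<open>n\<close> this property passes to the branches,
  see \<open>good_pair_branch\<close>.
\<close>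

definition good_pair :: "(nat list \<Rightarrow> nat list) set \<Rightarrow> (nat list \<Rightarrow> nat list) set \<Rightarrow> bool"
  where "good_pair G B \<longleftrightarrow> tau_pair G B \<and> \<sigma> \<in> rp ` B"

lemma good_pair_branch1:
  assumes n: "prime n \<or> n = 4" and P: "tau_pair G B" and b: "b \<in> B" "rp b \<noteq> id"
  shows "good_pair (branch G) (branch1 B)"
proof (cases "n = 4")
  case True
  then obtain b' where "b' \<in> B" "\<forall>i<4. rp b' i = (i + 2) mod 4"
    using double_step_in_root[OF P True b] by blast
  then have "\<sigma> \<in> rp ` branch1 B" using cyc_in_branch1_root_4[OF P True] by blast
  then show ?thesis using tau_pair_branch[OF P] by (simp add: good_pair_def)
next
  case False
  then have p: "prime n" using n by simp
  obtain b' where "b' \<in> branch1 B" "rp b' \<noteq> id"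
    using branch1_root_nontrivial[OF P cyc_in_root_prime[OF P p b]] by blast
  then have "\<sigma> \<in> rp ` branch1 B" using cyc_in_root_prime[OF tau_pair_branch[OF P] p] by blast
  then show ?thesis using tau_pair_branch[OF P] by (simp add: good_pair_def)
qed

lemma cyc_neq_id: "\<sigma> \<noteq> id"
  using n2 by (auto simp: cyc_def dest!: fun_cong[of _ _ 0])

lemma good_pair_branch:
  assumes n: "prime n \<or> n = 4" and Q: "good_pair G B"
  shows "good_pair (branch G) (branch1 B)"
proof -
  obtain b where "b \<in> B" "rp b = \<sigma>" using Q by (auto simp: good_pair_def)
  then show ?thesis using good_pair_branch1[OF n, of G B b] Q cyc_neq_id by (simp add: good_pair_def)
qed

text \<open>
  Some element of \<open>B\<close> moves a word \<open>w\<close>. Descend along \<open>w\<close> to the first letter that is moved.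
\<close>

lemma descend_to_good_pair:
  assumes n: "prime n \<or> n = 4"
    and key: "\<And>G B. good_pair G B \<Longrightarrow> conj_into_Gamma G"
    and P: "tau_pair G B" and c: "solv_chain G H d" and b: "b \<in> B"
    and w: "w \<in> words n" "b w \<noteq> w"
  shows "conj_into_Gamma G"
  using P c b w
proof (induction w arbitrary: G B H b)
  case Nil
  then show ?case using tau_pair_Aut by simp
next
  case (Cons i u)
  note P = Cons.prems(1)
  note G = tau_pairD[OF P]
  have ba: "b \<in> Aut" using tau_pair_Aut[OF P] Cons.prems by simp
  have "conj_into_Gamma (branch G)"
  proof (cases "rp b = id")
    case True
    then have "st b i u \<noteq> u" using Cons.prems Aut_Cons[OF ba, of i u] by simp
    moreover have "st b i \<in> branch1 B" using state_branch1[OF P Cons.prems(3) True] Cons.prems by simp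
    ultimately show ?thesis
      using Cons.IH[OF tau_pair_branch[OF P] solv_chain_branch[OF Cons.prems(2)]] Cons.prems by simp
  next
    case False
    then show ?thesis using key good_pair_branch1[OF n P Cons.prems(3)] by blast
  qed
  then show ?case
    using conj_into_Gamma_branch[OF G(1,2)] root_in_top_group[OF n G(2) Cons.prems(2)] by blast
qed

end

section \<open>Elements that are transitive on every level\<close>

lemma funpow_comp_commute:
  assumes "f \<circ> g = g \<circ> f" shows "(f \<circ> g) ^^ j = f ^^ j \<circ> g ^^ j"
proof -
  have c: "(f ^^ i) (g x) = g ((f ^^ i) x)" for i x
    using assms by (induction i) (auto simp: fun_eq_iff)
  show ?thesis
  proof
    fix x show "((f \<circ> g) ^^ j) x = (f ^^ j \<circ> g ^^ j) x"
      by (induction j) (simp_all add: c)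
  qed
qed

lemma conj_by_funpow: "bij g \<Longrightarrow> conj_by g (f ^^ j) = conj_by g f ^^ j"
proof (induction j)
  case 0
  then show ?case by (auto simp: conj_by_def fun_eq_iff bij_is_surj surj_f_inv_f)
next
  case (Suc j)
  show ?case unfolding funpow.simps(2) conj_by_comp[OF Suc.prems] Suc.IH[OF Suc.prems] ..
qed

context regular_tree
begin

lemma good_pairD:
  assumes "good_pair G B" shows "tau_pair G B" "\<sigma> \<in> rp ` B"
  using assms by (simp_all add: good_pair_def)

lemma good_pair_root_cyc:
  assumes Q: "good_pair G B" and b: "b \<in> B" shows "rp b = \<sigma> ^^ rp b 0"
  using abelian_containing_cyc[OF tau_pair_root(1,2)[OF good_pairD(1)[OF Q]] good_pairD(2)[OF Q], of "rp b"] b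
  by simp

lemma good_pair_level_transitive:
  assumes n: "prime n \<or> n = 4"
  shows "good_pair G B \<Longrightarrow> w \<in> words n \<Longrightarrow> length w = k \<Longrightarrow> \<exists>b\<in>B. b (zs k) = w"
proof (induction k arbitrary: G B w)
  case 0
  then show ?case using subgp_id[OF tau_pairD(3)[OF good_pairD(1)[OF 0(1)]]]
    by (auto intro!: bexI[of _ id])
next
  case (Suc k)
  note Q = Suc.prems(1)
  note G = tau_pairD[OF good_pairD(1)[OF Q]]
  note a = tau_pair_Aut[OF good_pairD(1)[OF Q]]
  obtain i u where w: "w = i # u" and i: "i < n" and u: "u \<in> words n" and k: "length u = k"
    using Suc.prems by (cases w) auto
  obtain b0 where b0: "b0 \<in> B" "rp b0 = \<sigma>" using good_pairD(2)[OF Q] by auto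
  define c where "c = b0 ^^ i"
  have cB: "c \<in> B" unfolding c_def using G b0 subgp_pow by blast
  have c: "c \<in> Aut" "rp c 0 = i" using a[of c] cB b0 i a by (auto simp: c_def root_funpow cyc_pow)
  define v where "v = iv (st c 0) u"
  have v: "v \<in> words n" "length v = length u" "st c 0 v = u"
    using u c by (simp_all add: v_def Aut_words Aut_length)
  obtain b' where b': "b' \<in> branch1 B" "b' (zs k) = v"
    using Suc.IH[OF good_pair_branch[OF n Q] v(1)] v(2) k by auto
  then obtain b where b: "b' = st b 0" "b \<in> B" "rp b = id" by (auto simp: branch1_def)
  have "(c \<circ> b) (0 # zs k) = i # u"
    using b b' v c a by (simp add: Aut_Cons)
  then show ?case using subgp_comp[OF G(3) cB b(2)] w by (intro bexI[of _ "c \<circ> b"]) simp_all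
qed

lemma good_pair_regular:
  assumes n: "prime n \<or> n = 4" and Q: "good_pair G B" and b: "b \<in> B"
    and w: "w \<in> words n" "b w = w" and v: "v \<in> words n" "length v = length w"
  shows "b v = v"
proof -
  note ab = abelianD[OF tau_pairD(4)[OF good_pairD(1)[OF Q]]]
  note a = tau_pair_Aut[OF good_pairD(1)[OF Q]]
  obtain c where c: "c \<in> B" "c (zs (length w)) = w" using good_pair_level_transitive[OF n Q w(1) refl] by blast
  obtain d where d: "d \<in> B" "d (zs (length w)) = v" using good_pair_level_transitive[OF n Q v(1,2)] by blast
  have "c (b (zs (length w))) = c (zs (length w))" using ab[OF b c(1), of "zs (length w)"] c w by simp
  then have "b (zs (length w)) = zs (length w)" using Aut_inj[OF a(1)[OF c(1)]] by (simp add: inj_eq)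
  then show ?thesis using ab[OF b d(1), of "zs (length w)"] d by simp
qed

lemma good_pair_conj_fix:
  assumes n: "prime n \<or> n = 4" and Q: "good_pair G B" and b: "b \<in> B"
  shows "conj_by \<tau> b (zs k) = zs k \<longleftrightarrow> b (zs k) = zs k"
proof
  note G = tau_pairD[OF good_pairD(1)[OF Q]]
  have cB: "conj_by \<tau> b \<in> B" using G b by blast
  have t: "\<tau> (zs k) \<in> words n" "length (\<tau> (zs k)) = k" "iv \<tau> (zs k) \<in> words n" "length (iv \<tau> (zs k)) = k"
    by (simp_all add: Aut_words Aut_length)
  {
    assume "conj_by \<tau> b (zs k) = zs k"
    then have "conj_by \<tau> b (\<tau> (zs k)) = \<tau> (zs k)" using good_pair_regular[OF n Q cB, of "zs k"] t by simp
    then have "\<tau> (b (zs k)) = \<tau> (zs k)" by (simp add: conj_by_def)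
    then show "b (zs k) = zs k" using Aut_inj[OF tau_Aut] by (simp add: inj_eq)
  next
    assume "b (zs k) = zs k"
    then have "b (iv \<tau> (zs k)) = iv \<tau> (zs k)" using good_pair_regular[OF n Q b, of "zs k"] t by simp
    then show "conj_by \<tau> b (zs k) = zs k" by (simp add: conj_by_def)
  }
qed

text \<open>
  For \<open>x\<close> fixing the first level, \<open>x\<close> moves the word \<open>00\<close> to \<open>0j\<close> with \<open>j = rot x\<close>. If \<open>x\<close> is in \<open>B\<close>, its
  state at \<open>0\<close> has root permutation \<open>\<sigma>\<^sup>j\<close>, so that \<open>rot\<close> is additive modulo \<open>n\<close>.
\<close>

abbreviation "rot x \<equiv> rp (st x 0) 0"

lemma rot_fix_iff:
  assumes Q: "good_pair G B" and x: "x \<in> B"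
  shows "rp x = id \<Longrightarrow> x (zs 2) = [0, rot x]"
    and "x (zs 2) = [0, j] \<Longrightarrow> rp x = id \<and> rot x = j"
proof -
  have xa: "x \<in> Aut" using tau_pair_Aut(1)[OF good_pairD(1)[OF Q] x] .
  have z: "zs 2 = [0, 0]" by (simp add: numeral_2_eq_2)
  have e: "x (zs 2) = [rp x 0, rot x]"
    unfolding z using Aut_Cons[OF xa, of 0 "[0]"] Aut_Cons[of "st x 0" 0 "[]"] xa by simp
  show "x (zs 2) = [0, rot x]" if "rp x = id" using e that by simp
  show "rp x = id \<and> rot x = j" if "x (zs 2) = [0, j]" using e that good_pair_root_cyc[OF Q x] by (simp add: id_def)
qed

lemma rot_comp:
  assumes Q: "good_pair G B" and n: "prime n \<or> n = 4" and x: "x \<in> B" "y \<in> B" "rp x = id" "rp y = id"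
  shows "rot (x \<circ> y) = (rot x + rot y) mod n" "rp (x \<circ> y) = id" "x \<circ> y \<in> B"
proof -
  note a = tau_pair_Aut[OF good_pairD(1)[OF Q]]
  have "st x 0 \<in> branch1 B" using x by (auto simp: branch1_def)
  then have "rp (st x 0) = \<sigma> ^^ rot x" using good_pair_root_cyc[OF good_pair_branch[OF n Q]] by blast
  then have "rot (x \<circ> y) = (\<sigma> ^^ rot x) (rot y)" using x a by (simp add: state_comp root_comp)
  then show "rot (x \<circ> y) = (rot x + rot y) mod n" using x a by (simp add: cyc_pow add.commute)
  show "rp (x \<circ> y) = id" using x a by (simp add: root_comp)
  show "x \<circ> y \<in> B" using subgp_comp tau_pairD(3)[OF good_pairD(1)[OF Q]] x by blast
qed

lemma rot_pow:
  assumes Q: "good_pair G B" and n: "prime n \<or> n = 4" and x: "x \<in> B" "rp x = id"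
  shows "rot (x ^^ j) = j * rot x mod n \<and> rp (x ^^ j) = id \<and> x ^^ j \<in> B"
proof (induction j)
  case 0
  then show ?case using subgp_id tau_pairD(3)[OF good_pairD(1)[OF Q]] by (simp add: id_def[symmetric])
next
  case (Suc j)
  then have IH: "rot (x ^^ j) = j * rot x mod n" "rp (x ^^ j) = id" "x ^^ j \<in> B" by blast+
  have "rot (x \<circ> x ^^ j) = Suc j * rot x mod n"
    unfolding rot_comp(1)[OF Q n x(1) IH(3) x(2) IH(2)] IH(1) by (simp add: mod_simps)
  then show ?case using rot_comp(2,3)[OF Q n x(1) IH(3) x(2) IH(2)] unfolding funpow.simps(2) by blast
qed

text \<open>
  Conjugation by \<open>\<tau>\<close> multiplies \<open>rot\<close> by some \<open>u\<close> modulo \<open>n\<close>. Since \<open>\<tau>\<^sup>n\<close> has state \<open>\<tau>\<close> at 0, conjugation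
  by it preserves \<open>rot\<close>, so \<open>u\<^sup>n = 1\<close>; as \<open>n\<close> is a power of the prime \<open>r\<close>, this gives \<open>u = 1\<close>
  modulo \<open>r\<close>.
\<close>

lemma rot_conj:
  assumes Q: "good_pair G B" and n: "prime n \<or> n = 4" and x: "x \<in> B" "rp x = id"
    and r: "prime r" "n = r \<or> n = 4 \<and> r = 2"
  shows "[rot (conj_by \<tau> x) = rot x] (mod r)" "rp (conj_by \<tau> x) = id" "conj_by \<tau> x \<in> B"
proof -
  note G = tau_pairD[OF good_pairD(1)[OF Q]]
  note a = tau_pair_Aut[OF good_pairD(1)[OF Q]]
  let ?T = "conj_by \<tau>"
  have TB: "?T y \<in> B" if "y \<in> B" for y using G that by blast
  have Tr: "rp (?T y) = id" if "y \<in> B" "rp y = id" for y using that a root_conj_id by simp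
  show "rp (conj_by \<tau> x) = id" "conj_by \<tau> x \<in> B" using TB Tr x by auto
  have bt: "bij \<tau>" using Aut_bij by simp
  have rless: "rot y < n" if "y \<in> B" for y using a that by simp
  obtain x1' where "x1' \<in> branch1 B" "rp x1' = \<sigma>"
    using good_pair_branch[OF n Q] by (auto simp: good_pair_def)
  then obtain x1 where x1: "x1 \<in> B" "rp x1 = id" "rp (st x1 0) = \<sigma>" by (auto simp: branch1_def)
  have r1: "rot x1 = 1" using x1 n2 by (simp add: cyc_def)
  define u where "u = rot (?T x1)"
  have lin: "[rot (?T y) = u * rot y] (mod n)" if y: "y \<in> B" "rp y = id" for y
  proof -
    \<comment> \<open>\<open>y\<close> is a power of \<open>x1\<close> up to a factor \<open>z\<close> that fixes the second level\<close>
    define k where "k = rot y"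
    define z where "z = iv (x1 ^^ k) \<circ> y"
    have p: "rot (x1 ^^ k) = k" "rp (x1 ^^ k) = id" "x1 ^^ k \<in> B"
      using rot_pow[OF Q n x1(1,2), of k] r1 rless[OF y(1)] by (simp_all add: k_def)
    have pa: "x1 ^^ k \<in> Aut" using a p by simp
    have zB: "z \<in> B" unfolding z_def by (intro subgp_comp[OF G(3)] subgp_iv[OF G(3)] p y)
    have zr: "rp z = id" using p pa y a by (simp add: z_def root_comp root_iv inv_id[unfolded id_def[symmetric]])
    have yz: "y = x1 ^^ k \<circ> z" using pa by (simp add: z_def fun_eq_iff)
    have "rot (x1 ^^ k \<circ> z) = (k + rot z) mod n" using rot_comp(1)[OF Q n p(3) zB p(2) zr] p(1) by simp
    then have "k = (k + rot z) mod n" unfolding yz[symmetric] k_def[symmetric] .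
    moreover have "k < n" "rot z < n" using rless y zB k_def by auto
    ultimately have "rot z = 0" by (cases "k + rot z < n") (auto simp: le_mod_geq)
    then have "?T z (zs 2) = zs 2"
      using good_pair_conj_fix[OF n Q zB, of 2] rot_fix_iff(1)[OF Q zB zr] by (simp add: numeral_2_eq_2)
    then have tz: "rot (?T z) = 0" using rot_fix_iff(2)[OF Q TB[OF zB], of 0] by (simp add: numeral_2_eq_2)
    have "?T y = ?T x1 ^^ k \<circ> ?T z" unfolding yz conj_by_comp[OF bt] conj_by_funpow[OF bt] ..
    moreover have q: "rot (?T x1 ^^ k) = k * u mod n" "rp (?T x1 ^^ k) = id" "?T x1 ^^ k \<in> B"
      using rot_pow[OF Q n TB[OF x1(1)] Tr[OF x1(1,2)], of k] by (simp_all add: u_def)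
    ultimately have "rot (?T y) = (k * u) mod n"
      using rot_comp(1)[OF Q n q(3) TB[OF zB] q(2) Tr[OF zB zr]] tz by simp
    then show ?thesis by (simp add: k_def cong_def mult.commute)
  qed
  have it: "[rot ((?T ^^ j) x1) = u ^ j] (mod n) \<and> (?T ^^ j) x1 \<in> B \<and> rp ((?T ^^ j) x1) = id" for j
  proof (induction j)
    case (Suc j)
    then have "[rot (?T ((?T ^^ j) x1)) = u * rot ((?T ^^ j) x1)] (mod n)" using lin by blast
    also have "[u * rot ((?T ^^ j) x1) = u * u ^ j] (mod n)" using Suc by (simp add: cong_scalar_left)
    finally have "[rot (?T ((?T ^^ j) x1)) = u ^ Suc j] (mod n)" by simp
    then show ?case using Suc TB Tr unfolding funpow.simps(2) comp_apply by blast
  qed (use x1 r1 in simp)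
  have "conj_by (\<tau> ^^ n) x1 = (?T ^^ n) x1"
    unfolding conj_by_eq_iff[OF Aut_bij[OF funpow_Aut[OF tau_Aut]]]
    using funpow_conj_by[OF bt, of n x1] by (rule sym)
  then have "(?T ^^ n) x1 = conj_by (\<tau> ^^ n) x1" by (rule sym)
  moreover have "st (conj_by (\<tau> ^^ n) x1) 0 = conj_by \<tau> (st x1 0)"
    using conj_state_fix(1)[of "\<tau> ^^ n" x1] a x1 by (simp add: root_tau_pow state_tau_pow_n)
  moreover have "conj_by \<sigma> \<sigma> = \<sigma>" using conj_by_eq_iff[OF cyc_bij] by blast
  ultimately have "rot ((?T ^^ n) x1) = 1" using x1 a n2 by (simp add: root_conj) (simp add: cyc_def)
  then have "[1 = u ^ n] (mod n)" using it[of n] by simp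
  moreover have rn: "r dvd n" using r by auto
  ultimately have un: "[1 = u ^ n] (mod r)" by (rule cong_dvd_modulus_nat)
  have "[u = 1] (mod r)"
  proof (cases "n = 4 \<and> r = 2")
    case True
    then have "odd (u ^ n)" using un by (auto simp: cong_def mod2_eq_if split: if_splits)
    then show ?thesis using True by (auto simp: cong_def odd_iff_mod_2_eq_one)
  next
    case False
    then have nr: "n = r" using r by blast
    have "\<not> r dvd u"
    proof
      assume "r dvd u"
      then have "r dvd u ^ n" using n2 dvd_trans[OF _ dvd_power[of n u]] by simp
      then have "r dvd 1" using un by (metis cong_dvd_iff)
      then show False using r(1) by simp
    qed
    then have "[u ^ (r - 1) = 1] (mod r)" using fermat_theorem r(1) by blast
    then have "[u * u ^ (r - 1) = u * 1] (mod r)" by (rule cong_scalar_left)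
    moreover have "u * u ^ (r - 1) = u ^ n" using nr n2 by (metis Suc_diff_1 n_pos(1) power_Suc)
    ultimately have "[u ^ n = u] (mod r)" by simp
    then show ?thesis using cong_sym[OF cong_trans[OF un]] by blast
  qed
  then have "[u * rot x = 1 * rot x] (mod r)" by (rule cong_scalar_right)
  moreover have "[rot (?T x) = u * rot x] (mod r)" by (rule cong_dvd_modulus_nat[OF lin[OF x] rn])
  ultimately show "[rot (conj_by \<tau> x) = rot x] (mod r)" unfolding mult_1 by (rule cong_trans[rotated])
qed

text \<open>
  The product \<open>a \<circ> a\<^sub>1 \<circ> \<dots> \<circ> a\<^sub>j\<^sub>-\<^sub>1\<close> of the conjugates \<open>a\<^sub>i\<close> of \<open>a\<close> by \<open>\<tau>\<^sup>i\<close>.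
\<close>

primrec norm_prod :: "(nat list \<Rightarrow> nat list) \<Rightarrow> nat \<Rightarrow> nat list \<Rightarrow> nat list"
  where "norm_prod a 0 = id" | "norm_prod a (Suc j) = a \<circ> conj_by \<tau> (norm_prod a j)"

lemma norm_prod_mem:
  assumes P: "tau_pair G B" and a: "a \<in> B" shows "norm_prod a j \<in> B"
proof (induction j)
  case 0
  show ?case unfolding norm_prod.simps by (rule subgp_id[OF tau_pairD(3)[OF P]])
next
  case (Suc j)
  then show ?case unfolding norm_prod.simps
    by (intro subgp_comp[OF tau_pairD(3)[OF P]] a tau_pairD(5)[OF P tau_pairD(2)[OF P]])
qed

text \<open>
  With \<open>s = a\<^sup>-\<^sup>1 \<tau>\<close>, conjugation by \<open>s\<close> and by \<open>\<tau>\<close> agree on the abelian group \<open>B\<close>; now expand the power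
  of \<open>\<tau> = as\<close>.
\<close>

lemma tau_pow_norm_prod:
  assumes P: "tau_pair G B" and a: "a \<in> B"
  shows "\<tau> ^^ j = norm_prod a j \<circ> (iv a \<circ> \<tau>) ^^ j"
proof (induction j)
  case 0
  show ?case by simp
next
  case (Suc j)
  have aa: "a \<in> Aut" using tau_pair_Aut[OF P] a by simp
  have c: "conj_by \<tau> (norm_prod a j) (a x) = a (conj_by \<tau> (norm_prod a j) x)" for x
    using abelianD[OF tau_pairD(4)[OF P] tau_pairD(5)[OF P tau_pairD(2)[OF P] norm_prod_mem[OF P a]] a] .
  have t: "\<tau> (norm_prod a j x) = conj_by \<tau> (norm_prod a j) (\<tau> x)" for x by (simp add: conj_by_def)
  have "(\<tau> ^^ Suc j) x = (norm_prod a (Suc j) \<circ> (iv a \<circ> \<tau>) ^^ Suc j) x" for x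
  proof -
    let ?y = "((iv a \<circ> \<tau>) ^^ j) x"
    have "(\<tau> ^^ Suc j) x = \<tau> (norm_prod a j ?y)" 
      using fun_cong[OF Suc, of x] unfolding comp_apply funpow.simps(2) by (rule arg_cong)
    also have "\<dots> = conj_by \<tau> (norm_prod a j) (a (iv a (\<tau> ?y)))" using t aa by simp
    also have "\<dots> = a (conj_by \<tau> (norm_prod a j) ((iv a \<circ> \<tau>) ?y))" unfolding c by simp
    finally show ?thesis by simp
  qed
  then show ?case by blast
qed

lemma norm_prod_fix:
  assumes P: "tau_pair G B" and a: "a \<in> B" "a (zs k) = \<tau> (zs k)"
  shows "norm_prod a j (zs k) = (\<tau> ^^ j) (zs k)"
proof -
  have aa: "a \<in> Aut" using tau_pair_Aut[OF P] a by simp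
  have "(iv a \<circ> \<tau>) (zs k) = zs k" using a(2)[symmetric] aa by simp
  then have "((iv a \<circ> \<tau>) ^^ j) (zs k) = zs k" by (induction j) auto
  then show ?thesis using fun_cong[OF tau_pow_norm_prod[OF P a(1), of j], of "zs k"] by simp
qed

text \<open>
  Let \<open>d\<close> be \<open>a\<^sup>-\<^sup>1\<close> times the conjugate of \<open>a\<close> by \<open>\<tau>\<close>. Each factor of the product is \<open>a\<close>
  times conjugates of \<open>d\<close>, and \<open>rot\<close> does not see the conjugation.
\<close>

lemma rot_shifted_pow:
  assumes Q: "good_pair G B" and n: "prime n \<or> n = 4"
    and r: "prime r" "n = r \<or> n = 4 \<and> r = 2" and a: "a \<in> B" "rp a = \<sigma>"
  shows "\<exists>f\<in>B. rp f = id \<and> norm_prod a j = a ^^ j \<circ> f \<and>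
    [rot f = (\<Sum>l<j. l) * rot (iv a \<circ> conj_by \<tau> a)] (mod r)"
proof (induction j)
  case 0
  have "rot id = 0" by (simp only: state_id root_id id_apply)
  then have "[rot id = (\<Sum>l<(0::nat). l) * rot (iv a \<circ> conj_by \<tau> a)] (mod r)" by simp
  then show ?case unfolding norm_prod.simps funpow.simps id_comp
    using subgp_id[OF tau_pairD(3)[OF good_pairD(1)[OF Q]]] root_id by blast
next
  case (Suc j)
  note P = good_pairD(1)[OF Q]
  note G = tau_pairD[OF P]
  note au = tau_pair_Aut[OF P]
  define d where "d = iv a \<circ> conj_by \<tau> a"
  obtain f where f: "f \<in> B" "rp f = id" "norm_prod a j = a ^^ j \<circ> f"
    "[rot f = (\<Sum>l<j. l) * rot d] (mod r)" using Suc d_def by blast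
  have TaB: "conj_by \<tau> a \<in> B" using G a by blast
  have dB: "d \<in> B" unfolding d_def by (intro subgp_comp[OF G(3)] subgp_iv[OF G(3)] a TaB)
  have "conj_by \<sigma> \<sigma> = \<sigma>" using conj_by_eq_iff[OF cyc_bij] by blast
  then have "rp d = iv \<sigma> \<circ> \<sigma>" using a au by (simp add: d_def root_comp root_conj root_iv)
  then have dr: "rp d = id" using cyc_bij by (simp add: bij_is_inj)
  have aa: "a \<in> Aut" using au a by simp
  have "a \<circ> d = d \<circ> a" using G(4) a dB unfolding abelian_def by blast
  then have "conj_by \<tau> a ^^ j = a ^^ j \<circ> d ^^ j"
    using funpow_comp_commute[of a d j] aa by (simp add: d_def o_assoc)
  then have Taj: "conj_by \<tau> (a ^^ j) = a ^^ j \<circ> d ^^ j" using conj_by_funpow[of \<tau> j a] Aut_bij by simp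
  note dj = rot_pow[OF Q n dB dr, of j]
  note Tf = rot_conj[OF Q n f(1,2) r]
  define f' where "f' = d ^^ j \<circ> conj_by \<tau> f"
  have f': "f' \<in> B" "rp f' = id" "rot f' = (rot (d ^^ j) + rot (conj_by \<tau> f)) mod n"
    using rot_comp[OF Q n, of "d ^^ j" "conj_by \<tau> f"] dj Tf unfolding f'_def by blast+
  have "norm_prod a (Suc j) = a \<circ> (conj_by \<tau> (a ^^ j) \<circ> conj_by \<tau> f)"
    unfolding norm_prod.simps f(3) using conj_by_comp[of \<tau>] Aut_bij by simp
  also have "\<dots> = a ^^ Suc j \<circ> f'" unfolding Taj f'_def by (simp add: fun_eq_iff)
  finally have e: "norm_prod a (Suc j) = a ^^ Suc j \<circ> f'" .
  have rn: "r dvd n" using r by auto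
  have "[rot f' = rot (d ^^ j) + rot (conj_by \<tau> f)] (mod n)" using f'(3) by (simp add: cong_def)
  then have "[rot f' = rot (d ^^ j) + rot (conj_by \<tau> f)] (mod r)" using rn by (rule cong_dvd_modulus_nat)
  moreover have "[rot (d ^^ j) = j * rot d] (mod n)" using dj by (simp add: cong_def)
  then have "[rot (d ^^ j) = j * rot d] (mod r)" using rn by (rule cong_dvd_modulus_nat)
  moreover have "[rot (conj_by \<tau> f) = (\<Sum>l<j. l) * rot d] (mod r)" using Tf(1) f(4) by (rule cong_trans)
  ultimately have "[rot f' = j * rot d + (\<Sum>l<j. l) * rot d] (mod r)" by (rule cong_trans[OF _ cong_add])
  then have "[rot f' = (\<Sum>l<Suc j. l) * rot d] (mod r)" by (simp add: add_mult_distrib add.commute)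
  then show ?case using e f'(1,2) d_def by blast
qed

text \<open>
  The exponent \<open>0 + \<dots> + (n - 1)\<close> of the correction is divisible by \<open>r\<close>, because \<open>n\<close> is an odd prime
  \<open>r\<close>, or \<open>n = 4\<close>, \<open>r = 2\<close> and the exponent is 6.
\<close>

lemma exists_generating_element_odd:
  assumes Q: "good_pair G B" and n: "prime n \<or> n = 4" and ne2: "n \<noteq> 2"
    and r: "prime r" "n = r \<or> n = 4 \<and> r = 2"
  shows "\<exists>a\<in>B. rp a = \<sigma> \<and> [rot (a ^^ n) = 1] (mod r)"
proof -
  note P = good_pairD(1)[OF Q]
  note G = tau_pairD[OF P]
  note au = tau_pair_Aut[OF P]
  obtain a where a: "a \<in> B" "a (zs 2) = \<tau> (zs 2)"
    using good_pair_level_transitive[OF n Q, of "\<tau> (zs 2)" 2] by (auto simp: Aut_words Aut_length)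
  have aa: "a \<in> Aut" using au a by simp
  have z: "zs 2 = [0, 0]" by (simp add: numeral_2_eq_2)
  have "rp a 0 = 1"
    using a(2) Aut_Cons[OF aa, of 0 "[0]"] Aut_Cons[of \<tau> 0 "[0]"] n2 unfolding z by (simp add: cyc_def)
  then have ar: "rp a = \<sigma>" using good_pair_root_cyc[OF Q a(1)] by simp
  obtain f where f: "f \<in> B" "rp f = id" "norm_prod a n = a ^^ n \<circ> f"
    "[rot f = (\<Sum>l<n. l) * rot (iv a \<circ> conj_by \<tau> a)] (mod r)"
    using rot_shifted_pow[OF Q n r a(1) ar, of n] by blast
  have "r dvd (\<Sum>l<n. l)"
  proof (cases "n = 4 \<and> r = 2")
    case True
    have "(\<Sum>l<4::nat. l) = 6" by (simp add: numeral_eq_Suc)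
    then show ?thesis using True by simp
  next
    case False
    then have nr: "n = r" using r by blast
    then have "odd n" using r(1) ne2 prime_odd_nat[of n] n2 by simp
    then obtain m where m: "n = 2 * m + 1" by (auto elim: oddE)
    have "(\<Sum>l<2 * m + 1. l) = m * (2 * m + 1)" for m :: nat by (induction m) auto
    then have "(\<Sum>l<n. l) = m * n" unfolding m .
    then show ?thesis using nr by simp
  qed
  then have "[(\<Sum>l<n. l) * rot (iv a \<circ> conj_by \<tau> a) = 0] (mod r)" by (simp add: cong_0_iff)
  then have f0: "[rot f = 0] (mod r)" by (rule cong_trans[OF f(4)])
  have an: "a ^^ n \<in> B" "rp (a ^^ n) = id" using subgp_pow[OF G(3) a(1)] root_pow_id[OF aa ar] by auto
  have "norm_prod a n (zs 2) = (\<tau> ^^ n) (zs 2)" by (rule norm_prod_fix[OF P a])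
  also have "\<dots> = [0, 1]"
    using Aut_Cons[of "\<tau> ^^ n" 0 "[0]"] Aut_Cons[of \<tau> 0 "[]"] n2
    unfolding z by (simp add: root_tau_pow state_tau_pow_n cyc_def)
  finally have "rot (norm_prod a n) = 1" using rot_fix_iff(2)[OF Q norm_prod_mem[OF P a(1)]] by blast
  then have "1 = (rot (a ^^ n) + rot f) mod n"
    using rot_comp(1)[OF Q n an(1) f(1) an(2) f(2)] f(3) by simp
  then have "[1 = rot (a ^^ n) + rot f] (mod n)" by (simp add: cong_def)
  then have "[1 = rot (a ^^ n) + rot f] (mod r)" using cong_dvd_modulus_nat[of 1 _ n r] r(2) by auto
  moreover have "[rot (a ^^ n) + rot f = rot (a ^^ n) + 0] (mod r)" using f0 by (intro cong_add cong_refl)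
  ultimately have "[rot (a ^^ n) = 1] (mod r)" unfolding add_0_right by (rule cong_sym[OF cong_trans])
  then show ?thesis using a(1) ar by blast
qed

text \<open>
  In the binary tree the elements of \<open>B\<close> that fix the leftmost word of length \<open>k + 1\<close> form a subgroup
  of index at most 2 in those that fix the leftmost word of length \<open>k\<close>.
\<close>

lemma good_pair_index_two:
  assumes Q: "good_pair G B" and n: "n = 2" and x: "x \<in> B" "y \<in> B"
    and fx: "x (zs k) = zs k" "y (zs k) = zs k"
    and mv: "x (zs (Suc k)) = zs (Suc k) \<longleftrightarrow> y (zs (Suc k)) = zs (Suc k)"
  shows "(x \<circ> y) (zs (Suc k)) = zs (Suc k)"
proof (cases "y (zs (Suc k)) = zs (Suc k)")
  case True
  then show ?thesis using mv by simp
next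
  case False
  note au = tau_pair_Aut[OF good_pairD(1)[OF Q]]
  have p: "prime n \<or> n = 4" using n by simp
  have zk: "zs (Suc k) = zs k @ [0]" by (simp add: replicate_append_same)
  have form: "\<exists>e<2. z (zs k @ [d]) = zs k @ [e]" if "z \<in> B" "z (zs k) = zs k" "d < 2" for z d
  proof -
    have za: "z \<in> Aut" using au that by simp
    have w: "zs k @ [d] \<in> words n" using that n by simp
    have "butlast (z (zs k @ [d])) = zs k" using Aut_butlast[OF za w] that by simp
    moreover have "length (z (zs k @ [d])) = Suc k" using Aut_length[OF za w] by simp
    ultimately obtain e where e: "z (zs k @ [d]) = zs k @ [e]"
      by (metis append_butlast_last_id list.size(3) nat.distinct(1))
    have "zs k @ [e] \<in> words n" using Aut_words[OF za, of "zs k @ [d]"] w e by simp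
    then show ?thesis using e n by auto
  qed
  have one: "z (zs k @ [0]) = zs k @ [1]" if z: "z \<in> B" "z (zs k) = zs k" "z (zs (Suc k)) \<noteq> zs (Suc k)" for z
    using form[OF z(1,2), of 0] z(3) unfolding zk by (auto simp: less_2_cases_iff)
  have x1: "x (zs k @ [0]) = zs k @ [1]" and y1: "y (zs k @ [0]) = zs k @ [1]"
    using one x fx mv False by blast+
  obtain e where e: "e < 2" "x (zs k @ [1]) = zs k @ [e]" using form[OF x(1) fx(1), of 1] by auto
  have "e \<noteq> 1"
  proof
    assume "e = 1"
    then have "x (zs k @ [1]) = x (zs k @ [0])" using e x1 by simp
    then have "zs k @ [1] = zs k @ [0]" using Aut_inj[OF au(1)[OF x(1)]] by (simp only: inj_eq)
    then show False by simp
  qed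
  then have "e = 0" using e by simp
  then show ?thesis unfolding zk comp_apply y1 e(2) by simp
qed

text \<open>
  Write \<open>F k\<close> for the stabilizer in \<open>B\<close> of the leftmost word of length \<open>k\<close>, which is the stabilizer of
  level \<open>k\<close>, and \<open>T\<close> for conjugation by \<open>\<tau>\<close>. Consecutive stabilizers have index at most 2, so
  squares and quotients of \<open>T x\<close> by \<open>x\<close> drop by one level. Choose \<open>a\<close> in \<open>B\<close> that agrees with \<open>\<tau>\<close> at
  \<open>000\<close>. If \<open>y = a\<^sup>2\<close> were in \<open>F 2\<close>, then the product of the first four conjugates of \<open>a\<close>, which agrees
  with \<open>\<tau>\<^sup>4\<close> at \<open>000\<close>, would be in \<open>F 3\<close>; but \<open>\<tau>\<close> has order 8 on the third level.
\<close>

lemma exists_generating_element_two: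
  assumes Q: "good_pair G B" and n: "n = 2"
  shows "\<exists>a\<in>B. rp a = \<sigma> \<and> [rot (a ^^ n) = 1] (mod 2)"
proof -
  note P = good_pairD(1)[OF Q]
  note G = tau_pairD[OF P]
  note au = tau_pair_Aut[OF P]
  note ab = abelianD[OF G(4)]
  have p: "prime n \<or> n = 4" using n by simp
  let ?T = "conj_by \<tau>"
  have TB: "?T x \<in> B" if "x \<in> B" for x using G that by blast
  have iB: "iv x \<in> B" if "x \<in> B" for x using subgp_iv[OF G(3)] that by blast
  have cB: "x \<circ> y \<in> B" if "x \<in> B" "y \<in> B" for x y using subgp_comp[OF G(3)] that by blast
  define F where "F k = {x \<in> B. x (zs k) = zs k}" for k
  have FB: "x \<in> B" if "x \<in> F k" for x k using that by (simp add: F_def)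
  have TF: "?T x \<in> F k \<longleftrightarrow> x \<in> F k" if "x \<in> B" for x k
    using good_pair_conj_fix[OF p Q that, of k] TB that by (simp add: F_def)
  have FF: "x \<circ> y \<in> F (Suc k)" if "x \<in> F k" "y \<in> F k" "x \<in> F (Suc k) \<longleftrightarrow> y \<in> F (Suc k)" for x y k
    using good_pair_index_two[OF Q n, of x y k] that cB by (simp add: F_def)
  have iF: "iv x \<in> F k \<longleftrightarrow> x \<in> F k" if "x \<in> B" for x k
  proof -
    have "iv x (zs k) = zs k \<longleftrightarrow> x (zs k) = zs k" using au(1)[OF that] by (metis iv_left iv_right)
    then show ?thesis using that iB by (simp add: F_def)
  qed
  obtain a where a: "a \<in> B" "a (zs 3) = \<tau> (zs 3)"
    using good_pair_level_transitive[OF p Q, of "\<tau> (zs 3)" 3] by (auto simp: Aut_words Aut_length)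
  have aa: "a \<in> Aut" using au a by simp
  have z: "zs 3 = [0, 0, 0]" by (simp add: numeral_3_eq_3)
  have "rp a 0 = 1"
    using a(2) Aut_Cons[OF aa, of 0 "[0, 0]"] Aut_Cons[of \<tau> 0 "[0, 0]"] n2 unfolding z by (simp add: cyc_def)
  then have ar: "rp a = \<sigma>" using good_pair_root_cyc[OF Q a(1)] by simp
  define y where "y = a \<circ> a"
  define d where "d = iv a \<circ> ?T a"
  have yB: "y \<in> B" and dB: "d \<in> B" unfolding y_def d_def using a TB iB cB by blast+
  have y2: "y = a ^^ n" unfolding y_def n by (simp add: numeral_2_eq_2)
  have yr: "rp y = id" unfolding y2 by (rule root_pow_id[OF aa ar])
  have F1: "x \<in> F 1" if "x \<in> B" "rp x = id" for x
    using that Aut_Cons[OF au(1)[OF that(1)], of 0 "[]"] au(1)[OF that(1)] by (simp add: F_def)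
  have "conj_by \<sigma> \<sigma> = \<sigma>" using conj_by_eq_iff[OF cyc_bij] by blast
  then have "rp d = iv \<sigma> \<circ> \<sigma>" using aa ar by (simp add: d_def root_comp root_conj root_iv)
  then have d1: "d \<in> F 1" using F1[OF dB] cyc_bij by (simp add: bij_is_inj)
  have "y \<notin> F 2"
  proof
    assume yF: "y \<in> F 2"
    have Ta: "?T a x = a (d x)" for x using aa by (simp add: d_def)
    have ad: "a (d x) = d (a x)" for x using ab a dB by blast
    have bt: "bij \<tau>" using Aut_bij by simp
    have dd: "d \<circ> d \<in> F 3"
    proof -
      have "?T y = y \<circ> (d \<circ> d)" unfolding y_def conj_by_comp[OF bt] using ad by (simp add: fun_eq_iff Ta)
      then have "d \<circ> d = iv y \<circ> ?T y" using au(1)[OF yB] by (simp add: fun_eq_iff)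
      moreover have "iv y \<circ> ?T y \<in> F (Suc 2)"
        using yF TF[OF yB] iF[OF yB] by (intro FF) auto
      ultimately show ?thesis by simp
    qed
    have yy: "y \<circ> ?T (?T y) \<in> F (Suc 2)"
      using yF TF[OF yB] TF[OF TB[OF yB]] by (intro FF) auto
    define e where "e = iv d \<circ> ?T d"
    have eB: "e \<in> B" unfolding e_def using iB cB TB dB by blast
    have "e \<in> F (Suc 1)" unfolding e_def using d1 TF[OF dB] iF[OF dB] by (intro FF) auto
    then have e2: "e \<in> F 2" by (simp add: numeral_2_eq_2)
    have ee: "e \<circ> ?T e \<in> F (Suc 2)" using e2 TF[OF eB] by (intro FF) auto
    have da: "d \<in> Aut" using au dB by simp
    have "?T d = d \<circ> e" using da by (simp add: e_def fun_eq_iff)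
    then have TTd: "?T (?T d) = d \<circ> (e \<circ> ?T e)" by (simp add: conj_by_comp[OF bt] o_assoc)
    have "norm_prod a 4 = a \<circ> ?T (a \<circ> ?T (a \<circ> ?T (a \<circ> ?T id)))"
      by (simp add: numeral_eq_Suc fun_eq_iff)
    also have "?T id = id" using bt by (auto simp: conj_by_def fun_eq_iff bij_is_surj surj_f_inv_f)
    also have "a \<circ> ?T (a \<circ> ?T (a \<circ> ?T (a \<circ> id))) = (a \<circ> ?T a) \<circ> ?T (?T (a \<circ> ?T a))"
      by (simp add: conj_by_comp[OF bt] fun_eq_iff)
    also have "a \<circ> ?T a = y \<circ> d" by (simp add: y_def fun_eq_iff Ta)
    also have "?T (?T (y \<circ> d)) = ?T (?T y) \<circ> ?T (?T d)" by (simp add: conj_by_comp[OF bt])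
    also have "y \<circ> d \<circ> (?T (?T y) \<circ> ?T (?T d)) = (y \<circ> ?T (?T y)) \<circ> ((d \<circ> d) \<circ> (e \<circ> ?T e))"
      using ab[OF dB TB[OF TB[OF yB]]] unfolding TTd by (simp add: fun_eq_iff)
    finally have "norm_prod a 4 (zs 3) = zs 3" using yy ee dd by (simp add: F_def numeral_3_eq_3 numeral_2_eq_2)
    then have "(\<tau> ^^ 4) (zs 3) = zs 3" using norm_prod_fix[OF P a(1), of 3 4] a(2) by simp
    then have "n ^ 3 dvd 4" using cyclic_on_level_period[OF tau_Aut tau_cyclic, of 4 3] by simp
    then show False using n by simp
  qed
  then have "y (zs 2) \<noteq> [0, 0]" using yB by (simp add: F_def numeral_2_eq_2)
  then have "rot y \<noteq> 0" using rot_fix_iff(1)[OF Q yB yr] by auto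
  moreover have "rot y < 2" using au(1)[OF yB] n n2 by (metis n_pos(1) root_less state_Aut)
  ultimately have "rot y = 1" by simp
  then show ?thesis using a(1) ar y2 by auto
qed

lemma exists_generating_element:
  assumes Q: "good_pair G B" and r: "prime r" "n = r \<or> n = 4 \<and> r = 2"
  shows "\<exists>a\<in>B. rp a = \<sigma> \<and> [rot (a ^^ n) = 1] (mod r)"
proof (cases "n = 2")
  case True
  then show ?thesis using exists_generating_element_two[OF Q True] r by auto
next
  case False
  then show ?thesis using exists_generating_element_odd[OF Q _ False r] r by auto
qed

text \<open>
  Being transitive on the first level means that the exponent of the root permutation is prime to
  \<open>r\<close>. One element \<open>a\<close> whose \<open>n\<close>-th power is transitive on the next level suffices: every \<open>b\<close> is
  \<open>a\<^sup>j x\<close> with \<open>x\<close> fixing the first level, and \<open>x\<^sup>n\<close> does not contribute modulo \<open>n\<close>.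
\<close>

lemma generating_element_branch:
  assumes Q: "good_pair G B" and r: "prime r" "n = r \<or> n = 4 \<and> r = 2"
    and b: "b \<in> B" "\<not> r dvd rp b 0"
  shows "rp (b ^^ n) = id" "st (b ^^ n) 0 \<in> branch1 B" "\<not> r dvd rp (st (b ^^ n) 0) 0"
proof -
  note P = good_pairD(1)[OF Q]
  note G = tau_pairD[OF P]
  note au = tau_pair_Aut[OF P]
  have n: "prime n \<or> n = 4" using r by auto
  obtain a where a: "a \<in> B" "rp a = \<sigma>" "[rot (a ^^ n) = 1] (mod r)"
    using exists_generating_element[OF Q r] by blast
  have aa: "a \<in> Aut" "b \<in> Aut" using au a b by auto
  have rb: "rp b = \<sigma> ^^ rp b 0" by (rule good_pair_root_cyc[OF Q b(1)])
  then have "rp (b ^^ n) = (\<sigma> ^^ n) ^^ rp b 0"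
    using aa by (metis funpow_mult mult.commute root_funpow)
  then show rbn: "rp (b ^^ n) = id" by simp
  have bnB: "b ^^ n \<in> B" using subgp_pow[OF G(3) b(1)] .
  then show "st (b ^^ n) 0 \<in> branch1 B" using rbn unfolding branch1_def by blast
  define j where "j = rp b 0"
  define x where "x = iv (a ^^ j) \<circ> b"
  have ajB: "a ^^ j \<in> B" using subgp_pow[OF G(3) a(1)] .
  have xB: "x \<in> B" unfolding x_def by (intro subgp_comp[OF G(3)] subgp_iv[OF G(3)] ajB b)
  have aj: "a ^^ j \<in> Aut" using aa by simp
  have "rp (a ^^ j) = rp b" using aa a rb j_def by (simp add: root_funpow)
  then have "rp x = iv (rp b) \<circ> rp b" using aa aj by (simp add: x_def root_comp root_iv)
  then have xr: "rp x = id" using root_bij[OF aa(2)] by (simp add: bij_is_inj)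
  have bx: "b = a ^^ j \<circ> x" using aj by (simp add: x_def fun_eq_iff)
  have "a ^^ j \<circ> x = x \<circ> a ^^ j" using G(4) ajB xB unfolding abelian_def by blast
  then have "b ^^ n = (a ^^ j) ^^ n \<circ> x ^^ n" using funpow_comp_commute[of "a ^^ j" x n] bx by simp
  also have "(a ^^ j) ^^ n = (a ^^ n) ^^ j" by (simp add: funpow_mult mult.commute)
  finally have bn: "b ^^ n = (a ^^ n) ^^ j \<circ> x ^^ n" .
  have an: "a ^^ n \<in> B" "rp (a ^^ n) = id" using subgp_pow[OF G(3) a(1)] root_pow_id[OF aa(1) a(2)] by auto
  have anj: "rot ((a ^^ n) ^^ j) = j * rot (a ^^ n) mod n" "rp ((a ^^ n) ^^ j) = id" "(a ^^ n) ^^ j \<in> B"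
    using rot_pow[OF Q n an, of j] by auto
  have xn: "rot (x ^^ n) = n * rot x mod n" "rp (x ^^ n) = id" "x ^^ n \<in> B"
    using rot_pow[OF Q n xB xr, of n] by auto
  have "rot (b ^^ n) = j * rot (a ^^ n) mod n"
    unfolding bn rot_comp(1)[OF Q n anj(3) xn(3) anj(2) xn(2)] anj(1) xn(1) by simp
  then have "[rot (b ^^ n) = j * rot (a ^^ n)] (mod n)" by (simp add: cong_def)
  moreover have "r dvd n" using r by auto
  ultimately have "[rot (b ^^ n) = j * rot (a ^^ n)] (mod r)" by (rule cong_dvd_modulus_nat)
  moreover have "[j * rot (a ^^ n) = j * 1] (mod r)" using a(3) by (rule cong_scalar_left)
  ultimately have c: "[rot (b ^^ n) = j * 1] (mod r)" by (rule cong_trans)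
  show "\<not> r dvd rp (st (b ^^ n) 0) 0" using b(2) cong_dvd_iff[OF c] unfolding j_def by simp
qed

lemma cyclic_on_level_of_generating:
  assumes r: "prime r" "n = r \<or> n = 4 \<and> r = 2"
  shows "good_pair G B \<Longrightarrow> b \<in> B \<Longrightarrow> \<not> r dvd rp b 0 \<Longrightarrow> cyclic_on_level b k"
proof (induction k arbitrary: G B b)
  case 0
  show ?case by simp
next
  case (Suc k)
  note Q = Suc.prems(1)
  have n: "prime n \<or> n = 4" using r by auto
  have ba: "b \<in> Aut" using tau_pair_Aut good_pairD(1)[OF Q] Suc.prems by blast
  note g = generating_element_branch[OF Q r Suc.prems(2,3)]
  show ?case
  proof (rule cyclic_on_level_Suc[OF ba])
    fix i assume i: "i < n"
    define m where "m = rp b 0"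
    have "coprime r m" using r(1) Suc.prems(3) prime_imp_coprime unfolding m_def by blast
    then have "coprime m n" using r(2) coprime_power_right_iff[of m 2 2] by (auto simp: coprime_commute)
    then obtain x where "[m * x = 1] (mod n)" using cong_solve_coprime_nat[of m n] by auto
    then have "[m * x * i = 1 * i] (mod n)" by (rule cong_scalar_right)
    then have mx: "m * (x * i) mod n = i" using i by (simp add: cong_def mult.assoc)
    have "rp b = \<sigma> ^^ m" unfolding m_def by (rule good_pair_root_cyc[OF Q Suc.prems(2)])
    then have "rp (b ^^ (x * i)) 0 = m * (x * i) mod n"
      using ba by (simp add: root_funpow funpow_mult cyc_pow mult.commute)
    then show "\<exists>j. rp (b ^^ j) 0 = i" using mx by auto
  next
    show "rp (b ^^ n) 0 = 0" using g(1) by simp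
    show "cyclic_on_level (st (b ^^ n) 0) k"
      using Suc.IH[OF good_pair_branch[OF n Q] g(2,3)] .
  qed
qed

section \<open>The centralizer of the adding machine and its conjugates\<close>

lemma cyclic_same_exponents:
  assumes f: "f \<in> Aut" "cyclic_on_level f k" and g: "g \<in> Aut" "cyclic_on_level g k"
    and e: "(f ^^ i) (zs k) = (f ^^ j) (zs k)"
  shows "(g ^^ i) (zs k) = (g ^^ j) (zs k)"
proof -
  have *: "(g ^^ i) (zs k) = (g ^^ j) (zs k)" if ij: "i \<le> j" "(f ^^ i) (zs k) = (f ^^ j) (zs k)" for i j
  proof -
    have s: "(h ^^ j) (zs k) = (h ^^ i) ((h ^^ (j - i)) (zs k))" for h :: "nat list \<Rightarrow> nat list"
      using ij(1) by (simp add: funpow_add[symmetric, THEN fun_cong, unfolded o_apply])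
    have "(f ^^ (j - i)) (zs k) = zs k"
      using ij(2) s[of f] Aut_inj[OF funpow_Aut[OF f(1), of i]] by (simp add: inj_eq)
    then have "(g ^^ (j - i)) (zs k) = zs k"
      using cyclic_on_level_period[OF f] cyclic_on_level_period[OF g] by simp
    then show ?thesis using s[of g] by simp
  qed
  show ?thesis
  proof (cases "i \<le> j")
    case True
    then show ?thesis using e by (rule *)
  next
    case False
    then have "j \<le> i" by simp
    then show ?thesis using e[symmetric] by (rule *[symmetric])
  qed
qed

text \<open>
  The conjugator maps the image of the leftmost word under \<open>b\<^sup>j\<close> to its image under \<open>\<tau>\<^sup>j\<close>.
\<close>

lemma conj_to_tau:
  assumes b: "b \<in> Aut" "\<And>k. cyclic_on_level b k"
  shows "\<exists>\<gamma>\<in>Aut. conj_by \<gamma> b = \<tau>"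
proof -
  define \<gamma> where "\<gamma> w = (if w \<in> words n then (\<tau> ^^ (SOME j. (b ^^ j) (zs (length w)) = w)) (zs (length w)) else w)" for w
  have len: "length ((f ^^ j) (zs k)) = k" "(f ^^ j) (zs k) \<in> words n" if "f \<in> Aut" for f j k
    using that by (simp_all add: Aut_length Aut_words)
  have g: "\<gamma> ((b ^^ j) (zs k)) = (\<tau> ^^ j) (zs k)" for j k
  proof -
    define i where "i = (SOME i. (b ^^ i) (zs k) = (b ^^ j) (zs k))"
    have "(b ^^ i) (zs k) = (b ^^ j) (zs k)" unfolding i_def by (rule someI) (rule refl)
    then have "(\<tau> ^^ i) (zs k) = (\<tau> ^^ j) (zs k)"
      by (rule cyclic_same_exponents[OF b tau_Aut tau_cyclic])
    then show ?thesis using len[OF b(1), where j=j and k=k] by (simp add: \<gamma>_def i_def)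
  qed
  have ex: "\<exists>j. w = (f ^^ j) (zs (length w))" if "w \<in> words n" "\<And>k. cyclic_on_level f k" for w f
    using that(2)[of "length w"] that(1) unfolding cyclic_on_level_def by metis
  have gA: "\<gamma> \<in> Aut"
  proof (rule AutI)
    have "bij_betw \<gamma> (words n) (words n)"
      unfolding bij_betw_def
    proof
      show "inj_on \<gamma> (words n)"
      proof (rule inj_onI)
        fix v w assume vw: "v \<in> words n" "w \<in> words n" "\<gamma> v = \<gamma> w"
        obtain i where i: "v = (b ^^ i) (zs (length v))" using ex[OF vw(1) b(2)] by blast
        obtain j where j: "w = (b ^^ j) (zs (length w))" using ex[OF vw(2) b(2)] by blast
        have e: "(\<tau> ^^ i) (zs (length v)) = (\<tau> ^^ j) (zs (length w))"
          using vw(3) g[of i "length v"] g[of j "length w"] i j by simp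
        then have l: "length v = length w" using len(1)[OF tau_Aut] by metis
        have "(b ^^ i) (zs (length v)) = (b ^^ j) (zs (length v))"
          by (rule cyclic_same_exponents[OF tau_Aut tau_cyclic b]) (use e l in simp)
        then show "v = w" using i j l by simp
      qed
      show "\<gamma> ` words n = words n"
      proof
        show "\<gamma> ` words n \<subseteq> words n" using len(2)[OF tau_Aut] by (auto simp: \<gamma>_def)
        show "words n \<subseteq> \<gamma> ` words n"
        proof
          fix w assume "w \<in> words n"
          then obtain j where "w = (\<tau> ^^ j) (zs (length w))" using ex tau_cyclic by blast
          then have "w = \<gamma> ((b ^^ j) (zs (length w)))" using g by simp
          then show "w \<in> \<gamma> ` words n" using len(2)[OF b(1)] by blast
        qed
      qed
    qed
    then show "\<gamma> permutes words n" by (rule bij_imp_permutes) (simp add: \<gamma>_def)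
    fix w assume w: "w \<in> words n"
    then show "length (\<gamma> w) = length w" using len(1)[OF tau_Aut] by (simp add: \<gamma>_def)
    obtain j where j: "w = (b ^^ j) (zs (length w))" using ex[OF w b(2)] by blast
    have bl: "butlast ((f ^^ j) (zs k)) = (f ^^ j) (zs (k - 1))" if "f \<in> Aut" for f k
      using Aut_butlast[OF funpow_Aut[OF that], of "zs k" j] by (simp add: butlast_conv_take)
    have "\<gamma> (butlast w) = \<gamma> ((b ^^ j) (zs (length w - 1)))" using bl[OF b(1), of "length w"] j by simp
    also have "\<dots> = butlast ((\<tau> ^^ j) (zs (length w)))" unfolding g bl[OF tau_Aut] ..
    also have "\<dots> = butlast (\<gamma> w)" using g[of j "length w"] j by simp
    finally show "\<gamma> (butlast w) = butlast (\<gamma> w)" .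
  qed
  have "\<gamma> (b w) = \<tau> (\<gamma> w)" if w: "w \<in> words n" for w
  proof -
    obtain j where j: "w = (b ^^ j) (zs (length w))" using ex[OF w b(2)] by blast
    have "\<gamma> (b w) = \<gamma> ((b ^^ Suc j) (zs (length w)))" using j by simp
    also have "\<dots> = \<tau> ((\<tau> ^^ j) (zs (length w)))" unfolding g by simp
    also have "\<dots> = \<tau> (\<gamma> w)" using g[of j "length w"] j by simp
    finally show ?thesis .
  qed
  then have "\<gamma> \<circ> b = \<tau> \<circ> \<gamma>" using gA b by (intro Aut_eqI) auto
  then have "conj_by \<gamma> b = \<tau>" using conj_by_eq_iff[OF Aut_bij[OF gA]] by blast
  then show ?thesis using gA by blast
qed

text \<open>
The centralizer of \<open>\<tau>\<close> among the automorphisms of the tree.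
\<close>

definition tau_centralizer :: "(nat list \<Rightarrow> nat list) set"
  where "tau_centralizer = {f \<in> Aut. f \<circ> \<tau> = \<tau> \<circ> f}"

lemma centralizer_commutes_pow:
  assumes "f \<in> tau_centralizer" shows "f ((\<tau> ^^ j) w) = (\<tau> ^^ j) (f w)"
  using assms by (induction j) (auto simp: tau_centralizer_def fun_eq_iff)

lemma centralizer_level_pow:
  assumes f: "f \<in> tau_centralizer"
  shows "\<exists>j. \<forall>w\<in>words n. length w = k \<longrightarrow> f w = (\<tau> ^^ j) w"
proof -
  have fa: "f \<in> Aut" using f by (simp add: tau_centralizer_def)
  obtain j where j: "(\<tau> ^^ j) (zs k) = f (zs k)"
    using tau_cyclic[of k] fa unfolding cyclic_on_level_def by (metis Aut_length Aut_words length_replicate n_pos(1) words_replicate)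
  have "f w = (\<tau> ^^ j) w" if w: "w \<in> words n" "length w = k" for w
  proof -
    obtain i where i: "(\<tau> ^^ i) (zs k) = w" using tau_cyclic[of k] w unfolding cyclic_on_level_def by blast
    have "f w = (\<tau> ^^ i) ((\<tau> ^^ j) (zs k))" using centralizer_commutes_pow[OF f, of i "zs k"] i j by simp
    also have "\<dots> = (\<tau> ^^ j) ((\<tau> ^^ i) (zs k))"
      by (simp add: funpow_add[symmetric, THEN fun_cong, unfolded o_apply] add.commute)
    finally show ?thesis using i by simp
  qed
  then show ?thesis by blast
qed

lemma centralizer_abelian: "abelian tau_centralizer"
  unfolding abelian_def
proof (intro ballI)
  fix f g assume f: "f \<in> tau_centralizer" and g: "g \<in> tau_centralizer"
  have a: "f \<in> Aut" "g \<in> Aut" using f g by (auto simp: tau_centralizer_def)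
  show "f \<circ> g = g \<circ> f"
  proof (rule Aut_eqI)
    fix w assume w: "w \<in> words n"
    obtain j where "\<forall>v\<in>words n. length v = length w \<longrightarrow> f v = (\<tau> ^^ j) v"
      using centralizer_level_pow[OF f] by blast
    then have "f (g w) = (\<tau> ^^ j) (g w)" "f w = (\<tau> ^^ j) w" using w a by (simp_all add: Aut_words Aut_length)
    then show "(f \<circ> g) w = (g \<circ> f) w" using centralizer_commutes_pow[OF g] by simp
  qed (use a in auto)
qed

lemma level_coset_iff:
  assumes f: "f \<in> Aut"
  shows "g \<in> f <#\<^bsub>tree_aut n\<^esub> level_stabilizer n k \<longleftrightarrow>
    g \<in> Aut \<and> (\<forall>w\<in>words n. length w = k \<longrightarrow> g w = f w)"
proof
  assume "g \<in> f <#\<^bsub>tree_aut n\<^esub> level_stabilizer n k"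
  then obtain s where s: "s \<in> level_stabilizer n k" "g = s \<circ> f" by (auto simp: l_coset_def)
  then show "g \<in> Aut \<and> (\<forall>w\<in>words n. length w = k \<longrightarrow> g w = f w)"
    using f by (auto simp: level_stabilizer_def Aut_words Aut_length)
next
  assume g: "g \<in> Aut \<and> (\<forall>w\<in>words n. length w = k \<longrightarrow> g w = f w)"
  have i: "iv f w \<in> words n" "length (iv f w) = length w" if "w \<in> words n" for w
    using that f by (simp_all add: Aut_words Aut_length)
  have "g \<circ> iv f \<in> level_stabilizer n k" using f g i by (auto simp: level_stabilizer_def)
  moreover have "g = (g \<circ> iv f) \<circ> f" using f by (simp add: fun_eq_iff)
  ultimately show "g \<in> f <#\<^bsub>tree_aut n\<^esub> level_stabilizer n k"
    unfolding l_coset_def by auto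
qed

lemma agree_lower_level:
  assumes f: "f \<in> Aut" "g \<in> Aut" and km: "k \<le> m" and e: "\<forall>w\<in>words n. length w = m \<longrightarrow> g w = f w"
    and w: "w \<in> words n" "length w = k"
  shows "g w = f w"
proof -
  have v: "w @ zs (m - k) \<in> words n" "length (w @ zs (m - k)) = m" using w km by auto
  then have "g (w @ zs (m - k)) = f (w @ zs (m - k))" using e by blast
  then show ?thesis using Aut_take[OF f(1) v(1)] Aut_take[OF f(2) v(1)] by simp
qed

text \<open>
  Every open neighbourhood of \<open>f\<close> contains all automorphisms that agree with \<open>f\<close> on some level.
\<close>

lemma profinite_nhd:
  assumes "generate_topology_on {f <#\<^bsub>tree_aut n\<^esub> level_stabilizer n k | f k. f \<in> carrier (tree_aut n)} U"
    and "f \<in> U"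
  shows "f \<in> Aut \<and> (\<exists>k. \<forall>g\<in>Aut. (\<forall>w\<in>words n. length w = k \<longrightarrow> g w = f w) \<longrightarrow> g \<in> U)"
  using assms
proof (induction rule: generate_topology_on.induct)
  case Empty
  then show ?case by simp
next
  case (Int a b)
  have fab: "f \<in> a" "f \<in> b" using Int.prems by auto
  obtain k where k: "f \<in> Aut" "\<forall>g\<in>Aut. (\<forall>w\<in>words n. length w = k \<longrightarrow> g w = f w) \<longrightarrow> g \<in> a"
    using Int.IH(1)[OF fab(1)] by (elim conjE exE)
  obtain l where l: "\<forall>g\<in>Aut. (\<forall>w\<in>words n. length w = l \<longrightarrow> g w = f w) \<longrightarrow> g \<in> b"
    using Int.IH(2)[OF fab(2)] by (elim conjE exE)
  have "g \<in> a \<inter> b" if g: "g \<in> Aut" "\<forall>w\<in>words n. length w = max k l \<longrightarrow> g w = f w" for g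
  proof -
    have "\<forall>w\<in>words n. length w = m \<longrightarrow> g w = f w" if "m \<le> max k l" for m
      using agree_lower_level[OF k(1) g(1) that g(2)] by blast
    from this[of k] this[of l]
    have "\<forall>w\<in>words n. length w = k \<longrightarrow> g w = f w" "\<forall>w\<in>words n. length w = l \<longrightarrow> g w = f w" by auto
    then show ?thesis using k(2)[rule_format, OF g(1)] l[rule_format, OF g(1)] by simp
  qed
  then show ?case using k(1) by (intro conjI exI[of _ "max k l"] ballI impI)
next
  case (UN K)
  then obtain a where a: "a \<in> K" "f \<in> a" by blast
  have f: "f \<in> Aut \<and> (\<exists>k. \<forall>g\<in>Aut. (\<forall>w\<in>words n. length w = k \<longrightarrow> g w = f w) \<longrightarrow> g \<in> a)"
    using UN.IH[OF a] .
  then obtain k where "\<forall>g\<in>Aut. (\<forall>w\<in>words n. length w = k \<longrightarrow> g w = f w) \<longrightarrow> g \<in> a" by (elim conjE exE)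
  then have "\<forall>g\<in>Aut. (\<forall>w\<in>words n. length w = k \<longrightarrow> g w = f w) \<longrightarrow> g \<in> \<Union>K" using a(1) by (meson UnionI)
  then show ?case using f by (intro conjI exI[of _ k]) simp_all
next
  case (Basis s)
  then obtain h k where h: "s = h <#\<^bsub>tree_aut n\<^esub> level_stabilizer n k" "h \<in> Aut" by auto
  have "f \<in> Aut" "\<forall>w\<in>words n. length w = k \<longrightarrow> f w = h w"
    using Basis.prems unfolding h(1) level_coset_iff[OF h(2)] by auto
  then show ?case unfolding h(1) level_coset_iff[OF h(2)] by (intro conjI exI[of _ k]) simp_all
qed

lemma generate_tau:
  shows "\<tau> ^^ j \<in> generate (tree_aut n) {\<tau>}"
    and "f \<in> generate (tree_aut n) {\<tau>} \<Longrightarrow> f \<in> tau_centralizer"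
proof -
  show "\<tau> ^^ j \<in> generate (tree_aut n) {\<tau>}"
  proof (induction j)
    case 0
    show ?case using generate.one[of "tree_aut n"] by (simp only: funpow.simps tree_aut_simps)
  next
    case (Suc j)
    then show ?case
      using generate.eng[OF Suc generate.incl[of \<tau>]] by (simp only: funpow.simps tree_aut_simps insert_iff simp_thms)
  qed
  assume "f \<in> generate (tree_aut n) {\<tau>}"
  then show "f \<in> tau_centralizer"
  proof (induction rule: generate.induct)
    case one
    show ?case unfolding tree_aut_simps tau_centralizer_def mem_Collect_eq id_comp comp_id
      using id_Aut by blast
  next
    case (incl h)
    then show ?case by (simp add: tau_centralizer_def)
  next
    case (inv h)
    then show ?case by (auto simp: tau_centralizer_def)
  next
    case (eng f g)
    then have "f \<in> Aut" "g \<in> Aut" "\<And>x. f (\<tau> x) = \<tau> (f x)" "\<And>x. g (\<tau> x) = \<tau> (g x)"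
      by (auto simp: tau_centralizer_def fun_eq_iff)
    moreover from this have "g \<circ> f \<circ> \<tau> = \<tau> \<circ> (g \<circ> f)" by (simp add: fun_eq_iff)
    ultimately show ?case unfolding tau_centralizer_def tree_aut_simps by (intro CollectI conjI comp_Aut)
  qed
qed

text \<open>
  On each level an automorphism commuting with \<open>\<tau>\<close> is a power of \<open>\<tau>\<close>, since \<open>\<tau>\<close> is transitive there.
\<close>

lemma closure_tau:
  "profinite_topology n closure_of generate (tree_aut n) {\<tau>} = tau_centralizer"
proof
  let ?S = "{f <#\<^bsub>tree_aut n\<^esub> level_stabilizer n k | f k. f \<in> carrier (tree_aut n)}"
  have op: "openin (profinite_topology n) U \<longleftrightarrow> generate_topology_on ?S U" for U
    unfolding profinite_topology_def by (rule openin_topology_generated_by_iff)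
  have opc: "openin (profinite_topology n) (f <#\<^bsub>tree_aut n\<^esub> level_stabilizer n k)" if "f \<in> Aut" for f k
    unfolding op using that by (intro generate_topology_on.Basis) auto
  show "profinite_topology n closure_of generate (tree_aut n) {\<tau>} \<subseteq> tau_centralizer"
  proof
    fix g assume g: "g \<in> profinite_topology n closure_of generate (tree_aut n) {\<tau>}"
    then have "g \<in> topspace (profinite_topology n)" by (simp add: in_closure_of)
    moreover have "generate_topology_on ?S (topspace (profinite_topology n))" unfolding op[symmetric] by simp
    ultimately have ga: "g \<in> Aut" using profinite_nhd by blast
    have "g (\<tau> w) = \<tau> (g w)" if w: "w \<in> words n" for w
    proof -
      have "g \<in> g <#\<^bsub>tree_aut n\<^esub> level_stabilizer n (length w)" using ga level_coset_iff[OF ga] by simp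
      then obtain y where y: "y \<in> generate (tree_aut n) {\<tau>}" "y \<in> g <#\<^bsub>tree_aut n\<^esub> level_stabilizer n (length w)"
        using g opc[OF ga, of "length w"] unfolding in_closure_of by blast
      have "y (\<tau> w) = g (\<tau> w)" "y w = g w"
        using y(2) w unfolding level_coset_iff[OF ga] by (auto simp: Aut_words Aut_length)
      moreover have "y (\<tau> w) = \<tau> (y w)"
        using generate_tau(2)[OF y(1)] by (auto simp: tau_centralizer_def fun_eq_iff)
      ultimately show ?thesis by simp
    qed
    then show "g \<in> tau_centralizer" using ga unfolding tau_centralizer_def
      by (auto intro!: Aut_eqI)
  qed
  show "tau_centralizer \<subseteq> profinite_topology n closure_of generate (tree_aut n) {\<tau>}"
  proof
    fix g assume g: "g \<in> tau_centralizer"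
    then have ga: "g \<in> Aut" by (simp add: tau_centralizer_def)
    have "g \<in> topspace (profinite_topology n)"
      by (rule subsetD[OF openin_subset[OF opc[OF ga, of 0]]]) (simp add: level_coset_iff ga)
    moreover have "\<exists>y. y \<in> generate (tree_aut n) {\<tau>} \<and> y \<in> U" if U: "g \<in> U" "openin (profinite_topology n) U" for U
    proof -
      obtain k where k: "\<forall>h\<in>Aut. (\<forall>w\<in>words n. length w = k \<longrightarrow> h w = g w) \<longrightarrow> h \<in> U"
        using profinite_nhd[OF U(2)[unfolded op] U(1)] by (elim conjE exE)
      obtain j where "\<forall>w\<in>words n. length w = k \<longrightarrow> g w = (\<tau> ^^ j) w"
        using centralizer_level_pow[OF g] by blast
      then have "\<tau> ^^ j \<in> U" using k by simp
      then show ?thesis using generate_tau(1) by blast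
    qed
    ultimately show "g \<in> profinite_topology n closure_of generate (tree_aut n) {\<tau>}"
      unfolding in_closure_of by blast
  qed
qed

text \<open>
  The conjugate of \<open>c\<close> by \<open>x\<close> commutes with \<open>\<tau>\<close> because \<open>c\<close> commutes with the conjugate of \<open>\<tau>\<close> by the
  inverse of \<open>x\<close>, the centralizer of \<open>\<tau>\<close> being abelian.
\<close>

lemma conj_centralizer:
  assumes x: "x \<in> Aut" "conj_by (iv x) \<tau> \<in> tau_centralizer" and c: "c \<in> tau_centralizer"
  shows "conj_by x c \<in> tau_centralizer"
proof -
  have ca: "c \<in> Aut" using c by (simp add: tau_centralizer_def)
  have e: "conj_by x (conj_by (iv x) \<tau>) = \<tau>" using x by (simp add: conj_by_def fun_eq_iff)
  have "c \<circ> conj_by (iv x) \<tau> = conj_by (iv x) \<tau> \<circ> c"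
    using centralizer_abelian c x(2) unfolding abelian_def by blast
  then have "conj_by x (c \<circ> conj_by (iv x) \<tau>) = conj_by x (conj_by (iv x) \<tau> \<circ> c)" by simp
  then have "conj_by x c \<circ> \<tau> = \<tau> \<circ> conj_by x c"
    unfolding conj_by_comp[OF Aut_bij[OF x(1)]] e .
  then show ?thesis using x ca by (simp add: tau_centralizer_def)
qed

section \<open>Conjugation into the groups of the theorem\<close>

lemma good_pair_conj_into_Gamma:
  assumes n: "prime n \<or> n = 4" and Q: "good_pair G B"
  shows "conj_into_Gamma G"
proof -
  note P = good_pairD(1)[OF Q]
  note G = tau_pairD[OF P]
  note au = tau_pair_Aut[OF P]
  obtain r where r: "prime r" "n = r \<or> n = 4 \<and> r = 2" using n two_is_prime_nat by blast
  obtain b where b: "b \<in> B" "rp b = \<sigma>" using good_pairD(2)[OF Q] by auto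
  have "rp b 0 = 1" using b n2 by (simp add: cyc_def)
  then have "\<not> r dvd rp b 0" using r(1) by auto
  then have "cyclic_on_level b k" for k using cyclic_on_level_of_generating[OF r Q b(1)] by blast
  then obtain \<gamma> where g: "\<gamma> \<in> Aut" "conj_by \<gamma> b = \<tau>" using conj_to_tau au(1)[OF b(1)] by blast
  have gb: "bij \<gamma>" using Aut_bij[OF g(1)] .
  have cent: "conj_by (conj_by \<gamma> h) \<tau> \<in> tau_centralizer" if h: "h \<in> G" for h
  proof -
    have ha: "h \<in> Aut" using au h by blast
    have c: "conj_by h b \<in> B" using G b h by blast
    have "conj_by (conj_by \<gamma> h) \<tau> = conj_by \<gamma> (conj_by h b)"
      using g ha unfolding g(2)[symmetric] by (simp add: conj_by_def fun_eq_iff iv_distrib)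
    moreover have "conj_by h b \<circ> b = b \<circ> conj_by h b" using G(4) b c unfolding abelian_def by blast
    then have "conj_by \<gamma> (conj_by h b) \<circ> \<tau> = \<tau> \<circ> conj_by \<gamma> (conj_by h b)"
      unfolding g(2)[symmetric] conj_by_comp[OF gb, symmetric] by simp
    ultimately show ?thesis using g ha au(1)[OF c] by (simp add: tau_centralizer_def)
  qed
  interpret T: group "tree_aut n" by (rule group_tree_aut)
  have "conj_by \<gamma> h \<in> Gamma n 0" if h: "h \<in> G" for h
  proof -
    have ha: "h \<in> Aut" using au h by blast
    define x where "x = conj_by \<gamma> h"
    have x: "x \<in> Aut" using g ha by (simp add: x_def)
    have ix: "iv x = conj_by \<gamma> (iv h)" using g ha by (simp add: x_def conj_by_def iv_distrib o_assoc)
    have c1: "conj_by x \<tau> \<in> tau_centralizer" unfolding x_def by (rule cent[OF h])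
    have c2: "conj_by (iv x) \<tau> \<in> tau_centralizer" unfolding ix by (rule cent[OF subgp_iv[OF G(1) h]])
    have "\<forall>c\<in>tau_centralizer. x \<otimes>\<^bsub>tree_aut n\<^esub> c \<otimes>\<^bsub>tree_aut n\<^esub> inv\<^bsub>tree_aut n\<^esub> x \<in> tau_centralizer \<and>
      inv\<^bsub>tree_aut n\<^esub> x \<otimes>\<^bsub>tree_aut n\<^esub> c \<otimes>\<^bsub>tree_aut n\<^esub> x \<in> tau_centralizer"
    proof
      fix c assume c: "c \<in> tau_centralizer"
      have "conj_by x c \<in> tau_centralizer" by (rule conj_centralizer[OF x c2 c])
      moreover have "conj_by (iv x) c \<in> tau_centralizer"
        using conj_centralizer[OF iv_Aut[OF x] _ c] c1 x by simp
      ultimately show "x \<otimes>\<^bsub>tree_aut n\<^esub> c \<otimes>\<^bsub>tree_aut n\<^esub> inv\<^bsub>tree_aut n\<^esub> x \<in> tau_centralizer \<and>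
          inv\<^bsub>tree_aut n\<^esub> x \<otimes>\<^bsub>tree_aut n\<^esub> c \<otimes>\<^bsub>tree_aut n\<^esub> x \<in> tau_centralizer"
        using x by (simp add: conj_by_def o_assoc)
    qed
    then have "x \<in> normalizer (tree_aut n) tau_centralizer"
      using T.normalizer_iff[of tau_centralizer x] x by (auto simp: tau_centralizer_def)
    then show ?thesis by (simp add: x_def closure_tau)
  qed
  then show ?thesis unfolding conj_into_Gamma_def using g(1) by blast
qed

lemma solvable_conj_into_Gamma:
  assumes n: "prime n \<or> n = 4" and G: "subgp G" "\<tau> \<in> G" and c: "solv_chain G H d"
  shows "conj_into_Gamma G"
proof -
  have H: "H 0 = G" "H d = {id}" "\<And>i. subgp (H i)" "\<And>i. normalizes G (H i)"
    "\<And>i x y. x \<in> H i \<Longrightarrow> y \<in> H i \<Longrightarrow> conj_by x y \<circ> iv y \<in> H (Suc i)" "\<And>i. H i \<subseteq> G"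
    using c by (auto simp: solv_chain_def)
  have "\<tau> \<noteq> id" using cyc_neq_id root_tau root_id by metis
  then have "\<exists>h\<in>H 0. h \<noteq> id" using G(2) H(1) by blast
  moreover have "\<not> (\<exists>h\<in>H d. h \<noteq> id)" using H(2) by simp
  ultimately obtain j where j: "\<exists>h\<in>H j. h \<noteq> id" "\<not> (\<exists>h\<in>H (Suc j). h \<noteq> id)"
    using last_nontrivial[of "\<lambda>i. \<exists>h\<in>H i. h \<noteq> id" d] by blast
  have "abelian (H j)"
    unfolding abelian_def
  proof (intro ballI)
    fix x y assume xy: "x \<in> H j" "y \<in> H j"
    have a: "x \<in> Aut" "y \<in> Aut" using xy subgp_Aut[OF H(3)] by auto
    have e: "conj_by x y \<circ> iv y = id" using j(2) H(5)[OF xy] by blast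
    have "conj_by x y = conj_by x y \<circ> iv y \<circ> y" using a by (simp add: fun_eq_iff)
    then have "conj_by x y = y" unfolding e by simp
    then show "x \<circ> y = y \<circ> x" using conj_by_eq_iff[of x y y] Aut_bij[OF a(1)] by simp
  qed
  then have P: "tau_pair G (H j)" using G H by (simp add: tau_pair_def)
  obtain b where b: "b \<in> H j" "b \<noteq> id" using j(1) by blast
  have "\<exists>w\<in>words n. b w \<noteq> w" using b Aut_eqI[of b id] subgp_Aut[OF H(3) b(1)] by auto
  then show ?thesis
    using descend_to_good_pair[OF n _ P c b(1)] good_pair_conj_into_Gamma[OF n] by blast
qed

text \<open>
  Inverses in the record with carrier \<open>\<Gamma>\<^sub>i\<close> are determined by the two-sided equations with the
  identity, so nothing about \<open>\<Gamma>\<^sub>i\<close> itself has to be known.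
\<close>

lemma conj_subgroup_Gamma:
  assumes G: "subgp G" and \<gamma>: "\<gamma> \<in> Aut" "\<And>g. g \<in> G \<Longrightarrow> conj_by \<gamma> g \<in> Gamma n i"
  shows "subgroup (inv\<^bsub>tree_aut n\<^esub> \<gamma> <#\<^bsub>tree_aut n\<^esub> G #>\<^bsub>tree_aut n\<^esub> \<gamma>) (tree_aut n \<lparr>carrier := Gamma n i\<rparr>)"
proof -
  have eq: "inv\<^bsub>tree_aut n\<^esub> \<gamma> <#\<^bsub>tree_aut n\<^esub> G #>\<^bsub>tree_aut n\<^esub> \<gamma> = conj_by \<gamma> ` G"
    using \<gamma>(1) by (auto simp: l_coset_def r_coset_def conj_by_def o_assoc)
  let ?K = "tree_aut n \<lparr>carrier := Gamma n i\<rparr>"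
  have gb: "bij \<gamma>" using Aut_bij[OF \<gamma>(1)] .
  show ?thesis
    unfolding eq
  proof (rule subgroup.intro)
    show "conj_by \<gamma> ` G \<subseteq> carrier ?K" using \<gamma>(2) by auto
    show "\<one>\<^bsub>?K\<^esub> \<in> conj_by \<gamma> ` G"
      using subgp_id[OF G] \<gamma>(1) by (intro image_eqI[of _ _ id]) (simp_all add: conj_by_def)
    fix x assume "x \<in> conj_by \<gamma> ` G"
    then obtain g where g: "x = conj_by \<gamma> g" "g \<in> G" by blast
    have ga: "g \<in> Aut" using subgp_Aut[OF G g(2)] .
    have x: "x \<in> Aut" using ga \<gamma>(1) g by simp
    have ix: "iv x = conj_by \<gamma> (iv g)" using \<gamma>(1) ga by (simp add: g(1) conj_by_def iv_distrib o_assoc)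
    have "inv\<^bsub>?K\<^esub> x = iv x"
      unfolding m_inv_def
    proof (rule the_equality)
      show "iv x \<in> carrier ?K \<and> x \<otimes>\<^bsub>?K\<^esub> iv x = \<one>\<^bsub>?K\<^esub> \<and> iv x \<otimes>\<^bsub>?K\<^esub> x = \<one>\<^bsub>?K\<^esub>"
        using x \<gamma>(2)[OF subgp_iv[OF G g(2)]] unfolding ix[symmetric] by simp
      fix y assume "y \<in> carrier ?K \<and> x \<otimes>\<^bsub>?K\<^esub> y = \<one>\<^bsub>?K\<^esub> \<and> y \<otimes>\<^bsub>?K\<^esub> x = \<one>\<^bsub>?K\<^esub>"
      then have "y \<circ> x = id" "x \<circ> y = id" by auto
      then show "y = iv x" using inv_unique_comp by metis
    qed
    then show "inv\<^bsub>?K\<^esub> x \<in> conj_by \<gamma> ` G" using ix subgp_iv[OF G g(2)] by auto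
    fix y assume "y \<in> conj_by \<gamma> ` G"
    then obtain h where h: "y = conj_by \<gamma> h" "h \<in> G" by blast
    have "x \<otimes>\<^bsub>?K\<^esub> y = conj_by \<gamma> (h \<circ> g)" unfolding g(1) h(1) conj_by_comp[OF gb] by simp
    then show "x \<otimes>\<^bsub>?K\<^esub> y \<in> conj_by \<gamma> ` G" using subgp_comp[OF G h(2) g(2)] by blast
  qed
qed

end

theorem theoremA:
  fixes n :: nat and G :: "(nat list \<Rightarrow> nat list) set"
  assumes "Factorial_Ring.prime n \<or> n = 4"
    and "subgroup G (tree_aut n)"
    and "solvable (tree_aut n \<lparr>carrier := G\<rparr>)"
    and "adding_machine n \<in> G"
  shows "\<exists>i. \<exists>\<gamma>\<in>carrier (tree_aut n).
    subgroup (inv\<^bsub>tree_aut n\<^esub> \<gamma> <#\<^bsub>tree_aut n\<^esub> G #>\<^bsub>tree_aut n\<^esub> \<gamma>)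
      (tree_aut n \<lparr>carrier := Gamma n i\<rparr>)"
proof -
  interpret regular_tree n
    using assms(1) prime_ge_2_nat by unfold_locales auto
  have G: "subgp G" using assms(2) by (simp add: subgroup_tree_aut_iff)
  obtain H d where "solv_chain G H d" using solvable_imp_solv_chain[OF G assms(3)] by blast
  then have "conj_into_Gamma G" by (rule solvable_conj_into_Gamma[OF assms(1) G assms(4)])
  then show ?thesis using conj_subgroup_Gamma[OF G] unfolding conj_into_Gamma_def tree_aut_simps by blast
qed

end
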